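(* Let $p$ be an odd prime, $n\ge2$, $I=(1,n-1)$, and let $P(I)=P(1,n-1)$. Let $H^*(V)=E_{\mathbb F_p}(x_1,\dots,x_n)\otimes\mathbb F_p[y_1,\dots,y_n]$ and $\mathbb F_p(I)=\mathbb F_p[y_1,\dots,y_n]^{P(I)}$. Then $$\mathbb F_p(I)=\mathbb F_p[h_1^{p-1},\,d_{n,i}(I)\ |\ 1\le i\le n-1]$$ (a polynomial algebra on these generators), and $$H^*(V)^{P(I)}\cong \mathbb F_p(I)\oplus\mathbb F_p(I)\,M_{1,0}h_1^{p-2}\oplus\bigoplus_{t_1,\dots,t_k}\mathbb F_p(I)\,M_{n,t_1,\dots,t_k}L_n^{p-2},$$ where the last sum is over all $k\ge1$ and all sequences $0\le t_1<\dots<t_k\le n-1$ with $1\le t_k$ (the right-hand side being a free $\mathbb F_p(I)$-module on the displayed elements together with $1$).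
   Context: $H^*(V)=H^*(V;\mathbb F_p)$ for $V=\mathbb F_p^n$, with $|x_i|=1$ and $|y_i|=2$. $GL(n,\mathbb F_p)$ acts by algebra automorphisms with $(a_{ij})x_k=\sum_i a_{ik}x_i$ and $(a_{ij})y_k=\sum_i a_{ik}y_i$. $P(k,n-k)=\left\{\begin{pmatrix}A&C\\0&B\end{pmatrix}: A\in GL(k,\mathbb F_p),\ B\in GL(n-k,\mathbb F_p)\right\}$. $h_j=\prod_{v\in\langle y_1,\dots,y_{j-1}\rangle}(y_j-v)$ (so $h_1=y_1$), $\langle\cdots\rangle$ denoting $\mathbb F_p$-linear span, and $L_n=\prod_{j=1}^n h_j$. For $1\le i\le n-1$, $d_{n,n-i}(I)$ is obtained from the expression of the Dickson invariant $d_{n,n-i}=\sum_{1\le j_1<\dots<j_i\le n}\prod_{s=1}^i (h_{j_s}^{p-1})^{p^{\,n-i+s-j_s}}$ by putting $h_1^{p-1}=0$; that is, $d_{n,n-i}(I)=\sum_{2\le j_1<\dots<j_i\le n}\prod_{s=1}^i (h_{j_s}^{p-1})^{p^{\,n-i+s-j_s}}$. For $0\le s_1<\dots<s_k\le m-1$, $M_{m,s_1,\dots,s_k}=\frac1{k!}\det(\cdot)$, where the $m\times m$ matrix has $k$ first columns all equal to $(x_1,\dots,x_m)^T$ followed by the columns $(y_1^{p^j},\dots,y_m^{p^j})^T$ for $j\in\{0,\dots,m-1\}\setminus\{s_1,\dots,s_k\}$ in increasing order. The determinant is the signed sum over permutations of products of entries taken in column order, computed (and divided by $k!$) in $E_{\mathbb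 Z}(x_1,\dots,x_m)\otimes\mathbb Z[y_1,\dots,y_m]$, then reduced mod $p$. In particular $M_{1,0}=x_1$. *)

theory Defs
  imports
    "HOL-Library.Poly_Mapping"
    "HOL-Combinatorics.Permutations"
    "Jordan_Normal_Form.Matrix"
    "Berlekamp_Zassenhaus.Finite_Field"
begin

text \<open>
  All indices are shifted down by one: the generators of the cohomology of \<open>(\<int>/p)^n\<close> are
  \<open>x_0, \<dots>, x_{n-1}\<close> (degree 1) and \<open>y_0, \<dots>, y_{n-1}\<close> (degree 2), matching the row and column
  numbering of matrices.  Polynomials live in countably many variables, and the exterior
  algebra has countably many generators; the algebras in \<open>n\<close> variables are the subsets
  \<open>poly_ring n\<close> and \<open>cohom n\<close> below.
\<close>

subsection \<open>Polynomials\<close>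

type_synonym 'a mpoly = "(nat \<Rightarrow>\<^sub>0 nat) \<Rightarrow>\<^sub>0 'a"

definition mconst :: "'a::comm_ring_1 \<Rightarrow> 'a mpoly" where
  "mconst c = Poly_Mapping.single 0 c"

definition ygen :: "nat \<Rightarrow> 'a::comm_ring_1 mpoly" where
  "ygen i = Poly_Mapping.single (Poly_Mapping.single i 1) 1"

definition poly_ring :: "nat \<Rightarrow> 'a::comm_ring_1 mpoly set" where
  "poly_ring n = {f. \<forall>m \<in> Poly_Mapping.keys f. Poly_Mapping.keys m \<subseteq> {..<n}}"

definition msubst :: "(nat \<Rightarrow> 'a::comm_ring_1 mpoly) \<Rightarrow> 'a mpoly \<Rightarrow> 'a mpoly" where
  "msubst g f = (\<Sum>m \<in> Poly_Mapping.keys f. mconst (Poly_Mapping.lookup f m) * (\<Prod>i \<in> Poly_Mapping.keys m. g i ^ Poly_Mapping.lookup m i))"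

subsection \<open>Exterior algebras\<close>

text \<open>
  The exterior algebra over a commutative ring on generators \<open>x_0, x_1, \<dots>\<close>, an element
  being given by its coefficients with respect to the basis of the monomials
  \<open>x_S = x_{s_1} \<cdots> x_{s_k}\<close>, for \<open>S = {s_1 < \<dots> < s_k}\<close>.  The algebra \<open>E(x) \<otimes> R[y]\<close> is the
  exterior algebra over \<open>R[y]\<close>.
\<close>

typedef (overloaded) 'a ext =
  "{f :: nat set \<Rightarrow> 'a::zero. \<exists>n. \<forall>S. \<not> S \<subseteq> {..<n} \<longrightarrow> f S = 0}"
  morphisms ext_coeff Abs_ext
  by (rule exI[of _ "\<lambda>_. 0"]) simp

setup_lifting type_definition_ext

lemma ext_eqI: "(\<And>S. ext_coeff f S = ext_coeff g S) \<Longrightarrow> f = g"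
  by (simp add: ext_coeff_inject[symmetric] fun_eq_iff)

lemma ext_coeff_infinite: "infinite S \<Longrightarrow> ext_coeff f S = 0"
  by transfer (metis finite_lessThan finite_subset)

text \<open>For disjoint \<open>A\<close> and \<open>B\<close>, \<open>x_A x_B = shuffle_sign A B \<cdot> x_{A \<union> B}\<close>.\<close>

definition shuffle_sign :: "nat set \<Rightarrow> nat set \<Rightarrow> 'a::ring_1" where
  "shuffle_sign A B = (-1) ^ card {(a, b). a \<in> A \<and> b \<in> B \<and> b < a}"

lemma shuffle_sign_Un_left:
  assumes "finite A" "finite B" "finite C" "A \<inter> B = {}"
  shows "shuffle_sign (A \<union> B) C = shuffle_sign A C * shuffle_sign B C"
proof -
  have "{(a, b). a \<in> A \<union> B \<and> b \<in> C \<and> b < a} =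
     {(a, b). a \<in> A \<and> b \<in> C \<and> b < a} \<union> {(a, b). a \<in> B \<and> b \<in> C \<and> b < a}"
    by auto
  moreover have "finite {(a, b). a \<in> A \<and> b \<in> C \<and> b < a}"
    by (rule finite_subset[of _ "A \<times> C"]) (use assms in auto)
  moreover have "finite {(a, b). a \<in> B \<and> b \<in> C \<and> b < a}"
    by (rule finite_subset[of _ "B \<times> C"]) (use assms in auto)
  ultimately show ?thesis
    using assms(4) unfolding shuffle_sign_def power_add[symmetric]
    by (subst card_Un_disjoint[symmetric]) auto
qed

lemma shuffle_sign_Un_right:
  assumes "finite A" "finite B" "finite C" "B \<inter> C = {}"
  shows "shuffle_sign A (B \<union> C) = shuffle_sign A B * shuffle_sign A C"
proof -
  have "{(a, b). a \<in> A \<and> b \<in> B \<union> C \<and> b < a} =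
     {(a, b). a \<in> A \<and> b \<in> B \<and> b < a} \<union> {(a, b). a \<in> A \<and> b \<in> C \<and> b < a}"
    by auto
  moreover have "finite {(a, b). a \<in> A \<and> b \<in> C \<and> b < a}"
    by (rule finite_subset[of _ "A \<times> C"]) (use assms in auto)
  moreover have "finite {(a, b). a \<in> A \<and> b \<in> B \<and> b < a}"
    by (rule finite_subset[of _ "A \<times> B"]) (use assms in auto)
  ultimately show ?thesis
    using assms(4) unfolding shuffle_sign_def power_add[symmetric]
    by (subst card_Un_disjoint[symmetric]) auto
qed

lemma shuffle_sign_empty [simp]: "shuffle_sign {} B = 1" "shuffle_sign A {} = 1"
  by (simp_all add: shuffle_sign_def)

lemma shuffle_sign_commute: "shuffle_sign A B * (r::'a::ring_1) = r * shuffle_sign A B"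
  unfolding shuffle_sign_def
  by (cases "even (card {(a, b). a \<in> A \<and> b \<in> B \<and> b < a})") auto

instantiation ext :: (comm_ring_1) ring_1
begin

lift_definition zero_ext :: "'a ext" is "\<lambda>_. 0" by simp

lift_definition one_ext :: "'a ext" is "\<lambda>S. if S = {} then 1 else 0" by simp

lift_definition uminus_ext :: "'a ext \<Rightarrow> 'a ext" is "\<lambda>f S. - f S" by auto

lift_definition plus_ext :: "'a ext \<Rightarrow> 'a ext \<Rightarrow> 'a ext" is "\<lambda>f g S. f S + g S"
proof -
  fix f g :: "nat set \<Rightarrow> 'a"
  assume "\<exists>n. \<forall>S. \<not> S \<subseteq> {..<n} \<longrightarrow> f S = 0" "\<exists>n. \<forall>S. \<not> S \<subseteq> {..<n} \<longrightarrow> g S = 0"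
  then obtain m n where "\<And>S. \<not> S \<subseteq> {..<m} \<Longrightarrow> f S = 0" "\<And>S. \<not> S \<subseteq> {..<n} \<Longrightarrow> g S = 0"
    by metis
  moreover have "\<not> S \<subseteq> {..<m}" "\<not> S \<subseteq> {..<n}" if "\<not> S \<subseteq> {..<max m n}" for S :: "nat set"
    using that by fastforce+
  ultimately show "\<exists>n. \<forall>S. \<not> S \<subseteq> {..<n} \<longrightarrow> f S + g S = 0"
    by (intro exI[of _ "max m n"]) simp
qed

lift_definition minus_ext :: "'a ext \<Rightarrow> 'a ext \<Rightarrow> 'a ext" is "\<lambda>f g S. f S - g S"
proof -
  fix f g :: "nat set \<Rightarrow> 'a"
  assume "\<exists>n. \<forall>S. \<not> S \<subseteq> {..<n} \<longrightarrow> f S = 0" "\<exists>n. \<forall>S. \<not> S \<subseteq> {..<n} \<longrightarrow> g S = 0"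
  then obtain m n where "\<And>S. \<not> S \<subseteq> {..<m} \<Longrightarrow> f S = 0" "\<And>S. \<not> S \<subseteq> {..<n} \<Longrightarrow> g S = 0"
    by metis
  moreover have "\<not> S \<subseteq> {..<m}" "\<not> S \<subseteq> {..<n}" if "\<not> S \<subseteq> {..<max m n}" for S :: "nat set"
    using that by fastforce+
  ultimately show "\<exists>n. \<forall>S. \<not> S \<subseteq> {..<n} \<longrightarrow> f S - g S = 0"
    by (intro exI[of _ "max m n"]) simp
qed

lift_definition times_ext :: "'a ext \<Rightarrow> 'a ext \<Rightarrow> 'a ext" is
  "\<lambda>f g S. \<Sum>A \<in> Pow S. shuffle_sign A (S - A) * f A * g (S - A)"
proof -
  fix f g :: "nat set \<Rightarrow> 'a"
  assume "\<exists>n. \<forall>S. \<not> S \<subseteq> {..<n} \<longrightarrow> f S = 0" "\<exists>n. \<forall>S. \<not> S \<subseteq> {..<n} \<longrightarrow> g S = 0"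
  then obtain m n where f: "\<And>S. \<not> S \<subseteq> {..<m} \<Longrightarrow> f S = 0"
    and g: "\<And>S. \<not> S \<subseteq> {..<n} \<Longrightarrow> g S = 0"
    by metis
  show "\<exists>n. \<forall>S. \<not> S \<subseteq> {..<n} \<longrightarrow>
      (\<Sum>A \<in> Pow S. shuffle_sign A (S - A) * f A * g (S - A)) = 0"
  proof (intro exI[of _ "max m n"] allI impI sum.neutral ballI)
    fix S A :: "nat set" assume S: "\<not> S \<subseteq> {..<max m n}" and "A \<in> Pow S"
    have "\<not> A \<subseteq> {..<m} \<or> \<not> S - A \<subseteq> {..<n}"
    proof (rule ccontr)
      assume "\<not> (\<not> A \<subseteq> {..<m} \<or> \<not> S - A \<subseteq> {..<n})"
      then have "S \<subseteq> {..<m} \<union> {..<n}" by blast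
      with S show False by fastforce
    qed
    then show "shuffle_sign A (S - A) * f A * g (S - A) = 0"
    proof
      assume "\<not> A \<subseteq> {..<m}"
      then show ?thesis using f[of A] by simp
    next
      assume "\<not> S - A \<subseteq> {..<n}"
      then show ?thesis using g[of "S - A"] by simp
    qed
  qed
qed

instance
proof
  fix f g h :: "'a ext"
  show "f + g + h = f + (g + h)" "f + g = g + f" "0 + f = f" "- f + f = 0"
    "f - g = f + - g"
    by (transfer; simp add: add_ac)+
  show "(0::'a ext) \<noteq> 1"
    by transfer (metis zero_neq_one)
  show "(f + g) * h = f * h + g * h"
    by transfer (simp add: algebra_simps sum.distrib)
  show "f * (g + h) = f * g + f * h"
    by transfer (simp add: algebra_simps sum.distrib)
  show "1 * f = f"
  proof (rule ext_eqI)
    fix S show "ext_coeff (1 * f) S = ext_coeff f S"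
    proof (cases "finite S")
      case True
      have "ext_coeff (1 * f) S = (\<Sum>A \<in> Pow S. if A = {} then ext_coeff f S else 0)"
        unfolding times_ext.rep_eq one_ext.rep_eq by (intro sum.cong) auto
      also have "\<dots> = ext_coeff f S" using True by simp
      finally show ?thesis .
    next
      case False
      then show ?thesis by (simp add: ext_coeff_infinite)
    qed
  qed
  show "f * 1 = f"
  proof (rule ext_eqI)
    fix S show "ext_coeff (f * 1) S = ext_coeff f S"
    proof (cases "finite S")
      case True
      have "ext_coeff (f * 1) S = (\<Sum>A \<in> Pow S. if A = S then ext_coeff f S else 0)"
        unfolding times_ext.rep_eq one_ext.rep_eq by (intro sum.cong) auto
      also have "\<dots> = ext_coeff f S" using True by simp
      finally show ?thesis .
    next
      case False
      then show ?thesis by (simp add: ext_coeff_infinite)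
    qed
  qed
  show "f * g * h = f * (g * h)"
  proof (rule ext_eqI)
    fix S show "ext_coeff (f * g * h) S = ext_coeff (f * (g * h)) S"
    proof (cases "finite S")
      case True
      let ?t = "\<lambda>A B C. shuffle_sign A B * shuffle_sign A C * shuffle_sign B C *
        ext_coeff f A * ext_coeff g B * ext_coeff h C"
      have "ext_coeff (f * g * h) S = (\<Sum>D \<in> Pow S. \<Sum>A \<in> Pow D. ?t A (D - A) (S - D))"
        unfolding times_ext.rep_eq sum_distrib_left sum_distrib_right
      proof (intro sum.cong refl)
        fix D A assume "D \<in> Pow S" "A \<in> Pow D"
        then have fin: "finite A" "finite (D - A)" "finite (S - D)" and D: "A \<union> (D - A) = D"
          using True by (auto intro: finite_subset)
        have "shuffle_sign D (S - D) =
            (shuffle_sign A (S - D) * shuffle_sign (D - A) (S - D) :: 'a)"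
          using shuffle_sign_Un_left[OF fin] D by auto
        then show "shuffle_sign D (S - D) *
            (shuffle_sign A (D - A) * ext_coeff f A * ext_coeff g (D - A)) * ext_coeff h (S - D)
          = ?t A (D - A) (S - D)"
          by (simp add: mult_ac)
      qed
      also have "\<dots> = (\<Sum>(D, A) \<in> Sigma (Pow S) Pow. ?t A (D - A) (S - D))"
        by (rule sum.Sigma) (use True in \<open>auto intro: finite_subset\<close>)
      also have "\<dots> = (\<Sum>(A, B) \<in> Sigma (Pow S) (\<lambda>A. Pow (S - A)). ?t A B (S - A - B))"
        by (rule sum.reindex_bij_witness
            [of _ "\<lambda>(A, B). (A \<union> B, A)" "\<lambda>(D, A). (A, D - A)"]) (auto intro!: arg_cong2[of _ _ _ _ "(*)"]
             arg_cong2[of _ _ _ _ shuffle_sign] arg_cong[of _ _ "ext_coeff h"])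
      also have "\<dots> = (\<Sum>A \<in> Pow S. \<Sum>B \<in> Pow (S - A). ?t A B (S - A - B))"
        by (rule sum.Sigma[symmetric]) (use True in auto)
      also have "\<dots> = ext_coeff (f * (g * h)) S"
        unfolding times_ext.rep_eq sum_distrib_left sum_distrib_right
      proof (intro sum.cong refl)
        fix A B assume "A \<in> Pow S" "B \<in> Pow (S - A)"
        then have fin: "finite A" "finite B" "finite (S - A - B)" and D: "B \<union> (S - A - B) = S - A"
          using True by (auto intro: finite_subset)
        have "shuffle_sign A (S - A) =
            (shuffle_sign A B * shuffle_sign A (S - A - B) :: 'a)"
          using shuffle_sign_Un_right[OF fin] D by auto
        then show "?t A B (S - A - B) = shuffle_sign A (S - A) * ext_coeff f A *
            (shuffle_sign B (S - A - B) * ext_coeff g B * ext_coeff h (S - A - B))"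
          by (simp add: mult_ac)
      qed
      finally show ?thesis .
    next
      case False
      then show ?thesis by (simp add: ext_coeff_infinite)
    qed
  qed
qed

end

lift_definition ext_const :: "'a::zero \<Rightarrow> 'a ext" is "\<lambda>c S. if S = {} then c else 0" by simp

lift_definition xgen :: "nat \<Rightarrow> 'a::comm_ring_1 ext" is "\<lambda>i S. if S = {i} then 1 else 0"
  by (rule exI[of _ "Suc i" for i]) auto

lift_definition ext_map :: "('a::zero \<Rightarrow> 'b::zero) \<Rightarrow> 'a ext \<Rightarrow> 'b ext" is
  "\<lambda>\<phi> f S. if f S = 0 then 0 else \<phi> (f S)"
  by metis

subsection \<open>Group action and invariants\<close>

definition GL :: "nat \<Rightarrow> 'a::field mat set" where
  "GL n = {A \<in> carrier_mat n n. invertible_mat A}"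

definition parabolic :: "nat \<Rightarrow> nat \<Rightarrow> 'a::field mat set" where
  "parabolic k l = {four_block_mat A C (0\<^sub>m l k) B | A B C.
     A \<in> GL k \<and> B \<in> GL l \<and> C \<in> carrier_mat k l}"

definition poly_act :: "'a::comm_ring_1 mat \<Rightarrow> 'a mpoly \<Rightarrow> 'a mpoly" where
  "poly_act a = msubst (\<lambda>k. \<Sum>i<dim_row a. mconst (a $$ (i, k)) * ygen i)"

text \<open>The algebra endomorphism extending \<open>poly_act a\<close> and \<open>x_k \<mapsto> \<Sum>\<^sub>i a_{ik} x_i\<close>.\<close>

definition ext_act :: "'a::comm_ring_1 mat \<Rightarrow> 'a mpoly ext \<Rightarrow> 'a mpoly ext" where
  "ext_act a f = (\<Sum>S | ext_coeff f S \<noteq> 0. ext_const (poly_act a (ext_coeff f S)) *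
     (\<Prod>k\<leftarrow>sorted_list_of_set S. \<Sum>i<dim_row a. ext_const (mconst (a $$ (i, k))) * xgen i))"

definition cohom :: "nat \<Rightarrow> 'a::comm_ring_1 mpoly ext set" where
  "cohom n = {f. \<forall>S. ext_coeff f S \<noteq> 0 \<longrightarrow> S \<subseteq> {..<n} \<and> ext_coeff f S \<in> poly_ring n}"

definition poly_invariants :: "nat \<Rightarrow> 'a::comm_ring_1 mat set \<Rightarrow> 'a mpoly set" where
  "poly_invariants n G = {f \<in> poly_ring n. \<forall>a \<in> G. poly_act a f = f}"

definition cohom_invariants :: "nat \<Rightarrow> 'a::comm_ring_1 mat set \<Rightarrow> 'a mpoly ext set" where
  "cohom_invariants n G = {f \<in> cohom n. \<forall>a \<in> G. ext_act a f = f}"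

subsection \<open>Dickson and Mui invariants\<close>

text \<open>Here \<open>h j\<close>, for \<open>j = 0, \<dots>, n - 1\<close>, is the product usually written \<open>h_{j+1}\<close>.\<close>

definition mui_h :: "nat \<Rightarrow> 'p::prime_card mod_ring mpoly" where
  "mui_h j = (\<Prod>v \<in> range (\<lambda>c. \<Sum>i<j. mconst (c i) * ygen i). ygen j - v)"

definition mui_L :: "nat \<Rightarrow> 'p::prime_card mod_ring mpoly" where
  "mui_L n = (\<Prod>j<n. mui_h j)"

text \<open>
  The invariant \<open>d_{n,m}(I)\<close> for \<open>I = (1, n - 1)\<close> and \<open>m = n - i\<close>, where \<open>i\<close> is the size of the
  index sets \<open>J = {j_1 < \<dots> < j_i}\<close>.  The exponent \<open>m + s - j_s\<close> is unaffected by shifting \<open>s\<close>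
  and \<open>j_s\<close> simultaneously, and the subtraction never truncates.
\<close>

definition dickson_I :: "nat \<Rightarrow> nat \<Rightarrow> 'p::prime_card mod_ring mpoly" where
  "dickson_I n m = (\<Sum>J | J \<subseteq> {1..<n} \<and> card J = n - m. \<Prod>s<n - m.
     (mui_h (sorted_list_of_set J ! s) ^ (CARD('p) - 1)) ^
       (CARD('p) ^ (m + s - sorted_list_of_set J ! s)))"

definition column_det :: "nat \<Rightarrow> (nat \<Rightarrow> nat \<Rightarrow> 'a::ring_1) \<Rightarrow> 'a" where
  "column_det m E =
     (\<Sum>\<sigma> | \<sigma> permutes {..<m}. of_int (sign \<sigma>) * (\<Prod>j\<leftarrow>[0..<m]. E (\<sigma> j) j))"

definition mui_columns :: "nat \<Rightarrow> nat \<Rightarrow> nat set \<Rightarrow> (nat \<Rightarrow> int mpoly ext) list" where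
  "mui_columns p m T = replicate (card T) xgen @
     map (\<lambda>j i. ext_const (ygen i ^ (p ^ j))) (sorted_list_of_set ({..<m} - T))"

definition mui_det :: "nat \<Rightarrow> nat \<Rightarrow> nat set \<Rightarrow> int mpoly ext" where
  "mui_det p m T = column_det m (\<lambda>i j. (mui_columns p m T ! j) i)"

lemma xgen_mult_xgen:
  "xgen i * xgen j = (- (xgen j * xgen i) :: 'a::comm_ring_1 ext)"
proof (rule ext_eqI)
  have *: "ext_coeff (xgen i * xgen j :: 'a ext) S =
      (if i \<noteq> j \<and> S = {i, j} then if j < i then -1 else 1 else 0)" for i j S
  proof -
    have "ext_coeff (xgen i * xgen j :: 'a ext) S =
        (\<Sum>A \<in> Pow S. if A = {i} \<and> S - {i} = {j} then shuffle_sign {i} {j} else 0)"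
      unfolding times_ext.rep_eq xgen.rep_eq by (intro sum.cong) auto
    also have "\<dots> = (if {i} \<in> Pow S \<and> S - {i} = {j} then shuffle_sign {i} {j} else 0)"
    proof (cases "finite S")
      case True
      then show ?thesis
        by (cases "S - {i} = {j}") (auto simp: sum.delta)
    next
      case False
      then have "S - {i} \<noteq> {j}"
        by (metis finite.emptyI finite.insertI finite_Diff2)
      then show ?thesis by simp
    qed
    also have "{i} \<in> Pow S \<and> S - {i} = {j} \<longleftrightarrow> i \<noteq> j \<and> S = {i, j}"
      by auto
    also have "shuffle_sign {i} {j} = (if j < i then -1 else 1 :: 'a)"
    proof -
      have "{(a, b). a \<in> {i} \<and> b \<in> {j} \<and> b < a} = (if j < i then {(i, j)} else {})"
        by auto
      then show ?thesis by (simp add: shuffle_sign_def)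
    qed
    finally show ?thesis by simp
  qed
  fix S
  show "ext_coeff (xgen i * xgen j) S = ext_coeff (- (xgen j * xgen i) :: 'a ext) S"
    unfolding uminus_ext.rep_eq * by (auto simp: insert_commute)
qed

lemma prod_xgen_transpose:
  assumes "a < k" "b < k" "a \<noteq> b"
  shows "(\<Prod>j\<leftarrow>[0..<k]. xgen ((\<sigma> \<circ> Transposition.transpose a b) j)) =
    (- (\<Prod>j\<leftarrow>[0..<k]. xgen (\<sigma> j)) :: 'a::comm_ring_1 ext)"
proof -
  define P :: "nat list \<Rightarrow> 'a ext" where "P = (\<lambda>js. \<Prod>j\<leftarrow>js. xgen j)"
  have move: "xgen i * P js = (-1) ^ length js * (P js * xgen i)" for i js
  proof (induction js)
    case (Cons j js)
    have "xgen i * P (j # js) = (xgen i * xgen j) * P js"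
      by (simp add: P_def mult.assoc)
    also have "\<dots> = - (xgen j * (xgen i * P js))"
      by (subst xgen_mult_xgen) (simp add: mult.assoc)
    also have "\<dots> = (-1) ^ length (j # js) * (P (j # js) * xgen i)"
      unfolding Cons.IH by (cases "even (length js)") (simp_all add: P_def mult.assoc)
    finally show ?case .
  qed (simp add: P_def)
  have swap: "P (us @ [i] @ vs @ [j] @ ws) = - P (us @ [j] @ vs @ [i] @ ws)" for us vs ws i j
  proof -
    have "xgen i * P vs * xgen j = (-1) ^ length vs * (P vs * (xgen i * xgen j))"
      by (simp add: move mult.assoc)
    also have "\<dots> = - ((-1) ^ length vs * (P vs * (xgen j * xgen i)))"
      by (subst xgen_mult_xgen) simp
    also have "\<dots> = - (xgen j * P vs * xgen i)"
      by (simp add: move mult.assoc)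
    finally have "P us * (xgen i * P vs * xgen j) * P ws = - (P us * (xgen j * P vs * xgen i) * P ws)"
      by simp
    then show ?thesis by (simp add: P_def mult.assoc)
  qed
  have main: "P (map (\<sigma> \<circ> Transposition.transpose a b) [0..<k]) = - P (map \<sigma> [0..<k])"
    if "a < b" "b < k" for a b
  proof -
    have split: "[0..<k] = [0..<a] @ [a] @ [Suc a..<b] @ [b] @ [Suc b..<k]"
    proof -
      have "[0..<k] = [0..<a] @ [a..<k]"
        using upt_add_eq_append[of 0 a "k - a"] that by simp
      also have "[a..<k] = a # [Suc a..<k]"
        using that by (simp add: upt_conv_Cons)
      also have "[Suc a..<k] = [Suc a..<b] @ [b..<k]"
        using upt_add_eq_append[of "Suc a" b "k - b"] that by simp
      also have "[b..<k] = b # [Suc b..<k]"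
        using that by (simp add: upt_conv_Cons)
      finally show ?thesis by simp
    qed
    have "map (\<sigma> \<circ> Transposition.transpose a b) [0..<k] =
        map \<sigma> [0..<a] @ [\<sigma> b] @ map \<sigma> [Suc a..<b] @ [\<sigma> a] @ map \<sigma> [Suc b..<k]"
      unfolding split using that by (auto simp: Transposition.transpose_def)
    moreover have "map \<sigma> [0..<k] =
        map \<sigma> [0..<a] @ [\<sigma> a] @ map \<sigma> [Suc a..<b] @ [\<sigma> b] @ map \<sigma> [Suc b..<k]"
      unfolding split by simp
    ultimately show ?thesis by (metis swap)
  qed
  have "P (map (\<sigma> \<circ> Transposition.transpose a b) [0..<k]) = - P (map \<sigma> [0..<k])"
    using main[of a b] main[of b a] assms by (metis nat_neq_iff transpose_commute)
  then show ?thesis by (simp add: P_def comp_def)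
qed

lemma prod_xgen_permutes:
  assumes "\<tau> permutes {..<k}"
  shows "(\<Prod>j\<leftarrow>[0..<k]. xgen ((\<sigma> \<circ> \<tau>) j)) =
    (of_int (sign \<tau>) * (\<Prod>j\<leftarrow>[0..<k]. xgen (\<sigma> j)) :: 'a::comm_ring_1 ext)"
  using assms finite_lessThan[of k]
proof (induction arbitrary: \<sigma> rule: permutes_induct)
  case id
  then show ?case by simp
next
  case (swap a b \<tau>)
  have "(\<Prod>j\<leftarrow>[0..<k]. xgen ((\<sigma> \<circ> (Transposition.transpose a b \<circ> \<tau>)) j)) =
      (of_int (sign \<tau>) * (\<Prod>j\<leftarrow>[0..<k]. xgen ((\<sigma> \<circ> Transposition.transpose a b) j)) :: 'a ext)"
    using swap.IH[of "\<sigma> \<circ> Transposition.transpose a b"] by (simp add: comp_assoc)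
  also have "\<dots> = - (of_int (sign \<tau>) * (\<Prod>j\<leftarrow>[0..<k]. xgen (\<sigma> j)))"
    using swap.hyps by (subst prod_xgen_transpose) auto
  also have "\<dots> = of_int (sign (Transposition.transpose a b \<circ> \<tau>)) * (\<Prod>j\<leftarrow>[0..<k]. xgen (\<sigma> j))"
  proof -
    have "permutation \<tau>" using swap.hyps finite_lessThan permutation_permutes by blast
    then show ?thesis using swap.hyps
      by (simp add: sign_compose sign_swap_id permutation_swap_id)
  qed
  finally show ?case .
qed

lemma mui_det_divisible:
  assumes "T \<subseteq> {..<m}"
  shows "\<exists>M. of_nat (fact (card T)) * M = mui_det p m T"
proof -
  define k where "k = card T"
  have km: "k \<le> m"
    using card_mono[OF finite_lessThan assms] by (simp add: k_def)
  define E where "E = (\<lambda>i j. (mui_columns p m T ! j) i)"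
  define F where "F \<sigma> = of_int (sign \<sigma>) * (\<Prod>j\<leftarrow>[0..<m]. E (\<sigma> j) j)" for \<sigma>
  define S where "S = {\<sigma>. \<sigma> permutes {..<m}}"
  define K where "K = {\<tau>. \<tau> permutes {..<k}}"
  define orb where "orb \<sigma> = (\<lambda>\<tau>. \<sigma> \<circ> \<tau>) ` K" for \<sigma> :: "nat \<Rightarrow> nat"
  have fin: "finite S" by (simp add: S_def finite_permutations)
  have KS: "\<tau> \<in> S" if "\<tau> \<in> K" for \<tau>
    using that km permutes_subset[of \<tau> "{..<k}" "{..<m}"] by (auto simp: S_def K_def)
  have F_inv: "F (\<sigma> \<circ> \<tau>) = F \<sigma>" if "\<sigma> \<in> S" "\<tau> \<in> K" for \<sigma> \<tau>
  proof -
    have upt: "[0..<m] = [0..<k] @ [k..<m]"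
      using upt_add_eq_append[of 0 k "m - k"] km by simp
    have x: "map (\<lambda>j. E (\<rho> j) j) [0..<k] = map (\<lambda>j. xgen (\<rho> j)) [0..<k]" for \<rho>
      by (auto simp: E_def mui_columns_def k_def nth_append)
    have "\<tau> j = j" if "j \<ge> k" for j
      using \<open>\<tau> \<in> K\<close> that by (auto simp: K_def permutes_def)
    then have y: "map (\<lambda>j. E ((\<sigma> \<circ> \<tau>) j) j) [k..<m] = map (\<lambda>j. E (\<sigma> j) j) [k..<m]"
      by auto
    have "permutation \<sigma>" "permutation \<tau>"
      using that KS[OF that(2)] by (auto simp: S_def intro: permutes_imp_permutation)
    then have s: "sign (\<sigma> \<circ> \<tau>) = sign \<sigma> * sign \<tau>" by (rule sign_compose)
    have "F (\<sigma> \<circ> \<tau>) = of_int (sign \<sigma> * sign \<tau>) *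
        ((\<Prod>j\<leftarrow>[0..<k]. xgen ((\<sigma> \<circ> \<tau>) j)) * (\<Prod>j\<leftarrow>[k..<m]. E (\<sigma> j) j))"
      unfolding F_def upt map_append prod_list.append x y s ..
    also have "(\<Prod>j\<leftarrow>[0..<k]. xgen ((\<sigma> \<circ> \<tau>) j)) =
        (of_int (sign \<tau>) * (\<Prod>j\<leftarrow>[0..<k]. xgen (\<sigma> j)) :: int mpoly ext)"
      by (rule prod_xgen_permutes) (use that in \<open>simp add: K_def\<close>)
    also have "of_int (sign \<sigma> * sign \<tau>) * (\<dots> * (\<Prod>j\<leftarrow>[k..<m]. E (\<sigma> j) j)) = F \<sigma>"
      unfolding F_def upt map_append prod_list.append x
      by (rule sign_cases[of \<tau>]) (simp_all only: of_int_1 of_int_minus mult_1_left mult_1_right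
        mult_minus_left mult_minus_right minus_minus mult.assoc)
    finally show ?thesis .
  qed
  have K_comp: "\<tau> \<circ> \<tau>' \<in> K" if "\<tau> \<in> K" "\<tau>' \<in> K" for \<tau> \<tau>'
    using that permutes_compose[of \<tau>' _ \<tau>] by (simp add: K_def)
  have orb_self: "\<sigma> \<in> orb \<sigma>" for \<sigma>
    unfolding orb_def by (rule image_eqI[of _ _ id]) (simp_all add: K_def permutes_id)
  have orb_eq: "orb (\<sigma> \<circ> \<tau>) = orb \<sigma>" if "\<tau> \<in> K" for \<sigma> \<tau>
  proof
    show "orb (\<sigma> \<circ> \<tau>) \<subseteq> orb \<sigma>"
      unfolding orb_def using K_comp[OF that] by (auto simp only: comp_assoc)
    show "orb \<sigma> \<subseteq> orb (\<sigma> \<circ> \<tau>)"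
    proof
      fix \<rho> assume "\<rho> \<in> orb \<sigma>"
      then obtain \<tau>' where t: "\<tau>' \<in> K" "\<rho> = \<sigma> \<circ> \<tau>'" by (auto simp: orb_def)
      have "inv_into UNIV \<tau> \<circ> \<tau>' \<in> K"
        using that t(1) by (intro K_comp) (simp_all add: K_def permutes_inv)
      moreover have "\<rho> = \<sigma> \<circ> \<tau> \<circ> (inv_into UNIV \<tau> \<circ> \<tau>')"
        using that t permutes_inverses(1)[of \<tau> "{..<k}"] by (simp add: K_def fun_eq_iff)
      ultimately show "\<rho> \<in> orb (\<sigma> \<circ> \<tau>)" unfolding orb_def by blast
    qed
  qed
  have "mui_det p m T = (\<Sum>\<sigma> \<in> S. F \<sigma>)"
    by (simp add: mui_det_def column_det_def F_def E_def S_def)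
  also have "\<dots> = (\<Sum>Q \<in> orb ` S. \<Sum>\<sigma> \<in> {\<sigma> \<in> S. orb \<sigma> = Q}. F \<sigma>)"
    by (rule sum.image_gen[OF fin])
  also have "\<dots> = (\<Sum>Q \<in> orb ` S. of_nat (fact k) * F (SOME \<sigma>. \<sigma> \<in> S \<and> orb \<sigma> = Q))"
  proof (intro sum.cong refl)
    fix Q assume "Q \<in> orb ` S"
    define \<rho> where "\<rho> = (SOME \<sigma>. \<sigma> \<in> S \<and> orb \<sigma> = Q)"
    have r: "\<rho> \<in> S" "orb \<rho> = Q"
    proof -
      have "\<exists>\<sigma>. \<sigma> \<in> S \<and> orb \<sigma> = Q" using \<open>Q \<in> orb ` S\<close> by blast
      from someI_ex[OF this] show "\<rho> \<in> S" "orb \<rho> = Q" unfolding \<rho>_def by blast+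
    qed
    have "{\<sigma> \<in> S. orb \<sigma> = Q} = orb \<rho>"
    proof (intro subset_antisym subsetI)
      fix \<sigma> assume "\<sigma> \<in> {\<sigma> \<in> S. orb \<sigma> = Q}"
      then show "\<sigma> \<in> orb \<rho>" using orb_self[of \<sigma>] r by auto
    next
      fix \<sigma> assume "\<sigma> \<in> orb \<rho>"
      then obtain \<tau> where "\<tau> \<in> K" "\<sigma> = \<rho> \<circ> \<tau>" by (auto simp: orb_def)
      then show "\<sigma> \<in> {\<sigma> \<in> S. orb \<sigma> = Q}"
        using r orb_eq[of \<tau> \<rho>] KS[of \<tau>] permutes_compose[of \<tau> _ \<rho>] by (simp add: S_def)
    qed
    moreover have "F \<sigma> = F \<rho>" if \<sigma>: "\<sigma> \<in> orb \<rho>" for \<sigma>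
    proof -
      obtain \<tau> where "\<tau> \<in> K" "\<sigma> = \<rho> \<circ> \<tau>" using \<sigma> unfolding orb_def by blast
      then show ?thesis using F_inv[OF r(1)] by (simp only:)
    qed
    ultimately have "(\<Sum>\<sigma> \<in> {\<sigma> \<in> S. orb \<sigma> = Q}. F \<sigma>) = (\<Sum>\<sigma> \<in> orb \<rho>. F \<rho>)"
      by (rule sum.cong)
    moreover have "card (orb \<rho>) = fact k"
    proof -
      have "inj \<rho>" using r by (auto simp: S_def permutes_inj)
      then have "inj_on (\<lambda>\<tau>. \<rho> \<circ> \<tau>) K"
        by (intro inj_onI ext) (metis comp_apply injD)
      then have "card (orb \<rho>) = card K" by (simp add: orb_def card_image)
      also have "\<dots> = fact k" by (simp add: K_def card_permutations)
      finally show ?thesis .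
    qed
    ultimately have "(\<Sum>\<sigma> \<in> {\<sigma> \<in> S. orb \<sigma> = Q}. F \<sigma>) = of_nat (fact k) * F \<rho>"
      by (simp only: sum_constant)
    then show "(\<Sum>\<sigma> \<in> {\<sigma> \<in> S. orb \<sigma> = Q}. F \<sigma>) =
        of_nat (fact k) * F (SOME \<sigma>. \<sigma> \<in> S \<and> orb \<sigma> = Q)"
      by (simp only: \<rho>_def)
  qed
  also have "\<dots> = of_nat (fact k) * (\<Sum>Q \<in> orb ` S. F (SOME \<sigma>. \<sigma> \<in> S \<and> orb \<sigma> = Q))"
    by (rule sum_distrib_left[symmetric])
  finally show ?thesis unfolding k_def by (intro exI) (rule sym)
qed

lemma ext_coeff_of_nat_mult: "ext_coeff (of_nat n * f) S = of_nat n * ext_coeff f S"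
  by (induction n) (simp_all add: algebra_simps plus_ext.rep_eq zero_ext.rep_eq)

text \<open>
  The quotient \<open>det / k!\<close> over the integers; it exists and is unique, see \<open>mui_M_int_eq\<close>.
\<close>

definition mui_M_int :: "nat \<Rightarrow> nat \<Rightarrow> nat set \<Rightarrow> int mpoly ext" where
  "mui_M_int p m T = (THE M. of_nat (fact (card T)) * M = mui_det p m T)"

lemma mui_M_int_eq:
  assumes "T \<subseteq> {..<m}"
  shows "of_nat (fact (card T)) * mui_M_int p m T = mui_det p m T"
  unfolding mui_M_int_def
proof (rule theI')
  obtain M where M: "of_nat (fact (card T)) * M = mui_det p m T"
    using mui_det_divisible[OF assms] by blast
  show "\<exists>!M. of_nat (fact (card T)) * M = mui_det p m T"
  proof (rule ex1I, rule M)
    fix N assume N: "of_nat (fact (card T)) * N = mui_det p m T"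
    show "N = M"
    proof (rule ext_eqI)
      fix S
      have "of_nat (fact (card T)) * ext_coeff N S = of_nat (fact (card T)) * ext_coeff M S"
        unfolding ext_coeff_of_nat_mult[symmetric] M N ..
      moreover have "(of_nat (fact (card T)) :: int mpoly) \<noteq> 0"
        by (simp only: of_nat_eq_0_iff fact_nonzero not_False_eq_True)
      ultimately show "ext_coeff N S = ext_coeff M S"
        by (simp only: mult_cancel_left simp_thms)
    qed
  qed
qed

text \<open>\<open>mui_M m T\<close> is \<open>M_{m,s_1,\<dots>,s_k}\<close> for \<open>T = {s_1 < \<dots> < s_k} \<subseteq> {0, \<dots>, m - 1}\<close>.\<close>

definition mui_M :: "nat \<Rightarrow> nat set \<Rightarrow> 'p::prime_card mod_ring mpoly ext" where
  "mui_M m T = ext_map (Poly_Mapping.map of_int) (mui_M_int (CARD('p)) m T)"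

end

theory Submission
  imports Defs "HOL-Computational_Algebra.Polynomial" "Jordan_Normal_Form.Gauss_Jordan_Elimination"
begin

text \<open>
  Polynomial invariants: the shears force the restriction of an invariant to \<open>y_k = 0\<close> to be a
  \<open>p\<close>-th power of an invariant in fewer variables, so Dickson's theorem and its parabolic variant
  follow by descent on the degree.

  The exterior part: let \<open>\<partial>_t\<close> be the antiderivation over the polynomials with \<open>\<partial>_t x_i = y_i^{p^t}\<close>.
  It commutes with the group action, and up to a sign \<open>M_T\<close> is \<open>x_1 \<dots> x_n\<close> contracted by all
  \<open>\<partial>_t\<close> with \<open>t \<notin> T\<close>.  For an invariant \<open>f\<close> the polynomial \<open>g_T\<close> obtained as the constant
  term after contraction by all \<open>\<partial>_t\<close>, \<open>t \<in> T\<close>, is invariant; duality with the Moore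
  determinant gives \<open>L_n f = \<Sum> \<plusminus> g_T M_T\<close>.  Once the terms for \<open>T = {}\<close> and \<open>T = {0}\<close> are split off,
  each \<open>g_T\<close> is divisible by \<open>y_1\<close> and \<open>y_n\<close>, hence by invariance by \<open>L_n^{p-1}\<close>, which gives the expansion;
  the same functionals give freeness.
\<close>

subsection \<open>Substitution homomorphisms\<close>

text \<open>Restriction to \<open>y_0 = 0\<close> forgets which of the two groups is acting: the
  shears of the later variables by \<open>y_0\<close> exist in both, so a single step leads from the
  parabolic group to the full linear group in the remaining variables. Weighted degrees are bounded
  throughout, because the polynomial subtracted from an invariant must not raise its degree.

  The division by \<open>k!\<close> forbids computing with \<open>M_T\<close> modulo
  \<open>p\<close>, where \<open>k!\<close> may vanish. The comparison with contractions is made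
  over the integers, the factorial is cancelled, and only then is everything reduced. Signs are not
  tracked, since coefficients absorb them.

  \<open>T = {0}\<close> is special because no shear in the group moves \<open>x_0\<close>: the
  coefficient at \<open>x_0\<close> is only forced to be divisible by \<open>y_0\<close>. The
  element \<open>x_0 y_0^(p-2)\<close> accounts for it, as \<open>\<partial>_0\<close> sends it to
  \<open>y_0^(p-1)\<close>. The exponent \<open>p - 2\<close> of \<open>L_n\<close> has two reasons:
  \<open>M_T\<close> and \<open>L_n\<close> transform by the same character, whose
  \<open>(p-1)\<close>-st power is trivial, and \<open>L_n\<close> times \<open>L_n^(p-2)\<close> is
  the power that divides \<open>g_T\<close>.\<close>

lemma mconst_0 [simp]: "mconst 0 = 0"
  and mconst_1 [simp]: "mconst 1 = 1"
  and mconst_add: "mconst (a + b) = mconst a + mconst b"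
  and mconst_diff: "mconst (a - b) = mconst a - mconst b"
  and mconst_uminus: "mconst (- a) = - mconst a"
  and mconst_mult: "mconst (a * b) = mconst a * mconst b"
  by (simp_all add: mconst_def single_add single_diff single_uminus mult_single)

lemma mconst_power: "mconst (a ^ k) = mconst a ^ k"
  by (induction k) (simp_all add: mconst_mult)

lemma mconst_sum: "mconst (sum f A) = (\<Sum>i\<in>A. mconst (f i))"
  by (induction A rule: infinite_finite_induct) (simp_all add: mconst_add)

lemma mconst_eq_iff [simp]: "mconst a = mconst b \<longleftrightarrow> a = b"
  by (metis lookup_single_eq mconst_def)

lemma mconst_eq_0_iff [simp]: "mconst a = 0 \<longleftrightarrow> a = 0"
  using mconst_eq_iff[of a 0] by (simp del: mconst_eq_iff)

lemma mpoly_sum_single: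
  fixes f :: "'b \<Rightarrow>\<^sub>0 'a::comm_monoid_add"
  shows "f = (\<Sum>m\<in>Poly_Mapping.keys f. Poly_Mapping.single m (Poly_Mapping.lookup f m))"
proof (rule poly_mapping_eqI)
  fix k
  have "Poly_Mapping.lookup (\<Sum>m\<in>Poly_Mapping.keys f. Poly_Mapping.single m (Poly_Mapping.lookup f m)) k
      = (\<Sum>m\<in>Poly_Mapping.keys f. if m = k then Poly_Mapping.lookup f m else 0)"
    by (simp add: lookup_sum lookup_single when_def)
  also have "\<dots> = Poly_Mapping.lookup f k"
    by (simp add: sum.delta' in_keys_iff)
  finally show "Poly_Mapping.lookup f k = Poly_Mapping.lookup
      (\<Sum>m\<in>Poly_Mapping.keys f. Poly_Mapping.single m (Poly_Mapping.lookup f m)) k" ..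
qed

definition mono_subst :: "(nat \<Rightarrow> 'a::comm_monoid_mult) \<Rightarrow> (nat \<Rightarrow>\<^sub>0 nat) \<Rightarrow> 'a" where
  "mono_subst g m = (\<Prod>i\<in>Poly_Mapping.keys m. g i ^ Poly_Mapping.lookup m i)"

lemma mono_subst_superset:
  assumes "finite A" "Poly_Mapping.keys m \<subseteq> A"
  shows "mono_subst g m = (\<Prod>i\<in>A. g i ^ Poly_Mapping.lookup m i)"
  unfolding mono_subst_def by (rule prod.mono_neutral_left) (use assms in \<open>auto simp: in_keys_iff\<close>)

lemma mono_subst_add: "mono_subst g (m + m') = mono_subst g m * mono_subst g m'"
proof -
  let ?A = "Poly_Mapping.keys m \<union> Poly_Mapping.keys m'"
  have "mono_subst g (m + m') = (\<Prod>i\<in>?A. g i ^ Poly_Mapping.lookup (m + m') i)"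
    by (rule mono_subst_superset) (use keys_add[of m m'] in auto)
  then show ?thesis
    by (simp add: mono_subst_superset[of ?A m] mono_subst_superset[of ?A m'] lookup_add power_add
        prod.distrib)
qed

lemma mono_subst_0 [simp]: "mono_subst g 0 = 1"
  by (simp add: mono_subst_def)

lemma mono_subst_single [simp]: "mono_subst g (Poly_Mapping.single i e) = g i ^ e"
  by (cases "e = 0") (simp_all add: mono_subst_def)

lemma msubst_superset:
  assumes "finite A" "Poly_Mapping.keys f \<subseteq> A"
  shows "msubst g f = (\<Sum>m\<in>A. mconst (Poly_Mapping.lookup f m) * mono_subst g m)"
  unfolding msubst_def mono_subst_def[symmetric]
  by (rule sum.mono_neutral_left) (use assms in \<open>auto simp: in_keys_iff\<close>)

lemma msubst_0 [simp]: "msubst g 0 = 0"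
  by (simp add: msubst_def)

lemma msubst_add: "msubst g (f + f') = msubst g f + msubst g f'"
proof -
  let ?A = "Poly_Mapping.keys f \<union> Poly_Mapping.keys f'"
  have "msubst g (f + f') = (\<Sum>m\<in>?A. mconst (Poly_Mapping.lookup (f + f') m) * mono_subst g m)"
    by (rule msubst_superset) (use keys_add[of f f'] in auto)
  then show ?thesis
    by (simp add: msubst_superset[of ?A f] msubst_superset[of ?A f'] lookup_add mconst_add
        sum.distrib algebra_simps)
qed

lemma msubst_sum: "msubst g (sum f A) = (\<Sum>i\<in>A. msubst g (f i))"
  by (induction A rule: infinite_finite_induct) (simp_all add: msubst_add)

lemma msubst_single: "msubst g (Poly_Mapping.single m c) = mconst c * mono_subst g m"
  by (cases "c = 0") (simp_all add: msubst_def mono_subst_def)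

lemma msubst_mconst [simp]: "msubst g (mconst c) = mconst c"
  by (simp only: mconst_def[of c] msubst_single) (simp add: mconst_def)

lemma msubst_1 [simp]: "msubst g 1 = 1"
  using msubst_mconst[of g 1] by simp

lemma msubst_ygen_var [simp]: "msubst g (ygen i) = g i"
  by (simp add: ygen_def msubst_single)

lemma msubst_mult: "msubst g (f * f') = msubst g f * msubst g f'"
proof -
  let ?s = "\<lambda>f. (\<Sum>m\<in>Poly_Mapping.keys f. Poly_Mapping.single m (Poly_Mapping.lookup f m))"
  have "msubst g (f * f') = msubst g (?s f * ?s f')"
    using mpoly_sum_single[of f] mpoly_sum_single[of f'] by simp
  also have "\<dots> = (\<Sum>m\<in>Poly_Mapping.keys f. \<Sum>m'\<in>Poly_Mapping.keys f'.
      mconst (Poly_Mapping.lookup f m) * mono_subst g m *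
      (mconst (Poly_Mapping.lookup f' m') * mono_subst g m'))"
    by (simp add: sum_product msubst_sum mult_single msubst_single mono_subst_add mconst_mult
        mult_ac)
  also have "\<dots> = msubst g f * msubst g f'"
    by (simp add: sum_product[symmetric] msubst_def mono_subst_def)
  finally show ?thesis .
qed

lemma msubst_uminus: "msubst g (- f) = - msubst g f"
  using msubst_add[of g f "- f"] by (simp add: add_eq_0_iff)

lemma msubst_diff: "msubst g (f - f') = msubst g f - msubst g f'"
  using msubst_add[of g f "- f'"] by (simp add: msubst_uminus)

lemma msubst_power: "msubst g (f ^ k) = msubst g f ^ k"
  by (induction k) (simp_all add: msubst_mult)

lemma msubst_prod: "msubst g (prod f A) = (\<Prod>i\<in>A. msubst g (f i))"
  by (induction A rule: infinite_finite_induct) (simp_all add: msubst_mult)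

lemma msubst_dvd: "f dvd f' \<Longrightarrow> msubst g f dvd msubst g f'"
  by (auto simp: msubst_mult elim!: dvdE)

lemmas msubst_hom = msubst_add msubst_diff msubst_uminus msubst_mult msubst_power msubst_sum
  msubst_prod

lemma msubst_msubst: "msubst g (msubst h f) = msubst (\<lambda>i. msubst g (h i)) f"
  unfolding msubst_def[of h] msubst_def[of "\<lambda>i. msubst g (h i)"]
  by (simp add: msubst_hom)

lemma single_eq_mconst_mono: "Poly_Mapping.single m c = mconst c * mono_subst ygen m"
proof (induction "Poly_Mapping.keys m" arbitrary: m rule: infinite_finite_induct)
  case (insert i A)
  define m' where "m' = m - Poly_Mapping.single i (Poly_Mapping.lookup m i)"
  have m: "m = m' + Poly_Mapping.single i (Poly_Mapping.lookup m i)"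
    by (rule poly_mapping_eqI) (auto simp: m'_def lookup_add lookup_minus lookup_single when_def)
  have "Poly_Mapping.keys m' = A"
    using insert(2) insert(4)[symmetric] by (auto simp: m'_def in_keys_iff lookup_minus lookup_single when_def split: if_splits)
  then have IH: "Poly_Mapping.single m' c = mconst c * mono_subst ygen m'"
    using insert(3) by simp
  have *: "Poly_Mapping.single (Poly_Mapping.single i e) 1 = (ygen i ^ e :: 'a mpoly)" for e
  proof (induction e)
    case (Suc e)
    have "Poly_Mapping.single (Poly_Mapping.single i (Suc e)) (1 :: 'a) =
        ygen i * Poly_Mapping.single (Poly_Mapping.single i e) 1"
      by (simp add: ygen_def mult_single single_add[symmetric])
    then show ?case using Suc by simp
  qed simp
  have "Poly_Mapping.single m c = Poly_Mapping.single m' c *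
      Poly_Mapping.single (Poly_Mapping.single i (Poly_Mapping.lookup m i)) 1"
    by (subst m) (simp add: mult_single)
  also have "\<dots> = mconst c * mono_subst ygen m"
    by (metis IH * m mono_subst_add mono_subst_single mult.assoc)
  finally show ?case .
next
  case empty
  then have "m = 0"
    by (intro poly_mapping_eqI) (metis empty_iff in_keys_iff lookup_zero)
  then show ?case by (simp add: mconst_def)
qed simp

lemma msubst_ygen_id [simp]: "msubst ygen f = f"
proof -
  have "msubst ygen f = (\<Sum>m\<in>Poly_Mapping.keys f. Poly_Mapping.single m (Poly_Mapping.lookup f m))"
    by (simp add: msubst_def mono_subst_def[symmetric] single_eq_mconst_mono)
  then show ?thesis using mpoly_sum_single[of f] by simp
qed

subsection \<open>Polynomials in a set of variables\<close>

text \<open>An arbitrary set of variables, because the descent drops the lowest variable and works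
  with \<open>{k..<n}\<close>.\<close>

definition vpoly :: "nat set \<Rightarrow> 'a::comm_ring_1 mpoly set" where
  "vpoly A = {f. \<forall>m \<in> Poly_Mapping.keys f. Poly_Mapping.keys m \<subseteq> A}"

lemma poly_ring_eq_vpoly: "poly_ring n = vpoly {..<n}"
  by (simp add: poly_ring_def vpoly_def)

lemma vpoly_mono: "A \<subseteq> B \<Longrightarrow> vpoly A \<subseteq> vpoly B"
  by (auto simp: vpoly_def)

lemma vpoly_0 [intro, simp]: "0 \<in> vpoly A"
  and vpoly_mconst [intro, simp]: "mconst c \<in> vpoly A"
  and vpoly_ygen: "i \<in> A \<Longrightarrow> ygen i \<in> vpoly A"
  by (auto simp: vpoly_def mconst_def ygen_def split: if_splits)

lemma vpoly_1 [intro, simp]: "1 \<in> vpoly A"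
  using vpoly_mconst[of 1 A] by (simp del: vpoly_mconst)

lemma vpoly_add: "f \<in> vpoly A \<Longrightarrow> g \<in> vpoly A \<Longrightarrow> f + g \<in> vpoly A"
  using keys_add[of f g] by (fastforce simp: vpoly_def)

lemma vpoly_mult: "f \<in> vpoly A \<Longrightarrow> g \<in> vpoly A \<Longrightarrow> f * g \<in> vpoly A"
  unfolding vpoly_def
proof (intro CollectI ballI)
  fix m assume f: "f \<in> {f. \<forall>m \<in> Poly_Mapping.keys f. Poly_Mapping.keys m \<subseteq> A}"
    and g: "g \<in> {f. \<forall>m \<in> Poly_Mapping.keys f. Poly_Mapping.keys m \<subseteq> A}"
    and "m \<in> Poly_Mapping.keys (f * g)"
  then obtain a b where "a \<in> Poly_Mapping.keys f" "b \<in> Poly_Mapping.keys g" "m = a + b"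
    using keys_mult[of f g] by blast
  with f g keys_add[of a b] show "Poly_Mapping.keys m \<subseteq> A" by blast
qed

lemma vpoly_uminus: "f \<in> vpoly A \<Longrightarrow> - f \<in> vpoly A"
  using vpoly_mult[of "mconst (-1)" A f] vpoly_mconst[of "-1" A] by (simp add: mconst_uminus)

lemma vpoly_diff: "f \<in> vpoly A \<Longrightarrow> g \<in> vpoly A \<Longrightarrow> f - g \<in> vpoly A"
  using vpoly_add[of f A "- g"] vpoly_uminus[of g A] by simp

lemma vpoly_power: "f \<in> vpoly A \<Longrightarrow> f ^ k \<in> vpoly A"
  by (induction k) (simp_all add: vpoly_mult)

lemma vpoly_sum: "(\<And>i. i \<in> I \<Longrightarrow> f i \<in> vpoly A) \<Longrightarrow> sum f I \<in> vpoly A"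
  by (induction I rule: infinite_finite_induct) (simp_all add: vpoly_add)

lemma vpoly_prod: "(\<And>i. i \<in> I \<Longrightarrow> f i \<in> vpoly A) \<Longrightarrow> prod f I \<in> vpoly A"
  by (induction I rule: infinite_finite_induct) (simp_all add: vpoly_mult)

lemmas vpoly_closed = vpoly_add vpoly_mult vpoly_uminus vpoly_diff vpoly_power vpoly_sum vpoly_prod

lemma msubst_vpoly:
  assumes "f \<in> vpoly A" "\<And>i. i \<in> A \<Longrightarrow> g i \<in> vpoly B"
  shows "msubst g f \<in> vpoly B"
  unfolding msubst_def
proof (intro vpoly_sum vpoly_mult vpoly_prod vpoly_power vpoly_mconst)
  fix m i assume "m \<in> Poly_Mapping.keys f" "i \<in> Poly_Mapping.keys m"
  then have "i \<in> A" using assms(1) by (auto simp: vpoly_def)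
  then show "g i \<in> vpoly B" by (rule assms(2))
qed

lemma msubst_cong:
  assumes "f \<in> vpoly A" "\<And>i. i \<in> A \<Longrightarrow> g i = h i"
  shows "msubst g f = msubst h f"
proof -
  have "i \<in> A" if "m \<in> Poly_Mapping.keys f" "i \<in> Poly_Mapping.keys m" for i m
    using assms(1) that by (auto simp: vpoly_def)
  with assms(2) show ?thesis
    unfolding msubst_def by (intro sum.cong arg_cong2[of _ _ _ _ "(*)"] prod.cong) auto
qed

lemma vpoly_msubst_id:
  assumes "f \<in> vpoly A" "\<And>i. i \<in> A \<Longrightarrow> g i = ygen i"
  shows "msubst g f = f"
  using msubst_cong[OF assms] by simp

text \<open>Setting the variables outside \<open>A\<close> to zero fixes \<open>f * q\<close> and
  \<open>f\<close>, hence also \<open>q\<close> after cancelling \<open>f\<close>.\<close>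

lemma vpoly_quotient:
  fixes f :: "'a::idom mpoly"
  assumes "f * q \<in> vpoly A" "f \<in> vpoly A" "f \<noteq> 0"
  shows "q \<in> vpoly A"
proof -
  define \<pi> where "\<pi> = (\<lambda>i. if i \<in> A then ygen i else (0 :: 'a mpoly))"
  have "msubst \<pi> (f * q) = f * q" "msubst \<pi> f = f"
    using assms by (auto intro!: vpoly_msubst_id simp: \<pi>_def)
  then have "f * q = f * msubst \<pi> q" by (metis msubst_mult)
  with assms(3) have "q = msubst \<pi> q" by simp
  moreover have "msubst \<pi> q \<in> vpoly A"
    by (rule msubst_vpoly[of _ UNIV]) (auto simp: vpoly_def \<pi>_def ygen_def)
  ultimately show ?thesis by simp
qed

subsection \<open>Setting a variable to zero, and scaling it\<close>

definition var0 :: "nat \<Rightarrow> 'a::comm_ring_1 mpoly \<Rightarrow> 'a mpoly" where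
  "var0 k = msubst (ygen(k := 0))"

definition scale_var :: "nat \<Rightarrow> 'a \<Rightarrow> 'a::comm_ring_1 mpoly \<Rightarrow> 'a mpoly" where
  "scale_var k c = msubst (ygen(k := mconst c * ygen k))"

definition shear_var :: "nat \<Rightarrow> nat \<Rightarrow> 'a \<Rightarrow> 'a::comm_ring_1 mpoly \<Rightarrow> 'a mpoly" where
  "shear_var i j c = msubst (ygen(i := ygen i + mconst c * ygen j))"

lemma mono_subst_upd:
  "mono_subst (ygen(k := x)) m = x ^ Poly_Mapping.lookup m k *
    mono_subst ygen (m - Poly_Mapping.single k (Poly_Mapping.lookup m k))"
proof -
  let ?e = "Poly_Mapping.single k (Poly_Mapping.lookup m k)"
  have "m = ?e + (m - ?e)"
    by (rule poly_mapping_eqI) (simp add: lookup_add lookup_minus lookup_single when_def)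
  then have "mono_subst (ygen(k := x)) m =
      mono_subst (ygen(k := x)) ?e * mono_subst (ygen(k := x)) (m - ?e)"
    by (metis mono_subst_add)
  moreover have "mono_subst (ygen(k := x)) (m - ?e) = mono_subst ygen (m - ?e)"
    unfolding mono_subst_def by (rule prod.cong) (auto simp: in_keys_iff lookup_minus)
  ultimately show ?thesis by simp
qed

lemma lookup_sum_single:
  assumes "finite A"
  shows "Poly_Mapping.lookup (\<Sum>m\<in>A. Poly_Mapping.single m (c m)) k = (if k \<in> A then c k else 0)"
  using assms by (simp add: lookup_sum lookup_single when_def sum.delta')

lemma lookup_var0:
  "Poly_Mapping.lookup (var0 k f) m = (if Poly_Mapping.lookup m k = 0 then Poly_Mapping.lookup f m else 0)"
proof -
  have *: "mconst c * mono_subst (ygen(k := 0)) m' =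
      Poly_Mapping.single m' (if Poly_Mapping.lookup m' k = 0 then c else 0)" for c :: 'a and m'
    by (simp add: mono_subst_upd single_eq_mconst_mono[of m'] power_0_left)
  have "var0 k f = (\<Sum>m\<in>Poly_Mapping.keys f. Poly_Mapping.single m
      (if Poly_Mapping.lookup m k = 0 then Poly_Mapping.lookup f m else 0))"
    unfolding var0_def msubst_def mono_subst_def[symmetric] * ..
  then show ?thesis
    by (simp add: lookup_sum_single in_keys_iff)
qed

lemma lookup_scale_var:
  "Poly_Mapping.lookup (scale_var k c f) m = c ^ Poly_Mapping.lookup m k * Poly_Mapping.lookup f m"
proof -
  have *: "mconst b * mono_subst (ygen(k := mconst c * ygen k)) m' =
      Poly_Mapping.single m' (c ^ Poly_Mapping.lookup m' k * b)" for b :: 'a and m'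
  proof -
    let ?e = "Poly_Mapping.single k (Poly_Mapping.lookup m' k)"
    have "m' = ?e + (m' - ?e)"
      by (rule poly_mapping_eqI) (simp add: lookup_add lookup_minus lookup_single when_def)
    then have "mono_subst ygen m' = (ygen k ^ Poly_Mapping.lookup m' k * mono_subst ygen (m' - ?e) :: 'a mpoly)"
      by (metis mono_subst_add mono_subst_single)
    then show ?thesis
      by (simp add: mono_subst_upd single_eq_mconst_mono[of m'] mconst_mult mconst_power
          power_mult_distrib mult_ac)
  qed
  have "scale_var k c f = (\<Sum>m\<in>Poly_Mapping.keys f. Poly_Mapping.single m
      (c ^ Poly_Mapping.lookup m k * Poly_Mapping.lookup f m))"
    unfolding scale_var_def msubst_def mono_subst_def[symmetric] * ..
  then show ?thesis
    by (simp add: lookup_sum_single in_keys_iff)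
qed

lemma ygen_power_dvdI:
  assumes "\<And>m. m \<in> Poly_Mapping.keys f \<Longrightarrow> e \<le> Poly_Mapping.lookup m k"
  shows "ygen k ^ e dvd f"
proof -
  have "ygen k ^ e dvd Poly_Mapping.single m (Poly_Mapping.lookup f m)" if "m \<in> Poly_Mapping.keys f" for m
  proof -
    let ?e = "Poly_Mapping.single k e"
    have m: "m = ?e + (m - ?e)"
      by (rule poly_mapping_eqI)
        (use assms[OF that] in \<open>auto simp: lookup_add lookup_minus lookup_single when_def\<close>)
    have "Poly_Mapping.single m (Poly_Mapping.lookup f m) =
      mconst (Poly_Mapping.lookup f m) * mono_subst ygen (?e + (m - ?e))"
      using m by (simp add: single_eq_mconst_mono)
    then show ?thesis by (simp add: mono_subst_add)
  qed
  then have "ygen k ^ e dvd (\<Sum>m\<in>Poly_Mapping.keys f. Poly_Mapping.single m (Poly_Mapping.lookup f m))"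
    by (rule dvd_sum)
  then show ?thesis using mpoly_sum_single[of f] by simp
qed

lemma ygen_dvd_iff_keys: "ygen k dvd f \<longleftrightarrow> (\<forall>m\<in>Poly_Mapping.keys f. Poly_Mapping.lookup m k \<noteq> 0)"
proof
  assume "ygen k dvd f"
  then obtain q where "f = ygen k * q" by blast
  then have "var0 k f = 0" by (simp add: var0_def msubst_mult)
  then show "\<forall>m\<in>Poly_Mapping.keys f. Poly_Mapping.lookup m k \<noteq> 0"
    using lookup_var0[of k f] by (metis in_keys_iff lookup_zero)
next
  assume "\<forall>m\<in>Poly_Mapping.keys f. Poly_Mapping.lookup m k \<noteq> 0"
  then show "ygen k dvd f" using ygen_power_dvdI[of f 1 k] by (auto simp: Suc_le_eq)
qed

lemma ygen_dvd_iff_var0: "ygen k dvd f \<longleftrightarrow> var0 k f = 0"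
proof
  assume "var0 k f = 0"
  then show "ygen k dvd f"
    unfolding ygen_dvd_iff_keys using lookup_var0[of k f] by (metis in_keys_iff lookup_zero)
qed (auto simp: var0_def msubst_mult elim!: dvdE)

lemma var0_vpoly: "f \<in> vpoly A \<Longrightarrow> var0 k f \<in> vpoly (A - {k})"
  unfolding var0_def by (rule msubst_vpoly) (auto simp: vpoly_ygen)

subsection \<open>Frobenius\<close>

lemma of_nat_mpoly: "(of_nat k :: 'a::comm_ring_1 mpoly) = mconst (of_nat k)"
  by (induction k) (simp_all add: mconst_add)

lemma CHAR_mpoly [simp]: "CHAR('p::prime_card mod_ring mpoly) = CARD('p)"
proof (rule CHAR_eqI)
  show "of_nat CARD('p) = (0 :: 'p mod_ring mpoly)"
    by (simp add: of_nat_mpoly)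
  fix k assume "of_nat k = (0 :: 'p mod_ring mpoly)"
  then have "of_nat k = (0 :: 'p mod_ring)" by (simp add: of_nat_mpoly)
  then show "CARD('p) dvd k" by (simp add: of_nat_eq_0_iff_char_dvd)
qed

lemma prime_CARD [simp]: "prime (CARD('p::prime_card))"
  by (rule prime_card)

lemma CARD_gt_1: "Suc 0 < CARD('p::prime_card)"
  using prime_gt_1_nat[OF prime_card] by simp

lemma frob_sum: "(sum f A :: 'p::prime_card mod_ring mpoly) ^ (CARD('p) ^ k) = (\<Sum>i\<in>A. f i ^ (CARD('p) ^ k))"
  by (rule freshmans_dream_sum') simp_all

lemma frob_add: "(f + g :: 'p::prime_card mod_ring mpoly) ^ (CARD('p) ^ k) =
    f ^ (CARD('p) ^ k) + g ^ (CARD('p) ^ k)"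
  by (rule freshmans_dream') simp_all

lemma frob_diff: "(f - g :: 'p::prime_card mod_ring mpoly) ^ (CARD('p) ^ k) =
    f ^ (CARD('p) ^ k) - g ^ (CARD('p) ^ k)"
  using frob_add[of "f - g" g k] by (simp add: algebra_simps)

lemma mod_ring_power_CARD [simp]: "(c :: 'p::prime_card mod_ring) ^ CARD('p) = c"
  using finite_field_power_card_eq_same[of c] by simp

lemma mod_ring_power_CARD_power [simp]: "(c :: 'p::prime_card mod_ring) ^ (CARD('p) ^ k) = c"
  by (induction k) (simp_all add: power_mult)

lemma mod_ring_power_CARD_minus_1: "(c :: 'p::prime_card mod_ring) \<noteq> 0 \<Longrightarrow> c ^ (CARD('p) - 1) = 1"
proof -
  assume "c \<noteq> 0"
  have "c * c ^ (CARD('p) - 1) = c * 1"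
    using mod_ring_power_CARD[of c] power_eq_if[of c "CARD('p)"] by simp
  with \<open>c \<noteq> 0\<close> show ?thesis using mult_left_cancel by blast
qed

lemma mconst_power_CARD_power [simp]: "mconst (c :: 'p::prime_card mod_ring) ^ (CARD('p) ^ k) = mconst c"
  by (simp flip: mconst_power)

lemma frob_inj: "(f :: 'p::prime_card mod_ring mpoly) ^ CARD('p) = g ^ CARD('p) \<Longrightarrow> f = g"
  using frob_diff[of f g 1] by simp

text \<open>Compare two monic polynomials of degree \<open>p\<close> in the unknown
  \<open>A\<close>: both vanish at the \<open>p\<close> multiples of \<open>B\<close>. For
  \<open>B = 0\<close> these multiples coincide, so that case is separate.\<close>

lemma prod_minus_mconst_mult:
  fixes A B :: "'p::prime_card mod_ring mpoly"
  shows "(\<Prod>c\<in>UNIV. A - mconst c * B) = A ^ CARD('p) - B ^ (CARD('p) - 1) * A"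
proof (cases "B = 0")
  case True
  then show ?thesis using CARD_gt_1[where 'p = 'p] by (simp add: power_0_left)
next
  case False
  define Q where "Q = (\<Prod>c\<in>(UNIV :: 'p mod_ring set). [:- (mconst c * B), 1:])"
  define R where "R = monom (1 :: 'p mod_ring mpoly) CARD('p) - monom (B ^ (CARD('p) - 1)) 1"
  have p1: "CARD('p) \<noteq> 1" "CARD('p) > 0" using CARD_gt_1[where 'p = 'p] by linarith+
  have dQ: "degree Q = CARD('p)"
    unfolding Q_def by (subst degree_prod_eq_sum_degree) simp_all
  have "lead_coeff Q = 1" unfolding Q_def by (subst lead_coeff_prod) simp
  moreover have "coeff R CARD('p) = 1" unfolding R_def using p1 by simp
  ultimately have "coeff Q CARD('p) = coeff R CARD('p)" using dQ by simp
  moreover have "degree R \<le> CARD('p)" unfolding R_def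
    using p1 by (intro degree_diff_le) (auto intro: degree_monom_le order_trans[OF degree_monom_le])
  moreover have "poly Q x = poly R x" if "x \<in> range (\<lambda>c. mconst c * B)" for x
  proof -
    from that obtain c where x: "x = mconst c * B" by blast
    have "poly Q x = 0" unfolding Q_def poly_prod
      by (rule prod_zero) (auto simp: x)
    moreover have "poly R x = 0" unfolding R_def
      using p1(2) mconst_power_CARD_power[of c 1] power_minus_mult[of "CARD('p)" B]
      by (simp add: x poly_monom power_mult_distrib mult_ac)
    ultimately show ?thesis by simp
  qed
  moreover have "card (range (\<lambda>c. mconst c * B)) = CARD('p)"
    using False by (subst card_image) (auto simp: inj_on_def)
  ultimately have "Q = R"
    using dQ by (intro poly_eqI_degree_lead_coeff[of _ "CARD('p)" _ "range (\<lambda>c. mconst c * B)"]) auto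
  then have "poly Q A = poly R A" by simp
  then show ?thesis unfolding Q_def R_def by (simp add: poly_prod poly_monom)
qed

text \<open>With \<open>r\<close> the remainder of \<open>e\<close> modulo \<open>p - 1\<close>, all
  \<open>p - 1\<close> units are roots of \<open>t^r - 1\<close>, too many if
  \<open>0 < r < p - 1\<close>.\<close>

lemma CARD_minus_1_dvd:
  assumes "\<And>\<mu> :: 'p::prime_card mod_ring. \<mu> \<noteq> 0 \<Longrightarrow> \<mu> ^ e = 1"
  shows "CARD('p) - 1 dvd e"
proof (rule ccontr)
  assume "\<not> CARD('p) - 1 dvd e"
  define r where "r = e mod (CARD('p) - 1)"
  have r: "0 < r" "r < CARD('p) - 1"
    using \<open>\<not> _\<close> CARD_gt_1[where 'p = 'p] by (auto simp: r_def dvd_eq_mod_eq_0)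
  define Q where "Q = monom (1 :: 'p mod_ring) r - 1"
  have root: "poly Q \<mu> = 0" if "\<mu> \<noteq> 0" for \<mu>
  proof -
    have "1 = \<mu> ^ ((CARD('p) - 1) * (e div (CARD('p) - 1)) + r)"
      using assms[OF that] by (simp only: r_def mult_div_mod_eq)
    also have "\<dots> = \<mu> ^ r"
      using that mod_ring_power_CARD_minus_1[OF that] by (simp only: power_add power_mult power_one mult_1_left)
    finally show ?thesis by (simp add: Q_def poly_monom)
  qed
  have "coeff Q r = 1" using r by (simp add: Q_def)
  then have Q0: "Q \<noteq> 0" by auto
  have "degree Q \<le> r" unfolding Q_def by (intro degree_diff_le degree_monom_le) simp
  moreover have "card (UNIV - {0 :: 'p mod_ring}) \<le> card {x. poly Q x = 0}"
    using root by (intro card_mono poly_roots_finite[OF Q0]) auto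
  moreover have "card {x. poly Q x = 0} \<le> degree Q"
    using card_poly_roots_bound[OF Q0] .
  ultimately show False using r by (simp add: card_Diff_singleton)
qed

text \<open>Monomials are eigenvectors of a scaling, so the condition can be read off one exponent
  at a time. The twist \<open>r\<close> is 0 for invariant polynomials and 1 for the coefficient of
  an exterior monomial that contains \<open>x_k\<close>.\<close>

lemma scale_var_keys:
  fixes f :: "'p::prime_card mod_ring mpoly"
  assumes "\<And>\<mu>. \<mu> \<noteq> 0 \<Longrightarrow> mconst (\<mu> ^ r) * scale_var k \<mu> f = f" "m \<in> Poly_Mapping.keys f"
  shows "CARD('p) - 1 dvd Poly_Mapping.lookup m k + r"
proof (rule CARD_minus_1_dvd)
  fix \<mu> :: "'p mod_ring" assume "\<mu> \<noteq> 0"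
  have "Poly_Mapping.lookup (mconst a * g) m = a * Poly_Mapping.lookup g m" for a :: "'p mod_ring" and g
    unfolding mconst_def mult_map_scale_conv_mult[symmetric] by (simp add: map.rep_eq when_def)
  then have "\<mu> ^ r * (\<mu> ^ Poly_Mapping.lookup m k * Poly_Mapping.lookup f m) = Poly_Mapping.lookup f m"
    using assms(1)[OF \<open>\<mu> \<noteq> 0\<close>] by (metis lookup_scale_var)
  then show "\<mu> ^ (Poly_Mapping.lookup m k + r) = 1"
    using assms(2) by (simp add: in_keys_iff power_add mult_ac)
qed

lemma ygen_power_dvd_of_scale_var:
  fixes f :: "'p::prime_card mod_ring mpoly"
  assumes "\<And>\<mu>. \<mu> \<noteq> 0 \<Longrightarrow> scale_var k \<mu> f = f" "ygen k dvd f"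
  shows "ygen k ^ (CARD('p) - 1) dvd f"
proof (rule ygen_power_dvdI)
  fix m assume m: "m \<in> Poly_Mapping.keys f"
  have "CARD('p) - 1 dvd Poly_Mapping.lookup m k"
    using scale_var_keys[of 0 k f m] assms(1) m by simp
  moreover have "Poly_Mapping.lookup m k \<noteq> 0" using assms(2) m by (simp add: ygen_dvd_iff_keys)
  ultimately show "CARD('p) - 1 \<le> Poly_Mapping.lookup m k" by (simp add: dvd_imp_le)
qed

subsection \<open>Linear forms are prime\<close>

lemma dvd_diff_mult: "d dvd a - b \<Longrightarrow> d dvd a' - b' \<Longrightarrow> d dvd a * a' - b * (b' :: 'a::comm_ring_1)"
proof -
  assume "d dvd a - b" "d dvd a' - b'"
  then have "d dvd (a - b) * a' + b * (a' - b')" by (intro dvd_add dvd_mult dvd_mult2)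
  then show ?thesis by (simp add: algebra_simps)
qed

lemma dvd_diff_power: "d dvd a - b \<Longrightarrow> d dvd a ^ k - (b ^ k :: 'a::comm_ring_1)"
  by (induction k) (auto intro: dvd_diff_mult)

lemma dvd_diff_prod: "(\<And>i. i \<in> A \<Longrightarrow> d dvd f i - g i) \<Longrightarrow> d dvd prod f A - (prod g A :: 'a::comm_ring_1)"
  by (induction A rule: infinite_finite_induct) (auto intro: dvd_diff_mult)

lemma msubst_diff_dvd: 
  assumes "\<And>i. d dvd g i - h i"
  shows "d dvd msubst g f - msubst h f"
  unfolding msubst_def sum_subtractf[symmetric] right_diff_distrib[symmetric]
  by (intro dvd_sum dvd_mult dvd_diff_prod dvd_diff_power assms)

text \<open>As \<open>v\<close> does not involve \<open>y_j\<close>, the substitution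
  \<open>y_j := v\<close> is the quotient map modulo \<open>y_j - v\<close>. Its target is again a
  polynomial ring, which makes linear forms prime.\<close>

lemma lin_form_dvd_iff:
  assumes "v \<in> vpoly A" "j \<notin> A"
  shows "ygen j - v dvd f \<longleftrightarrow> msubst (ygen(j := v)) f = 0"
proof
  assume "ygen j - v dvd f"
  then obtain q where "f = (ygen j - v) * q" by blast
  moreover have "msubst (ygen(j := v)) v = v"
    by (rule vpoly_msubst_id[OF assms(1)]) (use assms(2) in auto)
  ultimately show "msubst (ygen(j := v)) f = 0" by (simp add: msubst_hom)
next
  assume "msubst (ygen(j := v)) f = 0"
  moreover have "ygen j - v dvd msubst ygen f - msubst (ygen(j := v)) f"
    by (rule msubst_diff_dvd) simp
  ultimately show "ygen j - v dvd f" by simp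
qed

lemma ygen_eq_iff [simp]: "(ygen i :: 'a::comm_ring_1 mpoly) = ygen j \<longleftrightarrow> i = j"
proof
  assume eq: "(ygen i :: 'a mpoly) = ygen j"
  have "Poly_Mapping.keys (ygen i :: 'a mpoly) = {Poly_Mapping.single i 1}" 
    "Poly_Mapping.keys (ygen j :: 'a mpoly) = {Poly_Mapping.single j 1}"
    by (simp_all add: ygen_def)
  with eq have "Poly_Mapping.single i (1::nat) = Poly_Mapping.single j 1" by simp
  then show "i = j" by (metis lookup_single_eq lookup_single_not_eq zero_neq_one)
qed simp

lemma ygen_not_vpoly: "j \<notin> A \<Longrightarrow> (ygen j :: 'a::comm_ring_1 mpoly) \<notin> vpoly A"
  by (auto simp: vpoly_def ygen_def)

lemma ygen_nonzero [simp]: "(ygen j :: 'a::comm_ring_1 mpoly) \<noteq> 0"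
  using ygen_not_vpoly[of j "{}"] vpoly_0[of "{}"] by (metis empty_iff)

lemma lin_form_nonzero: "v \<in> vpoly A \<Longrightarrow> j \<notin> A \<Longrightarrow> ygen j - v \<noteq> 0"
  using ygen_not_vpoly[of j A] by auto

lemma prime_elem_lin_form:
  fixes v :: "'a::idom mpoly"
  assumes "v \<in> vpoly A" "j \<notin> A"
  shows "prime_elem (ygen j - v)"
proof (rule prime_elemI)
  show "ygen j - v \<noteq> 0" using lin_form_nonzero[OF assms] .
  show "\<not> ygen j - v dvd 1" using lin_form_dvd_iff[OF assms, of 1] by simp
qed (simp add: lin_form_dvd_iff[OF assms] msubst_mult)

text \<open>The forms are normalised to have top coefficient one, so each line is represented once
  and distinct forms are not associate. Divisibility by each of them can then be combined into
  divisibility by the product.\<close>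

lemma lin_form_dvd_lin_form:
  fixes v :: "'a::idom mpoly"
  assumes "v \<in> vpoly {..<j}" "v' \<in> vpoly {..<j'}" "ygen j - v dvd ygen j' - v'"
  shows "j = j' \<and> v = v'"
proof -
  have z: "msubst (ygen(j := v)) (ygen j') = msubst (ygen(j := v)) v'"
    using assms(3) lin_form_dvd_iff[OF assms(1)] by (simp add: msubst_diff)
  have *: "msubst (ygen(j := v)) v' \<in> vpoly {..<j'}" if "j < j'"
    by (rule msubst_vpoly[OF assms(2)])
      (use that assms(1) vpoly_mono[of "{..<j}" "{..<j'}"] in \<open>auto intro: vpoly_ygen\<close>)
  have **: "msubst (ygen(j := v)) v' = v'" if "j' \<le> j"
    by (rule vpoly_msubst_id[OF assms(2)]) (use that in auto)
  consider "j < j'" | "j = j'" | "j' < j" by linarith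
  then show ?thesis
  proof cases
    case 1
    with z * ygen_not_vpoly[of j' "{..<j'}"] show ?thesis by (metis lessThan_iff less_irrefl fun_upd_other msubst_ygen_var)
  next
    case 2
    with z ** show ?thesis by simp
  next
    case 3
    with z ** ygen_not_vpoly[of j' "{..<j'}"] assms(2) show ?thesis by auto
  qed
qed

lemma prime_elem_power_dvd_mult:
  fixes l :: "'a::idom"
  assumes "prime_elem l" "\<not> l dvd a" "l ^ e dvd a * b"
  shows "l ^ e dvd b"
  using assms(3)
proof (induction e arbitrary: b)
  case (Suc e)
  have "l dvd a * b" using Suc.prems by (metis dvd_mult_left power_Suc)
  then obtain b' where b: "b = l * b'" using assms prime_elem_dvd_multD by blast
  have "l * l ^ e dvd l * (a * b')" using Suc.prems b by (simp add: mult_ac)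
  then have "l ^ e dvd a * b'" using assms(1) by (simp add: prime_elem_not_zeroI)
  then have "l ^ e dvd b'" by (rule Suc.IH)
  then show ?case by (simp add: b mult_dvd_mono)
qed simp

text \<open>The primes are split off one at a time, which needs only that no element of
  \<open>B\<close> divides another one, not unique factorisation.\<close>

lemma prod_prime_elem_power_dvd:
  fixes f :: "'a::idom"
  assumes "finite B" "\<And>l. l \<in> B \<Longrightarrow> prime_elem l" "\<And>l l'. l \<in> B \<Longrightarrow> l' \<in> B \<Longrightarrow> l dvd l' \<Longrightarrow> l = l'"
    and "\<And>l. l \<in> B \<Longrightarrow> l ^ e dvd f"
  shows "\<Prod>B ^ e dvd f"
  using assms
proof (induction B)
  case (insert l B)
  then have "\<Prod>B ^ e dvd f" by (metis insertCI)
  then obtain q where q: "f = \<Prod>B ^ e * q" by blast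
  have "\<not> l dvd \<Prod>B"
  proof
    assume dvd: "l dvd \<Prod>B"
    have "\<exists>l'\<in>B. l dvd l'"
      using insert.hyps(1) dvd insert.prems(1)[OF insertI1]
      by (induction B rule: finite_induct) (auto dest: prime_elem_dvd_multD simp: prime_elem_def)
    with insert show False by (metis insertCI)
  qed
  then have "\<not> l dvd \<Prod>B ^ e"
    using insert.prems(1)[OF insertI1]
    by (induction e) (auto dest: prime_elem_dvd_multD simp: prime_elem_def)
  moreover have "l ^ e dvd \<Prod>B ^ e * q" using insert.prems(3)[of l] q by simp
  ultimately have "l ^ e dvd q" using insert.prems(1)[of l] prime_elem_power_dvd_mult by blast
  then show ?case using insert.hyps q by (simp add: power_mult_distrib mult_dvd_mono mult.commute)
qed simp

subsection \<open>Products over the translates of a linear span\<close>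

definition lspan :: "(nat \<Rightarrow> 'a::comm_ring_1 mpoly) \<Rightarrow> nat set \<Rightarrow> 'a mpoly set" where
  "lspan z A = range (\<lambda>c. \<Sum>i\<in>A. mconst (c i) * z i)"

text \<open>For \<open>z = ygen\<close>, \<open>A = {0..<j}\<close> and \<open>X = ygen j\<close>
  this is \<open>mui_h j\<close>. Other families \<open>z\<close> occur as well: modulo the fixed
  line the variables are replaced by \<open>line_norm (ygen i)\<close>.\<close>

definition span_prod :: "(nat \<Rightarrow> 'a::comm_ring_1 mpoly) \<Rightarrow> nat set \<Rightarrow> 'a mpoly \<Rightarrow> 'a mpoly" where
  "span_prod z A X = (\<Prod>v\<in>lspan z A. X - v)"

lemma finite_lspan:
  fixes z :: "nat \<Rightarrow> 'a::{comm_ring_1,finite} mpoly"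
  assumes "finite A" shows "finite (lspan z A)"
proof -
  have "lspan z A \<subseteq> (\<lambda>c. \<Sum>i\<in>A. mconst (c i) * z i) ` (A \<rightarrow>\<^sub>E UNIV)"
  proof
    fix v assume "v \<in> lspan z A"
    then obtain c where "v = (\<Sum>i\<in>A. mconst (c i) * z i)" by (auto simp: lspan_def)
    then have "v = (\<Sum>i\<in>A. mconst (restrict c A i) * z i)" by simp
    then show "v \<in> (\<lambda>c. \<Sum>i\<in>A. mconst (c i) * z i) ` (A \<rightarrow>\<^sub>E UNIV)"
      by (rule image_eqI[of _ _ "restrict c A"]) simp
  qed
  moreover have "finite (A \<rightarrow>\<^sub>E (UNIV :: 'a set))" using assms by (intro finite_PiE) auto
  ultimately show ?thesis by (meson finite_imageI finite_subset)
qed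

lemma lspan_ygen_vpoly: "lspan ygen A \<subseteq> vpoly A"
  by (auto simp: lspan_def intro!: vpoly_closed vpoly_ygen)

text \<open>The factors of the product are pairwise non-associate primes, so the powers can be
  collected. For \<open>b = 0\<close> and \<open>J = {..<n}\<close> the product is
  \<open>mui_L n\<close>; for \<open>b = k\<close> and \<open>J = {k..<n}\<close> its
  \<open>(p-1)\<close>-st power is the bottom Dickson invariant.\<close>

lemma span_prod_flag_power_dvd:
  fixes f :: "'a::{idom,finite} mpoly"
  assumes "finite J" "\<And>j v. j \<in> J \<Longrightarrow> v \<in> lspan ygen {b..<j} \<Longrightarrow> (ygen j - v) ^ e dvd f"
  shows "(\<Prod>j\<in>J. span_prod ygen {b..<j} (ygen j)) ^ e dvd f"
proof -
  define S where "S = Sigma J (\<lambda>j. lspan (ygen :: nat \<Rightarrow> 'a mpoly) {b..<j})"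
  define l where "l = (\<lambda>(j, v). ygen j - v :: 'a mpoly)"
  have S: "finite S" unfolding S_def using assms(1) by (auto intro: finite_lspan)
  have v: "v \<in> vpoly {..<j}" if "(j, v) \<in> S" for j v
    using that lspan_ygen_vpoly[of "{b..<j}"] vpoly_mono[of "{b..<j}" "{..<j}"]
    by (fastforce simp: S_def)
  have eq: "x = x'" if "x \<in> S" "x' \<in> S" "l x dvd l x'" for x x'
  proof -
    obtain j w j' w' where "x = (j, w)" "x' = (j', w')" by fastforce
    then show ?thesis using that lin_form_dvd_lin_form[OF v[of j w] v[of j' w']] by (simp add: l_def)
  qed
  have "inj_on l S" using eq by (intro inj_onI) (metis dvd_refl)
  have "(\<Prod>j\<in>J. span_prod ygen {b..<j} (ygen j)) = (\<Prod>x\<in>S. l x)"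
    unfolding span_prod_def S_def l_def
    by (rule prod.Sigma) (use assms(1) in \<open>auto intro: finite_lspan\<close>)
  also have "\<dots> = \<Prod>(l ` S)" by (simp add: prod.reindex[OF \<open>inj_on l S\<close>])
  also have "\<dots> ^ e dvd f"
  proof (rule prod_prime_elem_power_dvd)
    fix x assume "x \<in> l ` S"
    then obtain j v where "(j, v) \<in> S" "x = ygen j - v" by (auto simp: l_def)
    then show "prime_elem x" "x ^ e dvd f"
      using prime_elem_lin_form[OF v] assms(2) by (auto simp: S_def)
  qed (use S eq in auto)
  finally show ?thesis .
qed

text \<open>
  From one power \<open>y_{i0}^e\<close> dividing an invariant, the shears move the variable to every linear
  form \<open>y_j - v\<close>: first \<open>y_{i0} \<mapsto> y_{i0} + y_j \<mapsto> y_j\<close>, and then one subtracts the terms of \<open>v\<close>.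
\<close>

lemma shear_var_lin_form_power_dvd:
  fixes f :: "'a::idom mpoly"
  assumes inv: "\<And>i j c. i \<in> {a..<n} \<Longrightarrow> j \<in> {b..<n} \<Longrightarrow> i \<noteq> j \<Longrightarrow> shear_var i j c f = f"
    and "b \<le> a" "i0 \<in> {a..<n}" "ygen i0 ^ e dvd f" "j \<in> {a..<n}" "v \<in> lspan ygen {b..<j}"
  shows "(ygen j - v) ^ e dvd f"
proof -
  have shear: "shear_var i j c l ^ e dvd f"
    if "i \<in> {a..<n}" "j \<in> {b..<n}" "i \<noteq> j" "l ^ e dvd f" for i j c and l :: "'a mpoly"
    using inv[OF that(1-3), of c] msubst_dvd[OF that(4), of "ygen(i := ygen i + mconst c * ygen j)"]
    by (simp add: shear_var_def msubst_power)
  have j: "ygen j ^ e dvd f"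
  proof (cases "j = i0")
    case False
    have "(ygen i0 + ygen j) ^ e dvd f"
      using shear[of i0 j "ygen i0" 1] False assms by (simp add: shear_var_def)
    then show ?thesis
      using shear[of j i0 "ygen i0 + ygen j" "-1"] False assms
      by (simp add: shear_var_def msubst_hom mconst_uminus)
  qed (use assms in simp)
  obtain c where c: "v = (\<Sum>i\<in>{b..<j}. mconst (c i) * ygen i)"
    using assms by (auto simp: lspan_def)
  have "(ygen j - (\<Sum>i\<in>B. mconst (c i) * ygen i)) ^ e dvd f" if "finite B" "B \<subseteq> {b..<j}" for B
    using that
  proof (induction B)
    case (insert i B)
    let ?w = "\<Sum>i\<in>B. mconst (c i) * ygen i"
    have w: "?w \<in> vpoly {b..<j}" using insert.prems by (intro vpoly_closed vpoly_ygen vpoly_mconst) auto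
    have "shear_var j i (- c i) ?w = ?w"
      unfolding shear_var_def by (rule vpoly_msubst_id[OF w]) auto
    then have "shear_var j i (- c i) (ygen j - ?w) = ygen j - (mconst (c i) * ygen i + ?w)"
      by (simp add: shear_var_def msubst_hom mconst_uminus algebra_simps)
    moreover have "shear_var j i (- c i) (ygen j - ?w) ^ e dvd f"
      by (rule shear) (use insert assms in auto)
    ultimately show ?case using insert.hyps by simp
  qed (use j in simp)
  from this[of "{b..<j}"] show ?thesis by (simp add: c)
qed

subsection \<open>Polynomials in p-th powers\<close>

text \<open>The coefficient of \<open>y_k\<close> in \<open>f(y_i + y_k) - f\<close> is the partial derivative of \<open>f\<close> by \<open>y_i\<close>.\<close>

lemma shear_var_keys:
  fixes f :: "'p::prime_card mod_ring mpoly"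
  assumes "shear_var i k 1 f = f" "i \<noteq> k" "m \<in> Poly_Mapping.keys f" "Poly_Mapping.lookup m k = 0"
  shows "CARD('p) dvd Poly_Mapping.lookup m i"
proof (rule ccontr)
  assume not: "\<not> CARD('p) dvd Poly_Mapping.lookup m i"
  let ?y = "ygen :: nat \<Rightarrow> 'p mod_ring mpoly"
  define E where "E = (\<lambda>m. Poly_Mapping.lookup m i :: nat)"
  define q where "q = (\<lambda>m. m - Poly_Mapping.single i (E m))"
  define D where "D = (\<lambda>m. mconst (Poly_Mapping.lookup f m) * of_nat (E m) * ?y i ^ (E m - 1) * mono_subst ?y (q m))"
  have taylor: "?y k ^ 2 dvd (?y i + ?y k) ^ e - ?y i ^ e - of_nat e * ?y i ^ (e - 1) * ?y k" for e
  proof (induction e)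
    case (Suc e)
    let ?r = "(?y i + ?y k) ^ e - ?y i ^ e - of_nat e * ?y i ^ (e - 1) * ?y k"
    have "?y i * (of_nat e * ?y i ^ (e - 1)) = of_nat e * ?y i ^ e" by (cases e) auto
    then have "(?y i + ?y k) ^ Suc e - ?y i ^ Suc e - of_nat (Suc e) * ?y i ^ (Suc e - 1) * ?y k =
        (?y i + ?y k) * ?r + of_nat e * ?y i ^ (e - 1) * ?y k ^ 2"
      by (simp add: algebra_simps power2_eq_square)
    then show ?case using Suc by (simp add: dvd_add)
  qed simp
  have mono: "mono_subst ?y m = ?y i ^ E m * mono_subst ?y (q m)" for m
    using mono_subst_upd[of i "?y i" m] by (simp add: E_def q_def)
  have upd: "mono_subst (?y(i := ?y i + ?y k)) m = (?y i + ?y k) ^ E m * mono_subst ?y (q m)" for m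
    using mono_subst_upd[of i "?y i + ?y k" m] by (simp only: E_def q_def)
  have "?y k ^ 2 dvd shear_var i k 1 f - f - (\<Sum>m\<in>Poly_Mapping.keys f. D m) * ?y k"
  proof -
    have "shear_var i k 1 f - f - (\<Sum>m\<in>Poly_Mapping.keys f. D m) * ?y k =
        (\<Sum>m\<in>Poly_Mapping.keys f. mconst (Poly_Mapping.lookup f m) *
          mono_subst (?y(i := ?y i + ?y k)) m - mconst (Poly_Mapping.lookup f m) * mono_subst ?y m
          - D m * ?y k)"
      using msubst_ygen_id[of f] by (simp add: shear_var_def msubst_def mono_subst_def[symmetric]
          sum_subtractf sum_distrib_right del: fun_upd_apply)
    also have "\<dots> = (\<Sum>m\<in>Poly_Mapping.keys f. mconst (Poly_Mapping.lookup f m) * mono_subst ?y (q m) *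
        ((?y i + ?y k) ^ E m - ?y i ^ E m - of_nat (E m) * ?y i ^ (E m - 1) * ?y k))"
    proof (rule sum.cong[OF refl])
      fix x
      have alg: "c * (P * M) - c * (Y * M) - c * N * Z * M * K = c * M * (P - Y - N * Z * K)"
        for c P M Y N Z K :: "'p mod_ring mpoly"
        by (simp add: algebra_simps)
      show "mconst (Poly_Mapping.lookup f x) * mono_subst (?y(i := ?y i + ?y k)) x
          - mconst (Poly_Mapping.lookup f x) * mono_subst ?y x - D x * ?y k =
        mconst (Poly_Mapping.lookup f x) * mono_subst ?y (q x) *
        ((?y i + ?y k) ^ E x - ?y i ^ E x - of_nat (E x) * ?y i ^ (E x - 1) * ?y k)"
        unfolding upd D_def mono[of x] by (rule alg)
    qed
    also have "?y k ^ 2 dvd \<dots>" by (intro dvd_sum dvd_mult taylor)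
    finally show ?thesis .
  qed
  \<comment> \<open>Invariance removes the difference \<open>shear_var i k 1 f - f\<close>, so
    \<open>y_k^2\<close> divides \<open>y_k\<close> times the formal derivative of \<open>f\<close>
    by \<open>y_i\<close>; one factor cancels.\<close>
  then have "?y k * ?y k dvd (\<Sum>m\<in>Poly_Mapping.keys f. D m) * ?y k"
    using assms(1) by (simp add: power2_eq_square)
  then have dvd: "?y k dvd (\<Sum>m\<in>Poly_Mapping.keys f. D m)" by simp
  define r where "r = (\<lambda>m. q m + Poly_Mapping.single i (E m - 1))"
  have D: "D m = Poly_Mapping.single (r m) (of_nat (E m) * Poly_Mapping.lookup f m)" for m
    by (simp add: D_def r_def single_eq_mconst_mono mono_subst_add mconst_mult of_nat_mpoly mult_ac)
  \<comment> \<open>Distinct monomials containing \<open>y_i\<close> stay distinct after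
    differentiation, and the others contribute zero. Hence the term coming from \<open>m\<close>
    cannot cancel.\<close>
  have r_inj: "m' = m" if "r m' = r m" "E m' \<noteq> 0" for m'
  proof (rule poly_mapping_eqI)
    fix l
    have "Poly_Mapping.lookup (r m') l = Poly_Mapping.lookup (r m) l" using that by simp
    moreover have "E m \<noteq> 0" using not by (auto simp: E_def intro!: Nat.gr0I)
    ultimately show "Poly_Mapping.lookup m' l = Poly_Mapping.lookup m l"
      using that(2) by (cases "l = i") (auto simp: r_def q_def E_def lookup_add lookup_minus lookup_single when_def)
  qed
  have "Poly_Mapping.lookup (\<Sum>m\<in>Poly_Mapping.keys f. D m) (r m) =
      (\<Sum>m'\<in>Poly_Mapping.keys f. if m' = m then of_nat (E m) * Poly_Mapping.lookup f m else 0)"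
    unfolding lookup_sum D lookup_single
  proof (rule sum.cong[OF refl])
    fix m'
    show "(of_nat (E m') * Poly_Mapping.lookup f m' when r m' = r m) =
        (if m' = m then of_nat (E m) * Poly_Mapping.lookup f m else 0)"
      using r_inj[of m'] by (cases "m' = m"; cases "E m' = 0") (auto simp: when_def)
  qed
  also have "\<dots> = of_nat (E m) * Poly_Mapping.lookup f m" using assms(3) by simp
  also have "\<dots> \<noteq> 0"
    using not assms(3) by (simp add: E_def in_keys_iff of_nat_eq_0_iff_char_dvd)
  finally have "r m \<in> Poly_Mapping.keys (\<Sum>m\<in>Poly_Mapping.keys f. D m)" by (simp add: in_keys_iff)
  moreover have "Poly_Mapping.lookup (r m) k = 0"
    using assms(2,4) by (simp add: r_def q_def lookup_add lookup_minus lookup_single when_def)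
  ultimately show False using dvd by (metis ygen_dvd_iff_keys)
qed

definition lin_indep :: "(nat \<Rightarrow> 'a::comm_ring_1 mpoly) \<Rightarrow> nat set \<Rightarrow> bool" where
  "lin_indep z A \<longleftrightarrow> (\<forall>c. (\<Sum>i\<in>A. mconst (c i) * z i) = 0 \<longrightarrow> (\<forall>i\<in>A. c i = 0))"

lemma lin_indepD: "lin_indep z A \<Longrightarrow> (\<Sum>i\<in>A. mconst (c i) * z i) = 0 \<Longrightarrow> i \<in> A \<Longrightarrow> c i = 0"
  by (auto simp: lin_indep_def)

lemma lin_indep_eqD:
  assumes "lin_indep z A" "(\<Sum>i\<in>A. mconst (c i) * z i) = (\<Sum>i\<in>A. mconst (d i) * z i)" "i \<in> A"
  shows "c i = d i"
  using lin_indepD[OF assms(1), of "\<lambda>i. c i - d i"] assms(2,3)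
  by (simp add: mconst_diff left_diff_distrib sum_subtractf)

lemma lin_indep_mono:
  assumes "lin_indep z B" "A \<subseteq> B" "finite B"
  shows "lin_indep z A"
  unfolding lin_indep_def
proof (intro allI impI ballI)
  fix c i assume z: "(\<Sum>i\<in>A. mconst (c i) * z i) = 0" and i: "i \<in> A"
  have "(\<Sum>i\<in>B. mconst (if i \<in> A then c i else 0) * z i) = (\<Sum>i\<in>A. mconst (c i) * z i)"
    by (rule sum.mono_neutral_cong_right) (use assms in auto)
  then show "c i = 0"
    using lin_indepD[OF assms(1), of "\<lambda>i. if i \<in> A then c i else 0" i] z i assms(2) by auto
qed

lemma lin_indep_ygen:
  assumes "finite A" shows "lin_indep (ygen :: nat \<Rightarrow> 'a::comm_ring_1 mpoly) A"
  unfolding lin_indep_def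
proof (intro allI impI ballI)
  fix c i assume z: "(\<Sum>i\<in>A. mconst (c i) * ygen i) = (0 :: 'a mpoly)" and i: "i \<in> A"
  have *: "mconst b * ygen j = (Poly_Mapping.single (Poly_Mapping.single j 1) b :: 'a mpoly)" for b j
    by (simp add: mconst_def ygen_def mult_single)
  have inj: "Poly_Mapping.single j (Suc 0) = Poly_Mapping.single i (Suc 0) \<longleftrightarrow> j = i" for j
    by (metis lookup_single_eq lookup_single_not_eq nat.distinct(1))
  have "c i = Poly_Mapping.lookup (\<Sum>i\<in>A. mconst (c i) * ygen i) (Poly_Mapping.single i 1)"
    using assms i by (simp add: * lookup_sum lookup_single when_def inj sum.delta del: single_one)
  then show "c i = 0" by (simp add: z)
qed

lemma zero_in_lspan: "0 \<in> lspan z A"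
  unfolding lspan_def by (rule image_eqI[of _ _ "\<lambda>_. 0"]) simp_all

lemma lspan_insert:
  assumes "finite A" "i \<notin> A"
  shows "lspan z (insert i A) = (\<lambda>(c, v). mconst c * z i + v) ` (UNIV \<times> lspan z A)"
proof (intro subset_antisym subsetI)
  fix x assume "x \<in> lspan z (insert i A)"
  then obtain c where "x = (\<Sum>i\<in>insert i A. mconst (c i) * z i)" by (auto simp: lspan_def)
  then show "x \<in> (\<lambda>(c, v). mconst c * z i + v) ` (UNIV \<times> lspan z A)"
    using assms by (intro image_eqI[of _ _ "(c i, \<Sum>i\<in>A. mconst (c i) * z i)"]) (auto simp: lspan_def)
next
  fix x assume "x \<in> (\<lambda>(c, v). mconst c * z i + v) ` (UNIV \<times> lspan z A)"
  then obtain b c where "x = mconst b * z i + (\<Sum>i\<in>A. mconst (c i) * z i)" by (auto simp: lspan_def)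
  moreover have "(\<Sum>j\<in>A. mconst (c j) * z j) = (\<Sum>j\<in>A. mconst ((c(i := b)) j) * z j)"
    by (rule sum.cong) (use assms in auto)
  ultimately have "x = (\<Sum>j\<in>insert i A. mconst ((c(i := b)) j) * z j)"
    using assms by simp
  then show "x \<in> lspan z (insert i A)" unfolding lspan_def by blast
qed

lemma span_prod_empty [simp]: "span_prod z {} X = X"
  by (simp add: span_prod_def lspan_def)

text \<open>\<open>span_prod\<close> runs over a set and counts each vector once. Independence
  ensures that the cosets \<open>mconst c * z i + lspan z A\<close> are disjoint for different
  \<open>c\<close>, so the product splits along them.\<close>

lemma span_prod_insert:
  assumes "finite A" "i \<notin> A" "lin_indep z (insert i A)"
  shows "span_prod z (insert i A) X = (\<Prod>c\<in>UNIV. span_prod z A (X - mconst c * z i))"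
proof -
  let ?f = "\<lambda>(c, v). mconst c * z i + v"
  have "inj_on ?f (UNIV \<times> lspan z A)"
  proof (rule inj_onI, clarify)
    fix b v b' v' assume "v \<in> lspan z A" "v' \<in> lspan z A"
      and eq: "mconst b * z i + v = mconst b' * z i + v'"
    then obtain c c' where c: "v = (\<Sum>i\<in>A. mconst (c i) * z i)" "v' = (\<Sum>i\<in>A. mconst (c' i) * z i)"
      by (auto simp: lspan_def)
    have A: "(\<Sum>j\<in>A. mconst (c j) * z j) = (\<Sum>j\<in>A. mconst ((c(i := b)) j) * z j)" for c b
      by (rule sum.cong) (use assms in auto)
    have "(\<Sum>j\<in>insert i A. mconst ((c(i := b)) j) * z j) = (\<Sum>j\<in>insert i A. mconst ((c'(i := b')) j) * z j)"
      using eq assms(1,2) c A[of c b] A[of c' b'] by simp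
    then have *: "(c(i := b)) j = (c'(i := b')) j" if "j \<in> insert i A" for j
      using lin_indep_eqD[OF assms(3)] that by blast
    have "b = b'" using *[of i] by simp
    moreover have "c j = c' j" if "j \<in> A" for j using *[of j] that assms(2) by (auto split: if_splits)
    then have "v = v'" unfolding c by simp
    ultimately show "b = b' \<and> v = v'" by simp
  qed
  then have "span_prod z (insert i A) X = (\<Prod>x\<in>UNIV \<times> lspan z A. X - ?f x)"
    unfolding span_prod_def lspan_insert[OF assms(1,2)] by (simp add: prod.reindex)
  also have "\<dots> = (\<Prod>c\<in>UNIV. \<Prod>v\<in>lspan z A. X - ?f (c, v))"
    by (simp add: prod.cartesian_product case_prod_beta)
  finally show ?thesis by (simp add: span_prod_def algebra_simps)
qed

lemma span_prod_msubst:
  assumes "inj_on (msubst g) (lspan z A)" "msubst g ` lspan z A = lspan z' B"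
  shows "msubst g (span_prod z A X) = span_prod z' B (msubst g X)"
  unfolding span_prod_def assms(2)[symmetric]
  by (simp add: prod.reindex[OF assms(1)] msubst_hom)

lemma span_prod_msubst_fixed:
  assumes "\<And>i. i \<in> A \<Longrightarrow> msubst g (z i) = z i"
  shows "msubst g (span_prod z A X) = span_prod z A (msubst g X)"
proof -
  have *: "msubst g v = v" if "v \<in> lspan z A" for v
    using that assms by (auto simp: lspan_def msubst_hom)
  show ?thesis
  proof (rule span_prod_msubst)
    show "inj_on (msubst g) (lspan z A)" using * by (metis inj_onI)
    show "msubst g ` lspan z A = lspan z A" using * by (simp add: image_cong)
  qed
qed

subsection \<open>The coefficients of the Dickson polynomial\<close>

text \<open>The recursion for the coefficients of additive polynomials under
  \<open>F_{j+1} = F_j^p - h_j^(p-1) F_j\<close>, with the sign \<open>(-1)^(j-m)\<close> stripped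
  from the coefficient of \<open>X^(p^m)\<close>. If \<open>h\<close> starts with \<open>k\<close>
  zeros, the second index is shifted by \<open>k\<close>, which lets one recursion serve every flag
  \<open>{k..<n}\<close>.\<close>

primrec dickson_coeff :: "(nat \<Rightarrow> 'p::prime_card mod_ring mpoly) \<Rightarrow> nat \<Rightarrow> nat \<Rightarrow> 'p mod_ring mpoly" where
  "dickson_coeff h 0 = (\<lambda>m. if m = 0 then 1 else 0)"
| "dickson_coeff h (Suc j) = (\<lambda>m. (if m = 0 then 0 else dickson_coeff h j (m - 1) ^ CARD('p)) +
     h j ^ (CARD('p) - 1) * dickson_coeff h j m)"

lemma CARD_minus_1_pos [simp]: "0 < CARD('p::prime_card) - 1"
  using CARD_gt_1[where 'p = 'p] by simp

lemma dickson_coeff_gt: "j < m \<Longrightarrow> dickson_coeff h j m = 0"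
  by (induction j arbitrary: m) auto

lemma dickson_coeff_self [simp]: "dickson_coeff h j j = 1"
  by (induction j) (simp_all add: dickson_coeff_gt)

lemma dickson_coeff_lt:
  assumes "\<And>i. i < k \<Longrightarrow> h i = 0" "m < k" "m < j"
  shows "dickson_coeff h j m = (0 :: 'p::prime_card mod_ring mpoly)"
  using assms(2,3)
proof (induction j arbitrary: m)
  case (Suc j)
  have "h j ^ (CARD('p) - 1) * dickson_coeff h j m = 0"
    using Suc.IH[of m] Suc.prems assms(1)[of j] CARD_minus_1_pos[where 'p = 'p]
    by (cases "m = j") (simp_all add: power_0_left)
  then show ?case using Suc.IH[of "m - 1"] Suc.prems by (auto simp: power_0_left)
qed simp

text \<open>At the lowest surviving index the p-th power summand of the recursion vanishes, so only
  the factors \<open>h i ^ (p - 1)\<close> accumulate. In the descent this is the generator that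
  gets divided out.\<close>

lemma dickson_coeff_bottom:
  assumes "\<And>i. i < k \<Longrightarrow> h i = 0" "k \<le> j"
  shows "dickson_coeff h j k = (\<Prod>i\<in>{k..<j}. h i ^ (CARD('p) - 1) :: 'p::prime_card mod_ring mpoly)"
  using assms(2)
proof (induction rule: dec_induct)
  case (step j)
  have "(if k = 0 then 0 else dickson_coeff h j (k - 1) ^ CARD('p)) = 0"
    using dickson_coeff_lt[of k h "k - 1" j] assms(1) step by (auto simp: power_0_left)
  then show ?case using step by (simp add: prod.atLeastLessThan_Suc mult.commute)
qed simp

lemma dickson_coeff_msubst: "msubst g (dickson_coeff h j m) = dickson_coeff (\<lambda>i. msubst g (h i)) j m"
  by (induction j arbitrary: m) (simp_all add: msubst_hom)

text \<open>The recursion has its coefficients in the prime field, so Frobenius passes through it.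
  Together with \<open>dickson_coeff_msubst\<close> this reduces the restriction of Dickson
  invariants to that of the \<open>h i\<close>.\<close>

lemma dickson_coeff_frob:
  "dickson_coeff (\<lambda>i. h i ^ CARD('p)) j m = (dickson_coeff h j m ^ CARD('p) :: 'p::prime_card mod_ring mpoly)"
proof (induction j arbitrary: m)
  case (Suc j)
  have "(h j ^ CARD('p)) ^ (CARD('p) - 1) = (h j ^ (CARD('p) - 1)) ^ CARD('p)"
    by (simp only: power_mult[symmetric] mult.commute)
  then show ?case
    using frob_add[where k = 1 and 'p = 'p] by (simp add: Suc power_mult_distrib power_0_left)
qed (simp add: power_0_left)

lemma dickson_coeff_vpoly:
  "(\<And>i. i < j \<Longrightarrow> h i \<in> vpoly A) \<Longrightarrow> dickson_coeff h j m \<in> vpoly A"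
  by (induction j arbitrary: m) (auto intro!: vpoly_closed)

text \<open>
  With \<open>F_j(X) = \<Prod>(X - v)\<close> over the span of \<open>z_k, \<dots>, z_{j-1}\<close>, linearity of \<open>F_j\<close> gives
  \<open>F_{j+1}(X) = \<Prod>_c F_j(X - c z_j) = F_j(X)^p - F_j(z_j)^{p-1} F_j(X)\<close>.
\<close>

lemma span_prod_eq_sum:
  fixes z :: "nat \<Rightarrow> 'p::prime_card mod_ring mpoly"
  assumes indep: "lin_indep z {k..<k + d}" and h0: "\<And>i. i < k \<Longrightarrow> h i = 0"
    and h: "\<And>i. k \<le> i \<Longrightarrow> i < k + d \<Longrightarrow> h i = span_prod z {k..<i} (z i)"
  shows "span_prod z {k..<k + d} X =
    (\<Sum>r\<le>d. (-1) ^ (d - r) * dickson_coeff h (k + d) (k + r) * X ^ (CARD('p) ^ r))"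
  using indep h
proof (induction d arbitrary: X)
  case 0
  then show ?case by simp
next
  case (Suc d)
  let ?p = "CARD('p)" and ?D = "dickson_coeff h (k + d)"
  have ind: "lin_indep z {k..<k + d}"
    by (rule lin_indep_mono[OF Suc.prems(1)]) auto
  have IH: "span_prod z {k..<k + d} X =
      (\<Sum>r\<le>d. (-1) ^ (d - r) * ?D (k + r) * X ^ (?p ^ r))" for X
    by (rule Suc.IH[OF ind Suc.prems(2)]) auto
  define A where "A = span_prod z {k..<k + d} X"
  have hd: "h (k + d) = span_prod z {k..<k + d} (z (k + d))" by (rule Suc.prems(2)) auto
  have lin: "span_prod z {k..<k + d} (X - mconst c * z (k + d)) = A - mconst c * h (k + d)" for c
  proof -
    have t: "(X - mconst c * Y) ^ (?p ^ r) = X ^ (?p ^ r) - mconst c * Y ^ (?p ^ r)" for r Y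
      by (simp add: frob_diff power_mult_distrib)
    show ?thesis
      unfolding A_def hd IH t sum_distrib_left sum_subtractf[symmetric]
      by (rule sum.cong) (simp_all add: algebra_simps)
  qed
  have ins: "{k..<k + Suc d} = insert (k + d) {k..<k + d}" by auto
  have "span_prod z {k..<k + Suc d} X = A ^ ?p - h (k + d) ^ (?p - 1) * A"
    unfolding ins
    by (subst span_prod_insert[OF _ _ Suc.prems(1)[unfolded ins]])
      (simp_all add: lin prod_minus_mconst_mult)
  also have "A ^ ?p = (\<Sum>r\<le>d. (-1) ^ (d - r) * ?D (k + r) ^ ?p * X ^ (?p ^ Suc r))"
  proof -
    have "((-1) ^ e) ^ ?p = ((-1) ^ e :: 'p mod_ring mpoly)" for e
      using mconst_power_CARD_power[of "(-1) ^ e :: 'p mod_ring" 1]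
      by (simp add: mconst_power mconst_uminus)
    then show ?thesis
      unfolding A_def IH frob_sum[where k = 1 and 'p = 'p, unfolded power_one_right]
        power_mult_distrib power_mult[symmetric] power_Suc2 by simp
  qed
  also have "\<dots> = (\<Sum>r\<le>Suc d. (-1) ^ (Suc d - r) * (if k + r = 0 then 0 else ?D (k + r - 1) ^ ?p) * X ^ (?p ^ r))"
  proof -
    \<comment> \<open>The shifted sum gains a term at \<open>r = 0\<close>. It vanishes: for
      \<open>k > 0\<close> it is the p-th power of a coefficient with index below
      \<open>k\<close>.\<close>
    have "(if k + 0 = 0 then 0 else ?D (k + 0 - 1) ^ ?p) = 0"
      using dickson_coeff_lt[of k h "k - 1" "k + d"] h0 by (auto simp: power_0_left)
    then show ?thesis by (simp add: sum.atMost_Suc_shift del: sum.atMost_Suc)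
  qed
  also have "h (k + d) ^ (?p - 1) * A =
      - (\<Sum>r\<le>Suc d. (-1) ^ (Suc d - r) * (h (k + d) ^ (?p - 1) * ?D (k + r)) * X ^ (?p ^ r))"
  proof -
    have "(\<Sum>r\<le>Suc d. (-1) ^ (Suc d - r) * (h (k + d) ^ (?p - 1) * ?D (k + r)) * X ^ (?p ^ r)) =
      (\<Sum>r\<le>d. (-1) ^ (Suc d - r) * (h (k + d) ^ (?p - 1) * ?D (k + r)) * X ^ (?p ^ r))"
      by (simp add: dickson_coeff_gt)
    also have "\<dots> = - (h (k + d) ^ (?p - 1) * A)"
      unfolding A_def IH sum_distrib_left sum_negf[symmetric]
      by (rule sum.cong) (simp_all add: Suc_diff_le algebra_simps)
    finally show ?thesis by simp
  qed
  finally show ?case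
    unfolding add_Suc_right dickson_coeff.simps
    by (simp only: diff_minus_eq_add sum.distrib[symmetric] distrib_left distrib_right)
qed

lemma infinite_UNIV_mpoly: "infinite (UNIV :: 'a::comm_ring_1 mpoly set)"
  using range_inj_infinite[of "ygen :: nat \<Rightarrow> 'a mpoly"] infinite_super[OF subset_UNIV]
  by (metis injI ygen_eq_iff)

text \<open>Applying \<open>msubst g\<close> to the coefficients yields a polynomial in
  \<open>X\<close> that agrees with the original one on the range of \<open>msubst g\<close>. An
  infinite range is enough to identify the two, and the exponents \<open>p^r\<close> are distinct,
  so the coefficients agree one by one.\<close>

lemma additive_poly_coeff_invariant:
  fixes c :: "nat \<Rightarrow> 'p::prime_card mod_ring mpoly"
  assumes sum: "\<And>X. span_prod z A X = (\<Sum>r\<le>d. c r * X ^ (CARD('p) ^ r))"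
    and inj: "inj_on (msubst g) (lspan z A)" and im: "msubst g ` lspan z A = lspan z A"
    and inf: "infinite (range (msubst g))" and "r \<le> d"
  shows "msubst g (c r) = c r"
proof -
  define Q where "Q = (\<Sum>r\<le>d. monom (msubst g (c r) - c r) (CARD('p) ^ r))"
  have root: "poly Q X = 0" if "X \<in> range (msubst g)" for X
  proof -
    from that obtain Y where X: "X = msubst g Y" by blast
    have "(\<Sum>r\<le>d. msubst g (c r) * X ^ (CARD('p) ^ r)) = msubst g (span_prod z A Y)"
      unfolding sum X by (simp add: msubst_hom)
    also have "\<dots> = span_prod z A X" unfolding X by (rule span_prod_msubst[OF inj im])
    also have "\<dots> = (\<Sum>r\<le>d. c r * X ^ (CARD('p) ^ r))" by (rule sum)
    finally show ?thesis
      by (simp add: Q_def poly_sum poly_monom left_diff_distrib sum_subtractf)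
  qed
  have "Q = 0"
  proof (rule ccontr)
    assume "Q \<noteq> 0"
    then have "finite {X. poly Q X = 0}" by (rule poly_roots_finite)
    moreover have "range (msubst g) \<subseteq> {X. poly Q X = 0}" using root by blast
    ultimately show False using inf finite_subset by blast
  qed
  then have "coeff Q (CARD('p) ^ r) = 0" by simp
  moreover have "coeff Q (CARD('p) ^ r) = (\<Sum>s\<le>d. if s = r then msubst g (c s) - c s else 0)"
    unfolding Q_def coeff_sum coeff_monom
    by (rule sum.cong) (use CARD_gt_1[where 'p = 'p] in \<open>auto simp: power_inject_exp\<close>)
  ultimately show ?thesis using \<open>r \<le> d\<close> by simp
qed

text \<open>An injective map of the finite span into itself permutes it and so fixes the additive
  polynomial having that span as its roots. The signs of the coefficients cancel at the end.\<close>

lemma dickson_coeff_invariant: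
  fixes z :: "nat \<Rightarrow> 'p::prime_card mod_ring mpoly"
  assumes "lin_indep z {k..<n}" "\<And>i. i < k \<Longrightarrow> h i = 0" "k \<le> m" "m \<le> n"
    and "\<And>i. k \<le> i \<Longrightarrow> i < n \<Longrightarrow> h i = span_prod z {k..<i} (z i)"
    and "inj_on (msubst g) (lspan z {k..<n})" "msubst g ` lspan z {k..<n} \<subseteq> lspan z {k..<n}"
    and "infinite (range (msubst g))"
  shows "msubst g (dickson_coeff h n m) = dickson_coeff h n m"
proof -
  define d where "d = n - k"
  have n: "n = k + d" using assms by (simp add: d_def)
  have im: "msubst g ` lspan z {k..<n} = lspan z {k..<n}"
    by (rule endo_inj_surj[OF finite_lspan assms(7,6)]) simp
  have "msubst g ((-1) ^ (d - r) * dickson_coeff h n (k + r)) = (-1) ^ (d - r) * dickson_coeff h n (k + r)"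
    if "r \<le> d" for r
    by (rule additive_poly_coeff_invariant[OF _ assms(6) im assms(8) that], unfold n,
        rule span_prod_eq_sum) (use assms n in auto)
  from this[of "m - k"] assms(3,4) have
    "(-1) ^ (n - m) * msubst g (dickson_coeff h n m) = (-1) ^ (n - m) * dickson_coeff h n m"
    by (simp add: msubst_hom n)
  then show ?thesis by simp
qed

section \<open>Degree bounds and the descent on the number of variables\<close>

subsection \<open>Weighted degrees\<close>

definition wdeg :: "(nat \<Rightarrow> nat) \<Rightarrow> (nat \<Rightarrow>\<^sub>0 nat) \<Rightarrow> nat" where
  "wdeg w m = (\<Sum>i\<in>Poly_Mapping.keys m. w i * Poly_Mapping.lookup m i)"

lemma wdeg_superset:
  assumes "finite A" "Poly_Mapping.keys m \<subseteq> A"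
  shows "wdeg w m = (\<Sum>i\<in>A. w i * Poly_Mapping.lookup m i)"
  unfolding wdeg_def by (rule sum.mono_neutral_left) (use assms in \<open>auto simp: in_keys_iff\<close>)

lemma wdeg_add: "wdeg w (m + m') = wdeg w m + wdeg w m'"
proof -
  let ?A = "Poly_Mapping.keys m \<union> Poly_Mapping.keys m'"
  have "wdeg w (m + m') = (\<Sum>i\<in>?A. w i * Poly_Mapping.lookup (m + m') i)"
    by (rule wdeg_superset) (use keys_add[of m m'] in auto)
  then show ?thesis
    by (simp add: wdeg_superset[of ?A m] wdeg_superset[of ?A m'] lookup_add algebra_simps sum.distrib)
qed

definition homog :: "(nat \<Rightarrow> nat) \<Rightarrow> nat \<Rightarrow> 'a::comm_ring_1 mpoly \<Rightarrow> bool" where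
  "homog w d f \<longleftrightarrow> (\<forall>m\<in>Poly_Mapping.keys f. wdeg w m = d)"

definition deg_le :: "(nat \<Rightarrow> nat) \<Rightarrow> nat \<Rightarrow> 'a::comm_ring_1 mpoly \<Rightarrow> bool" where
  "deg_le w d f \<longleftrightarrow> (\<forall>m\<in>Poly_Mapping.keys f. wdeg w m \<le> d)"

lemma homog_0 [simp]: "homog w d 0" and deg_le_0 [simp]: "deg_le w d 0"
  by (simp_all add: homog_def deg_le_def)

lemma homog_mconst [simp]: "homog w 0 (mconst c)" and deg_le_mconst [simp]: "deg_le w d (mconst c)"
  by (auto simp: homog_def deg_le_def mconst_def wdeg_def split: if_splits)

lemma homog_1 [simp]: "homog w 0 1"
  using homog_mconst[of w 1] by (simp del: homog_mconst)

lemma homog_ygen: "homog w (w i) (ygen i)"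
  by (simp add: homog_def ygen_def wdeg_def)

lemma homog_add: "homog w d f \<Longrightarrow> homog w d g \<Longrightarrow> homog w d (f + g)"
  using keys_add[of f g] by (fastforce simp: homog_def)

lemma deg_le_add: "deg_le w d f \<Longrightarrow> deg_le w d g \<Longrightarrow> deg_le w d (f + g)"
  using keys_add[of f g] by (fastforce simp: deg_le_def)

lemma homog_mult: "homog w d f \<Longrightarrow> homog w e g \<Longrightarrow> homog w (d + e) (f * g)"
  using keys_mult[of f g] by (fastforce simp: homog_def wdeg_add)

lemma deg_le_mult: "deg_le w d f \<Longrightarrow> deg_le w e g \<Longrightarrow> deg_le w (d + e) (f * g)"
  using keys_mult[of f g] by (fastforce simp: deg_le_def wdeg_add intro: add_mono)

lemma homog_power: "homog w d f \<Longrightarrow> homog w (k * d) (f ^ k)"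
  by (induction k) (simp_all add: homog_mult)

lemma homog_uminus: "homog w d f \<Longrightarrow> homog w d (- f)"
  by (simp add: homog_def in_keys_iff)

lemma homog_diff: "homog w d f \<Longrightarrow> homog w d g \<Longrightarrow> homog w d (f - g)"
  using homog_add[of w d f "- g"] homog_uminus[of w d g] by simp

lemma deg_le_diff: "deg_le w d f \<Longrightarrow> deg_le w d g \<Longrightarrow> deg_le w d (f - g)"
  using deg_le_add[of w d f "- g"] by (simp add: deg_le_def in_keys_iff)

lemma deg_le_sum: "(\<And>i. i \<in> A \<Longrightarrow> deg_le w d (f i)) \<Longrightarrow> deg_le w d (sum f A)"
  by (induction A rule: infinite_finite_induct) (simp_all add: deg_le_add)

lemma homog_prod: "(\<And>i. i \<in> A \<Longrightarrow> homog w (d i) (f i)) \<Longrightarrow> homog w (sum d A) (prod f A)"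
  by (induction A rule: infinite_finite_induct) (simp_all add: homog_mult)

lemma homog_imp_deg_le: "homog w d f \<Longrightarrow> d \<le> e \<Longrightarrow> deg_le w e f"
  by (auto simp: homog_def deg_le_def)

lemma deg_le_mono: "deg_le w d f \<Longrightarrow> d \<le> e \<Longrightarrow> deg_le w e f"
  by (force simp: deg_le_def)

lemma deg_le_ex: "\<exists>d. deg_le w d f"
proof
  show "deg_le w (\<Sum>m\<in>Poly_Mapping.keys f. wdeg w m) f"
    unfolding deg_le_def by (intro ballI member_le_sum) auto
qed

lemma deg_le_var0: "deg_le w d f \<Longrightarrow> deg_le w d (var0 k f)"
  by (auto simp: deg_le_def in_keys_iff lookup_var0 split: if_splits)

lemma deg_le_weights:
  assumes "f \<in> vpoly A" "deg_le w' d f" "\<And>i. i \<in> A \<Longrightarrow> w i = p * w' i"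
  shows "deg_le w (p * d) f"
  unfolding deg_le_def
proof
  fix m assume m: "m \<in> Poly_Mapping.keys f"
  then have "Poly_Mapping.keys m \<subseteq> A" using assms(1) by (auto simp: vpoly_def)
  then have "wdeg w m = p * wdeg w' m"
    unfolding wdeg_def sum_distrib_left by (intro sum.cong) (auto simp: assms(3))
  then show "wdeg w m \<le> p * d" using assms(2) m by (simp add: deg_le_def)
qed

lemma deg_le_msubst:
  assumes "f \<in> vpoly A" "deg_le w N f" "\<And>i. i \<in> A \<Longrightarrow> homog w' (w i) (G i)"
  shows "deg_le w' N (msubst G f)"
  unfolding msubst_def
proof (rule deg_le_sum)
  fix m assume m: "m \<in> Poly_Mapping.keys f"
  have "homog w' (0 + (\<Sum>i\<in>Poly_Mapping.keys m. Poly_Mapping.lookup m i * w i))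
     (mconst (Poly_Mapping.lookup f m) * (\<Prod>i\<in>Poly_Mapping.keys m. G i ^ Poly_Mapping.lookup m i))"
    by (intro homog_mult homog_mconst homog_prod homog_power assms(3))
      (use assms(1) m in \<open>auto simp: vpoly_def\<close>)
  moreover have "(\<Sum>i\<in>Poly_Mapping.keys m. Poly_Mapping.lookup m i * w i) \<le> N"
    using assms(2) m by (auto simp: deg_le_def wdeg_def mult.commute)
  ultimately show "deg_le w' N
     (mconst (Poly_Mapping.lookup f m) * (\<Prod>i\<in>Poly_Mapping.keys m. G i ^ Poly_Mapping.lookup m i))"
    using homog_imp_deg_le by fastforce
qed

definition homog_part :: "(nat \<Rightarrow> nat) \<Rightarrow> nat \<Rightarrow> 'a::comm_ring_1 mpoly \<Rightarrow> 'a mpoly" where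
  "homog_part w d f = (\<Sum>m\<in>{m\<in>Poly_Mapping.keys f. wdeg w m = d}. Poly_Mapping.single m (Poly_Mapping.lookup f m))"

lemma lookup_homog_part:
  "Poly_Mapping.lookup (homog_part w d f) m = (if wdeg w m = d then Poly_Mapping.lookup f m else 0)"
  unfolding homog_part_def by (subst lookup_sum_single) (auto simp: in_keys_iff)

lemma homog_homog_part: "homog w d (homog_part w d f)"
  by (auto simp: homog_def in_keys_iff lookup_homog_part split: if_splits)

lemma homog_part_sum:
  assumes "finite A" "wdeg w ` Poly_Mapping.keys f \<subseteq> A"
  shows "f = (\<Sum>d\<in>A. homog_part w d f)"
proof (rule poly_mapping_eqI)
  fix m
  show "Poly_Mapping.lookup f m = Poly_Mapping.lookup (\<Sum>d\<in>A. homog_part w d f) m"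
    using assms by (auto simp: lookup_sum lookup_homog_part sum.delta in_keys_iff image_subset_iff)
qed

text \<open>Let \<open>e\<close> be the degree of the monomial \<open>m\<close>. The component of
  \<open>q\<close> of degree \<open>e\<close> times the homogeneous \<open>G\<close> is nonzero, and
  no other component of \<open>q\<close> contributes to degree \<open>d + e\<close> of the
  product.\<close>

lemma deg_le_quotient:
  fixes G q :: "'a::idom mpoly"
  assumes "homog w d G" "G \<noteq> 0" "deg_le w N (G * q)" "m \<in> Poly_Mapping.keys q"
  shows "d + wdeg w m \<le> N"
proof -
  define e where "e = wdeg w m"
  define A where "A = wdeg w ` Poly_Mapping.keys q"
  have "Poly_Mapping.lookup (homog_part w e q) m \<noteq> 0"
    using assms(4) by (simp add: lookup_homog_part e_def in_keys_iff)
  then have "G * homog_part w e q \<noteq> 0" using assms(2) by auto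
  then obtain m' where m': "Poly_Mapping.lookup (G * homog_part w e q) m' \<noteq> 0"
    by (metis lookup_zero poly_mapping_eqI)
  have h: "homog w (d + e') (G * homog_part w e' q)" for e'
    by (rule homog_mult[OF assms(1) homog_homog_part])
  have deg: "wdeg w m' = d + e" using h[of e] m' by (simp add: homog_def in_keys_iff)
  have zero: "Poly_Mapping.lookup (G * homog_part w e' q) m' = 0" if "e' \<noteq> e" for e'
    using h[of e'] deg that by (metis add_left_cancel homog_def in_keys_iff)
  have "G * q = (\<Sum>e'\<in>A. G * homog_part w e' q)"
    using homog_part_sum[of A w q] unfolding A_def by (simp add: sum_distrib_left[symmetric])
  then have "Poly_Mapping.lookup (G * q) m' = (\<Sum>e'\<in>A. Poly_Mapping.lookup (G * homog_part w e' q) m')"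
    by (simp add: lookup_sum)
  also have "\<dots> = (\<Sum>e'\<in>{e}. Poly_Mapping.lookup (G * homog_part w e' q) m')"
    by (rule sum.mono_neutral_right) (use zero assms(4) in \<open>auto simp: A_def e_def\<close>)
  finally have "m' \<in> Poly_Mapping.keys (G * q)" using m' by (simp add: in_keys_iff)
  then show ?thesis using assms(3) deg by (auto simp: deg_le_def e_def)
qed

text \<open>Elements of the prime field are their own p-th powers, so dividing all exponents by
  \<open>p\<close> gives a p-th root. The bound \<open>N div p\<close> is what makes the weights
  match when the root is rewritten in generators.\<close>

lemma frob_root_deg:
  fixes f :: "'p::prime_card mod_ring mpoly"
  assumes "f \<in> vpoly A" "\<And>m i. m \<in> Poly_Mapping.keys f \<Longrightarrow> i \<in> A \<Longrightarrow> CARD('p) dvd Poly_Mapping.lookup m i"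
    and "deg_le (\<lambda>_. 1) N f"
  shows "\<exists>h\<in>vpoly A. f = h ^ CARD('p) \<and> deg_le (\<lambda>_. 1) (N div CARD('p)) h"
proof -
  define h where "h = (\<Sum>m\<in>Poly_Mapping.keys f. mconst (Poly_Mapping.lookup f m) *
    (\<Prod>i\<in>Poly_Mapping.keys m. ygen i ^ (Poly_Mapping.lookup m i div CARD('p))))"
  have A: "i \<in> A" if "m \<in> Poly_Mapping.keys f" "i \<in> Poly_Mapping.keys m" for m i
    using assms(1) that by (auto simp: vpoly_def)
  have h: "h \<in> vpoly A"
    unfolding h_def by (intro vpoly_sum vpoly_mult vpoly_mconst vpoly_prod vpoly_power vpoly_ygen A)
  have "h ^ CARD('p) = (\<Sum>m\<in>Poly_Mapping.keys f. mconst (Poly_Mapping.lookup f m) *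
    (\<Prod>i\<in>Poly_Mapping.keys m. ygen i ^ Poly_Mapping.lookup m i))"
    unfolding h_def frob_sum[where k = 1 and 'p = 'p, unfolded power_one_right] power_mult_distrib
      mconst_power_CARD_power[where k = 1 and 'p = 'p, unfolded power_one_right] prod_power_distrib
      power_mult[symmetric]
    by (intro sum.cong prod.cong arg_cong2[of _ _ _ _ "(*)"] refl) (simp add: assms(2) A)
  also have "\<dots> = f" using msubst_ygen_id[of f] by (simp add: msubst_def)
  finally have f: "f = h ^ CARD('p)" ..
  have "deg_le (\<lambda>_. 1) (N div CARD('p)) h"
    unfolding h_def
  proof (rule deg_le_sum)
    fix m assume m: "m \<in> Poly_Mapping.keys f"
    let ?d = "\<Sum>i\<in>Poly_Mapping.keys m. Poly_Mapping.lookup m i div CARD('p)"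
    have "homog (\<lambda>_. 1) (0 + (\<Sum>i\<in>Poly_Mapping.keys m. (Poly_Mapping.lookup m i div CARD('p)) * 1))
      (mconst (Poly_Mapping.lookup f m) *
        (\<Prod>i\<in>Poly_Mapping.keys m. ygen i ^ (Poly_Mapping.lookup m i div CARD('p))))"
      by (intro homog_mult homog_mconst homog_prod homog_power homog_ygen)
    moreover have "?d * CARD('p) = wdeg (\<lambda>_. 1) m"
      unfolding wdeg_def sum_distrib_right
      by (rule sum.cong) (use assms(2) m A in auto)
    then have "?d \<le> N div CARD('p)"
      using assms(3) m zero_less_card_finite[where 'a = 'p] by (simp add: deg_le_def less_eq_div_iff_mult_less_eq)
    ultimately show "deg_le (\<lambda>_. 1) (N div CARD('p)) (mconst (Poly_Mapping.lookup f m) *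
        (\<Prod>i\<in>Poly_Mapping.keys m. ygen i ^ (Poly_Mapping.lookup m i div CARD('p))))"
      using homog_imp_deg_le by fastforce
  qed
  with h f show ?thesis by blast
qed

lemma msubst_frob:
  fixes g :: "'p::prime_card mod_ring mpoly"
  shows "msubst (\<lambda>i. G i ^ CARD('p)) g = msubst G g ^ CARD('p)"
  unfolding msubst_def frob_sum[where k = 1 and 'p = 'p, unfolded power_one_right] power_mult_distrib
    mconst_power_CARD_power[where k = 1 and 'p = 'p, unfolded power_one_right] prod_power_distrib
    power_mult[symmetric]
  by (simp add: mult.commute)

subsection \<open>Generators and independence by setting a variable to zero\<close>

text \<open>
  Restricting to \<open>y_k = 0\<close> turns an invariant \<open>f\<close> into a \<open>p\<close>-th power of an invariant in the
  remaining variables.  Subtracting the corresponding polynomial in the generators leaves a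
  multiple of \<open>G k\<close>, and the degree drops.
\<close>

lemma invariants_generated_step:
  fixes G G' :: "nat \<Rightarrow> 'p::prime_card mod_ring mpoly"
  assumes k: "k < n"
    and diff: "\<And>f g. f \<in> Inv \<Longrightarrow> g \<in> Inv \<Longrightarrow> f - g \<in> Inv"
    and gens: "\<And>g. g \<in> vpoly {k..<n} \<Longrightarrow> msubst G g \<in> Inv"
    and dvd: "\<And>f. f \<in> Inv \<Longrightarrow> var0 k f = 0 \<Longrightarrow> \<exists>q\<in>Inv. f = G k * q"
    and root: "\<And>f N. f \<in> Inv \<Longrightarrow> deg_le (\<lambda>_. 1) N f \<Longrightarrow>
      \<exists>h\<in>Inv'. var0 k f = h ^ CARD('p) \<and> deg_le (\<lambda>_. 1) (N div CARD('p)) h"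
    and IH: "\<And>h N. h \<in> Inv' \<Longrightarrow> deg_le (\<lambda>_. 1) N h \<Longrightarrow>
      \<exists>g\<in>vpoly {Suc k..<n}. deg_le w' N g \<and> h = msubst G' g"
    and restr: "\<And>v. v \<in> {Suc k..<n} \<Longrightarrow> var0 k (G v) = G' v ^ CARD('p)"
    and w: "\<And>v. v \<in> {Suc k..<n} \<Longrightarrow> w v = CARD('p) * w' v"
    and homog: "\<And>v. v \<in> {k..<n} \<Longrightarrow> homog (\<lambda>_. 1) (w v) (G v)" and "G k \<noteq> 0" "0 < w k"
    and "f \<in> Inv" "deg_le (\<lambda>_. 1) N f"
  shows "\<exists>g\<in>vpoly {k..<n}. deg_le w N g \<and> f = msubst G g"
  using assms(12,13)
proof (induction N arbitrary: f rule: less_induct)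
  case (less N)
  obtain h where h: "h \<in> Inv'" "var0 k f = h ^ CARD('p)" "deg_le (\<lambda>_. 1) (N div CARD('p)) h"
    using root[OF less.prems] by blast
  obtain g0 where g0: "g0 \<in> vpoly {Suc k..<n}" "deg_le w' (N div CARD('p)) g0" "h = msubst G' g0"
    using IH[OF h(1,3)] by blast
  \<comment> \<open>On the remaining variables \<open>w\<close> is \<open>p\<close> times
    \<open>w'\<close>, and \<open>p * (N div p) \<le> N\<close>: taking the root and lifting back
    does not increase the bound.\<close>
  have "deg_le w (CARD('p) * (N div CARD('p))) g0"
    by (rule deg_le_weights[OF g0(1,2)]) (use w in auto)
  then have g0N: "deg_le w N g0" by (rule deg_le_mono) simp
  have g0k: "g0 \<in> vpoly {k..<n}" using g0(1) vpoly_mono[of "{Suc k..<n}" "{k..<n}"] by fastforce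
  have "var0 k (msubst G g0) = msubst (\<lambda>i. G' i ^ CARD('p)) g0"
    unfolding var0_def msubst_msubst
    by (rule msubst_cong[OF g0(1)]) (use restr in \<open>simp add: var0_def\<close>)
  then have "var0 k (f - msubst G g0) = 0"
    using h(2) g0(3) by (simp add: msubst_frob var0_def msubst_diff)
  moreover have "f - msubst G g0 \<in> Inv" using diff less.prems(1) gens[OF g0k] by blast
  ultimately obtain q where q: "q \<in> Inv" "f - msubst G g0 = G k * q" using dvd by blast
  \<comment> \<open>Here the weighted bound on \<open>g0\<close> pays off: the difference has degree
    at most \<open>N\<close>, so dividing by \<open>G k\<close> strictly lowers the bound and the
    induction applies to \<open>q\<close>.\<close>
  have degGq: "deg_le (\<lambda>_. 1) N (G k * q)"
    unfolding q(2)[symmetric]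
    by (intro deg_le_diff less.prems deg_le_msubst[OF g0k g0N] homog)
  have hk: "homog (\<lambda>_. 1) (w k) (G k)" using homog k by simp
  note quot = deg_le_quotient[OF hk \<open>G k \<noteq> 0\<close> degGq]
  show ?case
  proof (cases "q = 0")
    case True
    then show ?thesis using q g0k g0N by auto
  next
    case False
    then have "w k \<le> N" using quot by (metis add_leD1 in_keys_iff lookup_zero poly_mapping_eqI)
    then have "N - w k < N" using \<open>0 < w k\<close> by simp
    moreover have "deg_le (\<lambda>_. 1) (N - w k) q"
      unfolding deg_le_def using quot by fastforce
    ultimately obtain g1 where g1: "g1 \<in> vpoly {k..<n}" "deg_le w (N - w k) g1" "q = msubst G g1"
      using less.IH q(1) by blast
    have "deg_le w (w k + (N - w k)) (ygen k * g1)"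
      by (intro deg_le_mult homog_imp_deg_le[OF homog_ygen] g1) simp
    then have "deg_le w N (ygen k * g1)" using \<open>w k \<le> N\<close> by simp
    then show ?thesis
      using g1 g0k g0N q k by (intro bexI[of _ "g0 + ygen k * g1"])
        (auto simp: msubst_hom algebra_simps intro!: deg_le_add vpoly_closed vpoly_ygen)
  qed
qed

text \<open>Restricting a relation to \<open>y_k = 0\<close> kills \<open>G k\<close> and makes the
  other generators p-th powers of the \<open>G' v\<close>. So the part of \<open>g\<close> without
  the variable \<open>k\<close> is a relation among the \<open>G' v\<close> and vanishes; then
  \<open>g\<close> is divisible by its own variable \<open>k\<close>, and the quotient is a relation
  of smaller degree. \<open>var0 k\<close> is thus applied both to the values and to the relation
  itself.\<close>

lemma generators_independent_step:
  fixes G G' :: "nat \<Rightarrow> 'p::prime_card mod_ring mpoly"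
  assumes k: "k < n"
    and IH: "\<And>g. g \<in> vpoly {Suc k..<n} \<Longrightarrow> msubst G' g = 0 \<Longrightarrow> g = 0"
    and restr: "\<And>v. v \<in> {Suc k..<n} \<Longrightarrow> var0 k (G v) = G' v ^ CARD('p)"
    and "var0 k (G k) = 0" "G k \<noteq> 0"
    and "g \<in> vpoly {k..<n}" "msubst G g = 0"
  shows "g = 0"
proof -
  have "deg_le (\<lambda>_. 1) N g \<Longrightarrow> g = 0" for N
    using assms(6,7)
  proof (induction N arbitrary: g rule: less_induct)
    case (less N)
    have v0: "var0 k g \<in> vpoly {Suc k..<n}"
      using var0_vpoly[OF less.prems(2), of k] vpoly_mono[of "{k..<n} - {k}" "{Suc k..<n}"] by fastforce
    have "msubst G' (var0 k g) ^ CARD('p) = msubst (\<lambda>i. G' i ^ CARD('p)) (var0 k g)"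
      by (simp add: msubst_frob)
    also have "\<dots> = msubst (\<lambda>i. var0 k (G i)) (var0 k g)"
      by (rule msubst_cong[OF v0]) (simp add: restr)
    also have "\<dots> = var0 k (msubst G g)"
      unfolding var0_def msubst_msubst
      by (rule msubst_cong[OF less.prems(2)]) (use assms(4) in \<open>auto simp: var0_def\<close>)
    finally have "msubst G' (var0 k g) = 0"
      using less.prems(3) by (simp add: var0_def)
    then have "var0 k g = 0" using IH v0 by blast
    then obtain g1 where g1: "g = ygen k * g1" using ygen_dvd_iff_var0 by blast
    have "g1 \<in> vpoly {k..<n}"
      by (rule vpoly_quotient[of "ygen k"]) (use g1 less.prems k in \<open>auto intro: vpoly_ygen\<close>)
    moreover have "msubst G g1 = 0" using less.prems(3) g1 assms(5) by (simp add: msubst_mult)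
    moreover have quot: "1 + wdeg (\<lambda>_. 1) m \<le> N" if "m \<in> Poly_Mapping.keys g1" for m
      using deg_le_quotient[OF homog_ygen[of "\<lambda>_. 1" k] ygen_nonzero _ that] less.prems(1) g1 by simp
    then have "deg_le (\<lambda>_. 1) (N - 1) g1" unfolding deg_le_def by fastforce
    \<comment> \<open>A nonzero quotient forces \<open>N\<close> to be positive; for
      \<open>N = 0\<close> the truncated subtraction would not decrease.\<close>
    moreover have "N - 1 < N" if "g1 \<noteq> 0"
      using quot that by (metis One_nat_def Suc_le_D add_leD1 diff_Suc_1 in_keys_iff lessI lookup_zero poly_mapping_eqI)
    ultimately have "g1 = 0" using less.IH by blast
    then show ?case using g1 by simp
  qed
  then show ?thesis using deg_le_ex by blast
qed

section \<open>Polynomial invariants of the linear and the parabolic group\<close>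

subsection \<open>Invariants of scalings and shears\<close>

text \<open>The variables \<open>y_i\<close> that may be sheared start at \<open>a\<close>, those
  that may be added start at \<open>k\<close>. The full linear group on \<open>{k..<n}\<close>
  corresponds to \<open>a = k\<close>, the parabolic group to \<open>a = 1\<close> and
  \<open>k = 0\<close>, where \<open>y_0\<close> may be added to others but is only scaled
  itself.\<close>

definition elem_inv :: "nat \<Rightarrow> nat \<Rightarrow> nat \<Rightarrow> 'a::comm_ring_1 mpoly set" where
  "elem_inv a k n = {f \<in> vpoly {k..<n}.
     (\<forall>i\<in>{k..<n}. \<forall>\<mu>. \<mu> \<noteq> 0 \<longrightarrow> scale_var i \<mu> f = f) \<and>
     (\<forall>i\<in>{a..<n}. \<forall>j\<in>{k..<n}. i \<noteq> j \<longrightarrow> (\<forall>c. shear_var i j c f = f))}"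

lemma elem_inv_diff: "f \<in> elem_inv a k n \<Longrightarrow> g \<in> elem_inv a k n \<Longrightarrow> f - g \<in> elem_inv a k n"
  by (auto simp: elem_inv_def scale_var_def shear_var_def msubst_diff intro!: vpoly_diff)

lemma elem_inv_msubst:
  assumes "g \<in> vpoly A" "\<And>v. v \<in> A \<Longrightarrow> G v \<in> elem_inv a k n"
  shows "msubst G g \<in> elem_inv a k n"
proof -
  have inv: "msubst s (msubst G g) = msubst G g" if "\<And>v. v \<in> A \<Longrightarrow> msubst s (G v) = G v" for s
    unfolding msubst_msubst by (rule msubst_cong[OF assms(1)]) (rule that)
  show ?thesis
    using assms(2) unfolding elem_inv_def scale_var_def shear_var_def
    by (auto intro!: inv msubst_vpoly[OF assms(1)])
qed

lemma elem_inv_quotient: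
  fixes G q :: "'a::idom mpoly"
  assumes "G * q \<in> elem_inv a k n" "G \<in> elem_inv a k n" "G \<noteq> 0"
  shows "q \<in> elem_inv a k n"
proof -
  have inv: "msubst s q = q" if "msubst s (G * q) = G * q" "msubst s G = G" for s
    using that assms(3) by (simp add: msubst_mult)
  have "q \<in> vpoly {k..<n}" using assms by (intro vpoly_quotient[of G q]) (auto simp: elem_inv_def)
  then show ?thesis
    using assms(1,2) unfolding elem_inv_def scale_var_def shear_var_def by (auto intro!: inv)
qed

text \<open>The condition \<open>a \<le> Suc k\<close> makes available the shears of all later
  variables by \<open>y_k\<close>; they force the exponents of the monomials without
  \<open>y_k\<close> to be multiples of \<open>p\<close>. The root is invariant under all scalings
  and shears of the later variables, so the parabolic case turns into the full linear one after one
  restriction.\<close>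

lemma elem_inv_var0_root:
  fixes f :: "'p::prime_card mod_ring mpoly"
  assumes f: "f \<in> elem_inv a k n" and k: "k < n" "a \<le> Suc k" and deg: "deg_le (\<lambda>_. 1) N f"
  shows "\<exists>h\<in>elem_inv (Suc k) (Suc k) n. var0 k f = h ^ CARD('p) \<and> deg_le (\<lambda>_. 1) (N div CARD('p)) h"
proof -
  have v: "var0 k f \<in> vpoly {Suc k..<n}"
    using f var0_vpoly[of f "{k..<n}" k] vpoly_mono[of "{k..<n} - {k}" "{Suc k..<n}"]
    by (fastforce simp: elem_inv_def)
  have "CARD('p) dvd Poly_Mapping.lookup m i"
    if "m \<in> Poly_Mapping.keys (var0 k f)" "i \<in> {Suc k..<n}" for m i
  proof (rule shear_var_keys[of i k f m])
    show "shear_var i k 1 f = f" "i \<noteq> k" using f k that by (auto simp: elem_inv_def)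
    show "m \<in> Poly_Mapping.keys f" "Poly_Mapping.lookup m k = 0"
      using that(1) by (auto simp: in_keys_iff lookup_var0 split: if_splits)
  qed
  then obtain h where h: "h \<in> vpoly {Suc k..<n}" "var0 k f = h ^ CARD('p)"
      "deg_le (\<lambda>_. 1) (N div CARD('p)) h"
    using frob_root_deg[OF v _ deg_le_var0[OF deg]] by blast
  \<comment> \<open>A substitution that commutes with \<open>y_k := 0\<close> fixes the p-th power
    of \<open>h\<close>, hence \<open>h\<close>, since Frobenius is injective.\<close>
  have inv: "msubst s h = h" if "msubst s f = f" "\<And>l. msubst s ((ygen(k := 0)) l) = var0 k (s l)" for s
  proof (rule frob_inj)
    have "msubst s (var0 k f) = var0 k (msubst s f)"
      unfolding var0_def msubst_msubst that(2) by (simp add: var0_def)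
    then show "msubst s h ^ CARD('p) = h ^ CARD('p)"
      using that(1) h(2) by (simp flip: msubst_power)
  qed
  have "h \<in> elem_inv (Suc k) (Suc k) n"
    using h(1) f k unfolding elem_inv_def scale_var_def shear_var_def
    by (auto intro!: inv simp: var0_def msubst_hom)
  with h show ?thesis by blast
qed

lemma elem_inv_var0_dvd:
  fixes f :: "'p::prime_card mod_ring mpoly"
  assumes "f \<in> elem_inv a k n" "k < n" "var0 k f = 0"
  shows "ygen k ^ (CARD('p) - 1) dvd f"
  by (rule ygen_power_dvd_of_scale_var) (use assms in \<open>auto simp: elem_inv_def ygen_dvd_iff_var0\<close>)

subsection \<open>Dickson's theorem\<close>

text \<open>The zeros below \<open>k\<close> trigger the index shift in
  \<open>dickson_coeff\<close>. As a result \<open>flag_dickson k n v\<close>, for \<open>v\<close>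
  in \<open>{k..<n}\<close>, is the Dickson invariant of \<open>y_k, ..., y_{n-1}\<close> of degree
  \<open>p^(n-k) - p^(v-k)\<close>.\<close>

definition flag_h :: "nat \<Rightarrow> nat \<Rightarrow> 'p::prime_card mod_ring mpoly" where
  "flag_h k j = (if j < k then 0 else span_prod ygen {k..<j} (ygen j))"

definition flag_dickson :: "nat \<Rightarrow> nat \<Rightarrow> nat \<Rightarrow> 'p::prime_card mod_ring mpoly" where
  "flag_dickson k n = dickson_coeff (flag_h k) n"

lemma lspan_vpoly: "(\<And>i. i \<in> A \<Longrightarrow> z i \<in> vpoly B) \<Longrightarrow> v \<in> lspan z A \<Longrightarrow> v \<in> vpoly B"
  by (auto simp: lspan_def intro!: vpoly_closed)

lemma lspan_add: "v \<in> lspan z A \<Longrightarrow> w \<in> lspan z A \<Longrightarrow> v + w \<in> lspan z A"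
proof -
  assume "v \<in> lspan z A" "w \<in> lspan z A"
  then obtain c d where "v = (\<Sum>i\<in>A. mconst (c i) * z i)" "w = (\<Sum>i\<in>A. mconst (d i) * z i)"
    by (auto simp: lspan_def)
  then have "v + w = (\<Sum>i\<in>A. mconst (c i + d i) * z i)"
    by (simp add: mconst_add distrib_right sum.distrib)
  then show ?thesis by (auto simp: lspan_def)
qed

lemma lspan_scale: "v \<in> lspan z A \<Longrightarrow> mconst b * v \<in> lspan z A"
proof -
  assume "v \<in> lspan z A"
  then obtain c where "v = (\<Sum>i\<in>A. mconst (c i) * z i)" by (auto simp: lspan_def)
  then have "mconst b * v = (\<Sum>i\<in>A. mconst (b * c i) * z i)"
    by (simp add: mconst_mult sum_distrib_left mult.assoc)
  then show ?thesis by (auto simp: lspan_def)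
qed

lemma lspan_sum: "(\<And>i. i \<in> I \<Longrightarrow> f i \<in> lspan z A) \<Longrightarrow> sum f I \<in> lspan z A"
  by (induction I rule: infinite_finite_induct) (simp_all add: lspan_add zero_in_lspan)

lemma lspan_base:
  assumes "finite A" "i \<in> A" shows "z i \<in> lspan z A"
proof -
  have "(\<Sum>j\<in>A. mconst (if j = i then 1 else 0) * z j) = (\<Sum>j\<in>A. if j = i then z j else 0)"
    by (rule sum.cong) auto
  also have "\<dots> = z i" using assms by simp
  finally have *: "z i = (\<Sum>j\<in>A. mconst (if j = i then 1 else 0) * z j)" ..
  show ?thesis unfolding lspan_def
    by (rule image_eqI[of _ _ "\<lambda>j. if j = i then 1 else 0"], rule *, rule UNIV_I)
qed

lemma flag_h_vpoly:
  assumes "j < n" shows "flag_h k j \<in> vpoly {k..<n}"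
proof (cases "j < k")
  case False
  have "ygen j - v \<in> vpoly {k..<n}" if "v \<in> lspan ygen {k..<j}" for v :: "'a mod_ring mpoly"
    using that assms False
    by (intro vpoly_diff vpoly_ygen lspan_vpoly[OF _ that]) auto
  then show ?thesis using False by (simp add: flag_h_def span_prod_def vpoly_prod)
qed (simp add: flag_h_def)

lemma flag_h_nonzero:
  assumes "k \<le> j" shows "flag_h k j \<noteq> (0 :: 'p::prime_card mod_ring mpoly)"
proof -
  have "ygen j - v \<noteq> 0" if "v \<in> lspan ygen {k..<j}" for v :: "'p mod_ring mpoly"
    using lin_form_nonzero[of v "{k..<j}" j] lspan_ygen_vpoly[of "{k..<j}"] that by auto
  then show ?thesis using assms by (auto simp: flag_h_def span_prod_def finite_lspan)
qed

text \<open>For \<open>j > k\<close> the forms \<open>y_j - v - c y_k\<close> with \<open>c\<close>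
  in the prime field become equal at \<open>y_k = 0\<close>, so every factor of the smaller product
  occurs \<open>p\<close> times. For \<open>j \<le> k\<close> both sides are zero.\<close>

lemma var0_flag_h: "var0 k (flag_h k j) = (flag_h (Suc k) j ^ CARD('p) :: 'p::prime_card mod_ring mpoly)"
proof (cases "j \<le> k")
  case True
  then show ?thesis by (auto simp: flag_h_def var0_def power_0_left)
next
  case False
  then have ins: "{k..<j} = insert k {Suc k..<j}" by auto
  have "span_prod ygen {k..<j} (ygen j) = (\<Prod>c\<in>(UNIV :: 'p mod_ring set). span_prod ygen {Suc k..<j} (ygen j - mconst c * ygen k))"
    unfolding ins by (rule span_prod_insert) (auto intro: lin_indep_ygen)
  then have "var0 k (flag_h k j) = (\<Prod>c\<in>(UNIV :: 'p mod_ring set). var0 k (span_prod ygen {Suc k..<j} (ygen j - mconst c * ygen k)))"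
    using False by (simp add: flag_h_def var0_def msubst_prod)
  also have "\<dots> = (\<Prod>c\<in>(UNIV :: 'p mod_ring set). span_prod ygen {Suc k..<j} (ygen j))"
    unfolding var0_def
    by (rule prod.cong[OF refl], subst span_prod_msubst_fixed) (use False in \<open>auto simp: msubst_hom\<close>)
  finally show ?thesis using False by (simp add: flag_h_def)
qed

lemma var0_flag_dickson:
  "var0 k (flag_dickson k n v) = (flag_dickson (Suc k) n v ^ CARD('p) :: 'p::prime_card mod_ring mpoly)"
  unfolding flag_dickson_def var0_def dickson_coeff_msubst dickson_coeff_frob[symmetric]
  by (simp add: var0_flag_h[unfolded var0_def])

lemma flag_dickson_bottom:
  "k \<le> n \<Longrightarrow> flag_dickson k n k = ((\<Prod>j\<in>{k..<n}. flag_h k j) ^ (CARD('p) - 1) :: 'p::prime_card mod_ring mpoly)"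
  unfolding flag_dickson_def
  by (subst dickson_coeff_bottom) (auto simp: flag_h_def prod_power_distrib)

lemma homog_span_prod_ygen:
  fixes X :: "'p::prime_card mod_ring mpoly"
  assumes "homog (\<lambda>_. 1) 1 X"
  shows "homog (\<lambda>_. 1) (CARD('p) ^ d) (span_prod ygen {k..<k + d} X)"
  using assms
proof (induction d arbitrary: X)
  case (Suc d)
  have ins: "{k..<k + Suc d} = insert (k + d) {k..<k + d}" by auto
  have "homog (\<lambda>_. 1) 1 (X - mconst c * ygen (k + d))" for c
    using homog_mult[OF homog_mconst homog_ygen, of "\<lambda>_. 1"] by (intro homog_diff Suc.prems) simp
  then have "homog (\<lambda>_. 1) (\<Sum>c\<in>(UNIV :: 'p mod_ring set). CARD('p) ^ d)
      (\<Prod>c\<in>UNIV. span_prod ygen {k..<k + d} (X - mconst c * ygen (k + d)))"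
    by (intro homog_prod Suc.IH)
  then show ?case
    unfolding ins by (subst span_prod_insert) (auto intro: lin_indep_ygen)
qed simp

lemma homog_flag_h: "k \<le> j \<Longrightarrow> homog (\<lambda>_. 1) (CARD('p) ^ (j - k)) (flag_h k j :: 'p::prime_card mod_ring mpoly)"
  unfolding flag_h_def using homog_span_prod_ygen[OF homog_ygen, of "j - k" k] by simp

text \<open>The scale \<open>r\<close> is 1 for the Dickson invariants themselves and
  \<open>p\<close> for \<open>dickson_I\<close>, whose flag starts at index 1 while
  \<open>mui_h i\<close> has degree \<open>p * p^(i-1)\<close>.\<close>

lemma homog_dickson_coeff:
  fixes h :: "nat \<Rightarrow> 'p::prime_card mod_ring mpoly"
  assumes "\<And>i. i < k \<Longrightarrow> h i = 0" "\<And>i. k \<le> i \<Longrightarrow> i < j \<Longrightarrow> homog w (r * CARD('p) ^ (i - k)) (h i)"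
    and "k \<le> m" "m \<le> j"
  shows "homog w (r * (CARD('p) ^ (j - k) - CARD('p) ^ (m - k))) (dickson_coeff h j m)"
proof -
  have "k \<le> j" using assms by simp
  then show ?thesis using assms(2-4)
  proof (induction arbitrary: m rule: dec_induct)
    case base
    then show ?case by (simp add: le_antisym)
  next
    case (step j)
    let ?p = "CARD('p)"
    show ?case
    proof (cases "m = Suc j")
      case True
      then show ?thesis by (simp del: dickson_coeff.simps)
    next
      case False
      then have mj: "m \<le> j" using step by simp
      have e: "r * (?p ^ (Suc j - k) - ?p ^ (m - k)) =
          (?p - 1) * (r * ?p ^ (j - k)) + r * (?p ^ (j - k) - ?p ^ (m - k))"
      proof -
        have "?p ^ (m - k) \<le> ?p ^ (j - k)" using mj by (intro power_increasing) (simp_all add: Suc_leI)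
        moreover have "?p * x = (?p - 1) * x + x" for x
          by (cases ?p) simp_all
        ultimately show ?thesis using step
          by (simp add: Suc_diff_le algebra_simps flip: distrib_left)
            (simp add: diff_mult_distrib2 algebra_simps)
      qed
      have 1: "homog w (r * (?p ^ (Suc j - k) - ?p ^ (m - k)))
          (h j ^ (?p - 1) * dickson_coeff h j m)"
        unfolding e using step mj by (intro homog_mult homog_power step.IH) auto
      have 2: "homog w (r * (?p ^ (Suc j - k) - ?p ^ (m - k)))
          (if m = 0 then 0 else dickson_coeff h j (m - 1) ^ ?p)"
      proof (cases "m = k")
        case True
        then have "(if m = 0 then 0 else dickson_coeff h j (m - 1) ^ ?p) = 0"
          using dickson_coeff_lt[of k h "k - 1" j] assms(1) step by (auto simp: power_0_left)
        then show ?thesis by simp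
      next
        case False
        then have m: "k \<le> m - 1" "m - 1 \<le> j" "m \<noteq> 0" "Suc (m - 1 - k) = m - k" using step mj by auto
        have "?p * (r * (?p ^ (j - k) - ?p ^ (m - 1 - k))) = r * (?p * ?p ^ (j - k) - ?p * ?p ^ (m - 1 - k))"
          by (simp add: diff_mult_distrib2 mult_ac)
        also have "\<dots> = r * (?p ^ (Suc j - k) - ?p ^ (m - k))"
          using m step by (simp add: Suc_diff_le flip: power_Suc)
        finally have "?p * (r * (?p ^ (j - k) - ?p ^ (m - 1 - k))) = r * (?p ^ (Suc j - k) - ?p ^ (m - k))" .
        moreover have "homog w (?p * (r * (?p ^ (j - k) - ?p ^ (m - 1 - k)))) (dickson_coeff h j (m - 1) ^ ?p)"
          using step m by (intro homog_power step.IH) auto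
        ultimately have "homog w (r * (?p ^ (Suc j - k) - ?p ^ (m - k))) (dickson_coeff h j (m - 1) ^ ?p)"
          by (simp only:)
        then show ?thesis using m(3) by (simp only: if_False)
      qed
      show ?thesis using homog_add[OF 2 1] by simp
    qed
  qed
qed

lemma linear_subst_lspan:
  assumes "\<And>i. i \<in> A \<Longrightarrow> msubst s (z i) \<in> lspan z A"
  shows "msubst s ` lspan z A \<subseteq> lspan z A"
proof
  fix x assume "x \<in> msubst s ` lspan z A"
  then obtain c where "x = (\<Sum>i\<in>A. mconst (c i) * msubst s (z i))" by (auto simp: lspan_def msubst_hom)
  then show "x \<in> lspan z A" using assms by (auto intro!: lspan_sum lspan_scale)
qed

lemma flag_dickson_elem_inv:
  fixes k n :: nat
  assumes "k \<le> v" "v < n"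
  shows "(flag_dickson k n v :: 'p::prime_card mod_ring mpoly) \<in> elem_inv k k n"
proof -
  have inv: "msubst s (flag_dickson k n v) = flag_dickson k n v"
    if s: "\<And>i. i \<in> {k..<n} \<Longrightarrow> s i \<in> lspan ygen {k..<n}"
      and t: "\<And>f. msubst t (msubst s f) = f" "\<And>f. msubst s (msubst t f) = f"
    for s t :: "nat \<Rightarrow> 'p mod_ring mpoly"
    unfolding flag_dickson_def
  proof (rule dickson_coeff_invariant)
    show "inj_on (msubst s) (lspan ygen {k..<n})" using t(1) by (metis inj_on_inverseI)
    show "msubst s ` lspan ygen {k..<n} \<subseteq> lspan ygen {k..<n}"
      by (rule linear_subst_lspan) (simp add: s)
    have "range (msubst s) = UNIV" using t(2) by (metis surjI)
    then show "infinite (range (msubst s))" using infinite_UNIV_mpoly by simp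
  qed (use assms in \<open>auto simp: flag_h_def intro: lin_indep_ygen\<close>)
  have base: "ygen i \<in> lspan ygen {k..<n}" if "i \<in> {k..<n}" for i
    using that by (intro lspan_base) auto
  have "scale_var i \<mu> (flag_dickson k n v) = flag_dickson k n v" if "i \<in> {k..<n}" "\<mu> \<noteq> 0" for i and \<mu> :: "'p mod_ring"
    unfolding scale_var_def
  proof (rule inv[of _ "ygen(i := mconst (inverse \<mu>) * ygen i)"])
    fix f :: "'p mod_ring mpoly"
    have "mconst \<mu> * (mconst (inverse \<mu>) * ygen i) = ygen i" "mconst (inverse \<mu>) * (mconst \<mu> * ygen i) = ygen i"
      using that(2) by (simp_all flip: mconst_mult mult.assoc)
    then show "msubst (ygen(i := mconst (inverse \<mu>) * ygen i)) (msubst (ygen(i := mconst \<mu> * ygen i)) f) = f"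
      "msubst (ygen(i := mconst \<mu> * ygen i)) (msubst (ygen(i := mconst (inverse \<mu>) * ygen i)) f) = f"
      unfolding msubst_msubst by (auto intro!: vpoly_msubst_id[of _ UNIV] simp: msubst_hom vpoly_def)
  qed (use that base in \<open>auto intro: lspan_scale\<close>)
  moreover have "shear_var i j c (flag_dickson k n v) = flag_dickson k n v"
    if "i \<in> {k..<n}" "j \<in> {k..<n}" "i \<noteq> j" for i j and c :: "'p mod_ring"
    unfolding shear_var_def
  proof (rule inv[of _ "ygen(i := ygen i + mconst (- c) * ygen j)"])
    fix f :: "'p mod_ring mpoly"
    show "msubst (ygen(i := ygen i + mconst (- c) * ygen j)) (msubst (ygen(i := ygen i + mconst c * ygen j)) f) = f"
      "msubst (ygen(i := ygen i + mconst c * ygen j)) (msubst (ygen(i := ygen i + mconst (- c) * ygen j)) f) = f"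
      unfolding msubst_msubst using that(3)
      by (auto intro!: vpoly_msubst_id[of _ UNIV] simp: msubst_hom vpoly_def mconst_uminus)
  qed (use that base in \<open>auto intro: lspan_scale lspan_add\<close>)
  moreover have "flag_dickson k n v \<in> vpoly {k..<n}"
    unfolding flag_dickson_def by (rule dickson_coeff_vpoly) (rule flag_h_vpoly)
  ultimately show ?thesis by (simp add: elem_inv_def)
qed

text \<open>Descending induction on \<open>k\<close>; with no variables left only constants remain.
  The weight of the variable \<open>v\<close> is the degree of \<open>flag_dickson k n v\<close>,
  and the bound belongs to the statement because the next larger case consumes it.\<close>

lemma dickson_theorem:
  fixes f :: "'p::prime_card mod_ring mpoly"
  assumes "k \<le> n" "f \<in> elem_inv k k n" "deg_le (\<lambda>_. 1) N f"
  shows "\<exists>g\<in>vpoly {k..<n}. deg_le (\<lambda>v. CARD('p) ^ (n - k) - CARD('p) ^ (v - k)) N g \<and>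
    f = msubst (flag_dickson k n) g"
  using assms
proof (induction arbitrary: f N rule: inc_induct)
  case base
  then have "f \<in> vpoly {}" by (simp add: elem_inv_def)
  then have "f = msubst (flag_dickson n n) f" by (subst vpoly_msubst_id) auto
  moreover have "deg_le w N f" for w
    using \<open>f \<in> vpoly {}\<close> by (auto simp: deg_le_def vpoly_def wdeg_def)
  ultimately show ?case using \<open>f \<in> vpoly {}\<close> by auto
next
  case (step k)
  let ?p = "CARD('p)"
  have p1: "1 < ?p" using CARD_gt_1[where 'p = 'p] by simp
  have G0: "flag_dickson k n k \<noteq> (0 :: 'p mod_ring mpoly)"
    using step by (simp add: flag_dickson_bottom flag_h_nonzero)
  show ?case
  proof (rule invariants_generated_step[of k n "elem_inv k k n" "flag_dickson k n"
        "elem_inv (Suc k) (Suc k) n" "\<lambda>v. ?p ^ (n - Suc k) - ?p ^ (v - Suc k)" "flag_dickson (Suc k) n"])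
    fix g :: "'p mod_ring mpoly" assume "g \<in> vpoly {k..<n}"
    then show "msubst (flag_dickson k n) g \<in> elem_inv k k n"
      by (rule elem_inv_msubst) (auto intro: flag_dickson_elem_inv)
  next
    fix f :: "'p mod_ring mpoly" assume f: "f \<in> elem_inv k k n" "var0 k f = 0"
    \<comment> \<open>Divisibility by \<open>y_k^(p-1)\<close> spreads under the shears to every
      linear form in the flag; the resulting product is the bottom generator.\<close>
    have "(\<Prod>j\<in>{k..<n}. span_prod ygen {k..<j} (ygen j)) ^ (?p - 1) dvd f"
    proof (rule span_prod_flag_power_dvd)
      fix j v assume "j \<in> {k..<n}" "v \<in> lspan (ygen :: nat \<Rightarrow> 'p mod_ring mpoly) {k..<j}"
      then show "(ygen j - v) ^ (?p - 1) dvd f"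
        using f step by (intro shear_var_lin_form_power_dvd[of k n k f k] elem_inv_var0_dvd[OF f(1)])
          (auto simp: elem_inv_def)
    qed simp
    then have "flag_dickson k n k dvd f"
      using step by (simp add: flag_dickson_bottom flag_h_def)
    then obtain q where q: "f = flag_dickson k n k * q" by blast
    moreover have "q \<in> elem_inv k k n"
      by (rule elem_inv_quotient[of "flag_dickson k n k"])
        (use f q G0 step flag_dickson_elem_inv[of k k n] in auto)
    ultimately show "\<exists>q\<in>elem_inv k k n. f = flag_dickson k n k * q" by blast
  next
    fix v assume "v \<in> {Suc k..<n}"
    then have "Suc (n - Suc k) = n - k" "Suc (v - Suc k) = v - k" by auto
    then show "?p ^ (n - k) - ?p ^ (v - k) = ?p * (?p ^ (n - Suc k) - ?p ^ (v - Suc k))"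
      by (metis diff_mult_distrib2 power_Suc)
  next
    fix v assume v: "v \<in> {k..<n}"
    have "homog (\<lambda>_. 1) (1 * (?p ^ (n - k) - ?p ^ (v - k))) (flag_dickson k n v :: 'p mod_ring mpoly)"
      unfolding flag_dickson_def
      by (rule homog_dickson_coeff) (use v homog_flag_h in \<open>auto simp: flag_h_def\<close>)
    then show "homog (\<lambda>_. 1) (?p ^ (n - k) - ?p ^ (v - k)) (flag_dickson k n v :: 'p mod_ring mpoly)" by simp
  next
    show "0 < ?p ^ (n - k) - ?p ^ (k - k)" 
      using step one_less_power[OF p1, of "n - k"] by simp
  next
    fix f :: "'p mod_ring mpoly" and N assume f: "f \<in> elem_inv k k n" "deg_le (\<lambda>_. 1) N f"
    show "\<exists>h\<in>elem_inv (Suc k) (Suc k) n. var0 k f = h ^ ?p \<and> deg_le (\<lambda>_. 1) (N div ?p) h"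
      by (rule elem_inv_var0_root[OF f(1) _ _ f(2)]) (use step in auto)
  qed (use step G0 in \<open>auto simp: var0_flag_dickson intro: elem_inv_diff\<close>)
qed

lemma flag_dickson_independent:
  fixes g :: "'p::prime_card mod_ring mpoly"
  assumes "k \<le> n" "g \<in> vpoly {k..<n}" "msubst (flag_dickson k n) g = 0"
  shows "g = 0"
  using assms
proof (induction arbitrary: g rule: inc_induct)
  case base
  then show ?case using vpoly_msubst_id[of g "{}" "flag_dickson n n"] by simp
next
  case (step k)
  \<comment> \<open>The bottom generator vanishes at \<open>y_k = 0\<close>: its restriction is the
    p-th power of a coefficient whose index \<open>k\<close> lies below the flag starting at
    \<open>Suc k\<close>.\<close>
  have "flag_h (Suc k) k = (0 :: 'p mod_ring mpoly)" by (simp add: flag_h_def)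
  then have "flag_dickson (Suc k) n k = (0 :: 'p mod_ring mpoly)"
    unfolding flag_dickson_def using step by (intro dickson_coeff_lt[of "Suc k"]) (auto simp: flag_h_def)
  moreover have "flag_dickson k n k \<noteq> (0 :: 'p mod_ring mpoly)"
    using step by (simp add: flag_dickson_bottom flag_h_nonzero)
  ultimately show ?case
    by (intro generators_independent_step[OF \<open>k < n\<close> step.IH _ _ _ step.prems])
      (simp_all add: var0_flag_dickson power_0_left)
qed

subsection \<open>The parabolic subgroup\<close>

lemma sum_lessThan_split_first:
  fixes f :: "nat \<Rightarrow> 'a::comm_monoid_add"
  shows "1 \<le> n \<Longrightarrow> (\<Sum>i<n. f i) = f 0 + (\<Sum>i\<in>{1..<n}. f i)"
  using sum.atLeast_Suc_lessThan[of 0 n f] by (simp add: atLeast0LessThan)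

lemma GL_inverse:
  assumes "A \<in> GL n"
  obtains B where "B \<in> carrier_mat n n" "A * B = 1\<^sub>m n" "B * A = 1\<^sub>m n" "A \<in> carrier_mat n n"
proof -
  from assms obtain B where A: "A \<in> carrier_mat n n" and B: "A * B = 1\<^sub>m n" "B * A = 1\<^sub>m (dim_row B)"
    by (auto simp: GL_def invertible_mat_def inverts_mat_def)
  have "dim_col B = n" by (metis B(1) index_mult_mat(3) index_one_mat(3))
  moreover have "dim_row B = n" by (metis A B(2) carrier_matD(2) index_mult_mat(3) index_one_mat(3))
  ultimately show ?thesis using that[of B] A B carrier_matI by metis
qed

text \<open>The last fact is injectivity of the lower right block, phrased in the coordinates of the
  whole matrix.\<close>

lemma parabolicD:
  fixes a :: "'a::field mat"
  assumes a: "a \<in> parabolic 1 (n - 1)" and n: "1 \<le> n"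
  shows "a \<in> carrier_mat n n" "a $$ (0, 0) \<noteq> 0"
    "\<And>i. i \<in> {1..<n} \<Longrightarrow> a $$ (i, 0) = 0"
    "\<And>c k. (\<And>i. i \<in> {1..<n} \<Longrightarrow> (\<Sum>k\<in>{1..<n}. a $$ (i, k) * c k) = 0) \<Longrightarrow> k \<in> {1..<n} \<Longrightarrow> c k = 0"
proof -
  from a obtain A B C where abc: "a = four_block_mat A C (0\<^sub>m (n - 1) 1) B"
    "A \<in> GL 1" "B \<in> GL (n - 1)" "C \<in> carrier_mat 1 (n - 1)"
    by (auto simp: parabolic_def)
  obtain A' where A: "A' \<in> carrier_mat 1 1" "A * A' = 1\<^sub>m 1" "A \<in> carrier_mat 1 1"
    using GL_inverse[OF abc(2)] by blast
  obtain B' where B: "B' \<in> carrier_mat (n - 1) (n - 1)" "B' * B = 1\<^sub>m (n - 1)" "B \<in> carrier_mat (n - 1) (n - 1)"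
    using GL_inverse[OF abc(3)] by blast
  have "four_block_mat A C (0\<^sub>m (n - 1) 1) B \<in> carrier_mat (1 + (n - 1)) (1 + (n - 1))"
    using A B by (intro four_block_carrier_mat)
  then show car: "a \<in> carrier_mat n n" using n abc by simp
  have "A $$ (0, 0) * A' $$ (0, 0) = (A * A') $$ (0, 0)" using A(1,3) by (auto simp: scalar_prod_def)
  also have "\<dots> = 1" unfolding A(2) by simp
  finally have "A $$ (0, 0) * A' $$ (0, 0) = 1" .
  then show "a $$ (0, 0) \<noteq> 0" using abc A B n by auto
  show "a $$ (i, 0) = 0" if "i \<in> {1..<n}" for i using that abc A B by auto
  fix c k assume z: "\<And>i. i \<in> {1..<n} \<Longrightarrow> (\<Sum>k\<in>{1..<n}. a $$ (i, k) * c k) = 0" and k: "k \<in> {1..<n}"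
  define v where "v = vec (n - 1) (\<lambda>k. c (Suc k))"
  have v: "v \<in> carrier_vec (n - 1)" by (simp add: v_def)
  have "B *\<^sub>v v = 0\<^sub>v (n - 1)"
  proof (rule eq_vecI)
    fix i assume "i < dim_vec (0\<^sub>v (n - 1) :: 'a vec)"
    then have i: "i < n - 1" by simp
    have "(B *\<^sub>v v) $ i = (\<Sum>k<n - 1. B $$ (i, k) * c (Suc k))"
      using i B by (simp add: v_def scalar_prod_def lessThan_atLeast0)
    also have "\<dots> = (\<Sum>k<n - 1. a $$ (Suc i, Suc k) * c (Suc k))"
      by (rule sum.cong) (use i abc A B in auto)
    also have "\<dots> = (\<Sum>k\<in>{1..<n}. a $$ (Suc i, k) * c k)"
      by (rule sum.reindex_bij_witness[of _ "\<lambda>k. k - 1" Suc]) auto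
    also have "\<dots> = 0" using z[of "Suc i"] i by simp
    finally show "(B *\<^sub>v v) $ i = 0\<^sub>v (n - 1) $ i" using i by simp
  qed (use B in simp)
  then have "B' *\<^sub>v (B *\<^sub>v v) = 0\<^sub>v (n - 1)" using B by auto
  then have "(B' * B) *\<^sub>v v = 0\<^sub>v (n - 1)"
    using assoc_mult_mat_vec[OF B(1,3) v] by simp
  then have "v = 0\<^sub>v (n - 1)" unfolding B(2) using v by simp
  then have "v $ (k - 1) = 0" using k by auto
  moreover have "k - 1 < n - 1" "Suc (k - 1) = k" using k by auto
  ultimately show "c k = 0" by (simp add: v_def)
qed

lemma parabolic_inj:
  fixes a :: "'a::field mat"
  assumes a: "a \<in> parabolic 1 (n - 1)" and n: "1 \<le> n"
    and z: "\<And>i. i < n \<Longrightarrow> (\<Sum>k<n. a $$ (i, k) * c k) = 0" and k: "k < n"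
  shows "c k = 0"
proof -
  note aD = parabolicD[OF a n]
  have "(\<Sum>k\<in>{1..<n}. a $$ (i, k) * c k) = 0" if "i \<in> {1..<n}" for i
    using z[of i] aD(3)[OF that] n that by (simp add: sum_lessThan_split_first)
  then have c: "c k = 0" if "k \<in> {1..<n}" for k
    using aD(4)[of c k] that by blast
  then have "a $$ (0, 0) * c 0 = 0" using z[of 0] n by (simp add: sum_lessThan_split_first)
  with aD(2) c k show ?thesis by (cases "k = 0") auto
qed

text \<open>Since the inverse has the same zeros in its first column, the diagonal blocks of
  \<open>a\<close> and \<open>b\<close> are inverse to each other.\<close>

lemma parabolicI:
  fixes a b :: "'a::field mat"
  assumes "a \<in> carrier_mat n n" "b \<in> carrier_mat n n" "a * b = 1\<^sub>m n" "b * a = 1\<^sub>m n" "1 \<le> n"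
    and "\<And>i. i \<in> {1..<n} \<Longrightarrow> a $$ (i, 0) = 0" "\<And>i. i \<in> {1..<n} \<Longrightarrow> b $$ (i, 0) = 0"
  shows "a \<in> parabolic 1 (n - 1)"
proof -
  define A where "A = (\<lambda>a :: 'a mat. mat 1 1 (\<lambda>(i, j). a $$ (i, j)))"
  define B where "B = (\<lambda>a :: 'a mat. mat (n - 1) (n - 1) (\<lambda>(i, j). a $$ (Suc i, Suc j)))"
  define C where "C = mat 1 (n - 1) (\<lambda>(i, j). a $$ (i, Suc j))"
  have entry: "(\<Sum>k<n. a $$ (i, k) * b $$ (k, j)) = (if i = j then 1 else 0)"
    if "a * b = 1\<^sub>m n" "a \<in> carrier_mat n n" "b \<in> carrier_mat n n" "i < n" "j < n" for a b :: "'a mat" and i j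
  proof -
    have "(a * b) $$ (i, j) = (\<Sum>k<n. a $$ (i, k) * b $$ (k, j))"
      using that(2-5) by (simp add: scalar_prod_def lessThan_atLeast0)
    then show ?thesis using that by simp
  qed
  have A: "A a * A b = 1\<^sub>m 1"
    if "a * b = 1\<^sub>m n" "a \<in> carrier_mat n n" "b \<in> carrier_mat n n"
      "\<And>i. i \<in> {1..<n} \<Longrightarrow> b $$ (i, 0) = 0" for a b :: "'a mat"
  proof -
    have "a $$ (0, 0) * b $$ (0, 0) = 1"
      using entry[OF that(1-3), of 0 0] that(4) assms(5) by (simp add: sum_lessThan_split_first)
    then show ?thesis by (intro eq_matI) (auto simp: A_def scalar_prod_def)
  qed
  have B: "B a * B b = 1\<^sub>m (n - 1)"
    if "a * b = 1\<^sub>m n" "a \<in> carrier_mat n n" "b \<in> carrier_mat n n"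
      "\<And>i. i \<in> {1..<n} \<Longrightarrow> a $$ (i, 0) = 0" for a b :: "'a mat"
  proof (rule eq_matI)
    fix i j assume ij: "i < dim_row (1\<^sub>m (n - 1) :: 'a mat)" "j < dim_col (1\<^sub>m (n - 1) :: 'a mat)"
    then have "(B a * B b) $$ (i, j) = (\<Sum>k<n - 1. a $$ (Suc i, Suc k) * b $$ (Suc k, Suc j))"
      by (simp add: B_def scalar_prod_def lessThan_atLeast0)
    also have "\<dots> = (\<Sum>k\<in>{1..<n}. a $$ (Suc i, k) * b $$ (k, Suc j))"
      by (rule sum.reindex_bij_witness[of _ "\<lambda>k. k - 1" Suc]) auto
    also have "\<dots> = (if i = j then 1 else 0)"
      using entry[OF that(1-3), of "Suc i" "Suc j"] that(4) assms(5) ij by (simp add: sum_lessThan_split_first)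
    finally show "(B a * B b) $$ (i, j) = 1\<^sub>m (n - 1) $$ (i, j)" using ij by simp
  qed (simp_all add: B_def)
  have "A a \<in> GL 1"
    using A[OF assms(3,1,2,7)] A[OF assms(4,2,1,6)]
    by (auto simp: GL_def invertible_mat_def inverts_mat_def A_def intro!: exI[of _ "A b"])
  moreover have "B a \<in> GL (n - 1)"
    using B[OF assms(3,1,2,6)] B[OF assms(4,2,1,7)]
    by (auto simp: GL_def invertible_mat_def inverts_mat_def B_def intro!: exI[of _ "B b"])
  moreover have "a = four_block_mat (A a) C (0\<^sub>m (n - 1) 1) (B a)"
    by (rule eq_matI) (use assms in \<open>auto simp: A_def B_def C_def\<close>)
  moreover have "C \<in> carrier_mat 1 (n - 1)" by (simp add: C_def)
  ultimately show ?thesis unfolding parabolic_def by blast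
qed

lemma multrow_mat_parabolic:
  fixes \<mu> :: "'a::field"
  assumes "i < n" "\<mu> \<noteq> 0"
  shows "multrow_mat n i \<mu> \<in> parabolic 1 (n - 1)"
  using multrow_mat_inv[OF assms] multrow_mat_inv[OF assms(1), of "inverse \<mu>"] assms
  by (intro parabolicI[of _ n "multrow_mat n i (inverse \<mu>)"]) (auto simp: multrow_mat_def)

text \<open>The extra entry of \<open>addrow_mat n c j i\<close> sits in row \<open>j\<close> and
  column \<open>i\<close>, so the matrix acts by \<open>y_i \<mapsto> y_i + c y_j\<close>;
  \<open>1 \<le> i\<close> keeps it out of the first column.\<close>

lemma addrow_mat_parabolic:
  fixes c :: "'a::field"
  assumes "j < n" "i < n" "i \<noteq> j" "1 \<le> i"
  shows "addrow_mat n c j i \<in> parabolic 1 (n - 1)"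
  using addrow_mat_inv[of j n i c] addrow_mat_inv[of j n i "- c"] assms
  by (intro parabolicI[of _ n "addrow_mat n (- c) j i"]) (auto simp: addrow_mat_def)

lemma poly_act_multrow:
  assumes "f \<in> vpoly {..<n}" "i < n"
  shows "poly_act (multrow_mat n i \<mu>) f = scale_var i \<mu> f"
  unfolding poly_act_def scale_var_def
proof (rule msubst_cong[OF assms(1)])
  fix k assume "k \<in> {..<n}"
  then have "(\<Sum>r<n. mconst (multrow_mat n i \<mu> $$ (r, k)) * ygen r) =
      (\<Sum>r<n. if r = k then (ygen(i := mconst \<mu> * ygen i)) k else 0)"
    by (intro sum.cong) (auto simp: multrow_mat_def)
  then show "(\<Sum>r<dim_row (multrow_mat n i \<mu>). mconst (multrow_mat n i \<mu> $$ (r, k)) * ygen r) =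
      (ygen(i := mconst \<mu> * ygen i)) k"
    using \<open>k \<in> {..<n}\<close> by (simp add: multrow_mat_def)
qed

lemma poly_act_addrow:
  assumes "f \<in> vpoly {..<n}" "i < n" "j < n" "i \<noteq> j"
  shows "poly_act (addrow_mat n c j i) f = shear_var i j c f"
  unfolding poly_act_def shear_var_def
proof (rule msubst_cong[OF assms(1)])
  fix k assume "k \<in> {..<n}"
  then have "(\<Sum>r<n. mconst (addrow_mat n c j i $$ (r, k)) * ygen r) =
      (\<Sum>r<n. (if r = k then ygen k else 0) + (if r = j then if k = i then mconst c * ygen j else 0 else 0))"
    using assms by (intro sum.cong) (auto simp: addrow_mat_def)
  then show "(\<Sum>r<dim_row (addrow_mat n c j i). mconst (addrow_mat n c j i $$ (r, k)) * ygen r) =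
      (ygen(i := ygen i + mconst c * ygen j)) k"
    using \<open>k \<in> {..<n}\<close> assms by (simp add: addrow_mat_def sum.distrib)
qed

text \<open>One inclusion is enough: the proposed generators are invariant under the whole group,
  and they already generate \<open>elem_inv 1 0 n\<close>.\<close>

lemma poly_invariants_elem_inv:
  "poly_invariants n (parabolic 1 (n - 1)) \<subseteq> (elem_inv 1 0 n :: 'a::field mpoly set)"
proof
  fix f :: "'a mpoly" assume "f \<in> poly_invariants n (parabolic 1 (n - 1))"
  then have f: "f \<in> vpoly {..<n}" "\<And>a. a \<in> parabolic 1 (n - 1) \<Longrightarrow> poly_act a f = f"
    by (auto simp: poly_invariants_def poly_ring_eq_vpoly)
  have "scale_var i \<mu> f = f" if "i < n" "\<mu> \<noteq> 0" for i \<mu>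
    using f(2)[OF multrow_mat_parabolic[OF that]] poly_act_multrow[OF f(1) that(1)] by simp
  moreover have "shear_var i j c f = f" if "i \<in> {1..<n}" "j < n" "i \<noteq> j" for i j c
    using f(2)[OF addrow_mat_parabolic[of j n i c]] poly_act_addrow[OF f(1), of i j] that by simp
  ultimately show "f \<in> elem_inv 1 0 n" using f(1) by (auto simp: elem_inv_def lessThan_atLeast0)
qed

subsection \<open>The Dickson invariants modulo the fixed line\<close>

text \<open>
  \<open>X \<mapsto> X^p - y_0^{p-1} X\<close> is additive with kernel spanned by \<open>y_0\<close>; it turns products over
  translates of spans containing \<open>y_0\<close> into products over spans of the images of \<open>y_1, y_2, \<dots>\<close>.
\<close>

definition line_norm :: "'p::prime_card mod_ring mpoly \<Rightarrow> 'p mod_ring mpoly" where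
  "line_norm X = X ^ CARD('p) - ygen 0 ^ (CARD('p) - 1) * X"

lemma line_norm_diff: "line_norm (X - Y) = line_norm X - (line_norm Y :: 'p::prime_card mod_ring mpoly)"
  using frob_diff[where k = 1 and 'p = 'p] by (simp add: line_norm_def algebra_simps)

lemma line_norm_add: "line_norm (X + Y) = line_norm X + (line_norm Y :: 'p::prime_card mod_ring mpoly)"
  using frob_add[where k = 1 and 'p = 'p] by (simp add: line_norm_def algebra_simps)

lemma line_norm_scale: "line_norm (mconst c * X) = mconst c * (line_norm X :: 'p::prime_card mod_ring mpoly)"
  using mconst_power_CARD_power[of c 1]
  by (simp add: line_norm_def power_mult_distrib algebra_simps)

lemma line_norm_sum: "line_norm (sum f A) = (\<Sum>i\<in>A. line_norm (f i) :: 'p::prime_card mod_ring mpoly)"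
proof -
  have "line_norm 0 = (0 :: 'p mod_ring mpoly)" by (simp add: line_norm_def power_0_left)
  then show ?thesis by (induction A rule: infinite_finite_induct) (simp_all add: line_norm_add)
qed

lemma line_norm_ygen_0 [simp]: "line_norm (ygen 0) = (0 :: 'p::prime_card mod_ring mpoly)"
  using power_minus_mult[of "CARD('p)" "ygen 0 :: 'p mod_ring mpoly"] by (simp add: line_norm_def)

text \<open>At \<open>y_0 = 0\<close> a linear relation between the norms becomes the p-th power of
  the same relation between the variables.\<close>

lemma lin_indep_line_norm:
  assumes "finite A" "0 \<notin> A"
  shows "lin_indep (\<lambda>i. line_norm (ygen i) :: 'p::prime_card mod_ring mpoly) A"
  unfolding lin_indep_def
proof (intro allI impI ballI)
  fix c i assume z: "(\<Sum>i\<in>A. mconst (c i) * line_norm (ygen i)) = (0 :: 'p mod_ring mpoly)" and i: "i \<in> A"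
  have "(\<Sum>i\<in>A. mconst (c i) * ygen i) ^ CARD('p) = var0 0 (\<Sum>i\<in>A. mconst (c i) * line_norm (ygen i))"
    unfolding frob_sum[where k = 1, unfolded power_one_right] power_mult_distrib var0_def msubst_sum
      mconst_power_CARD_power[where k = 1, unfolded power_one_right]
    by (rule sum.cong) (use assms CARD_minus_1_pos[where 'p = 'p] in \<open>auto simp: msubst_hom line_norm_def power_0_left\<close>)
  then have "(\<Sum>i\<in>A. mconst (c i) * ygen i) = (0 :: 'p mod_ring mpoly)" by (simp add: z var0_def)
  then show "c i = 0" using lin_indepD[OF lin_indep_ygen[OF assms(1)]] i by blast
qed

lemma span_prod_line_norm:
  assumes "1 \<le> j"
  shows "span_prod ygen {0..<j} X =
    span_prod (\<lambda>i. line_norm (ygen i)) {1..<j} (line_norm X :: 'p::prime_card mod_ring mpoly)"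
  using assms
proof (induction arbitrary: X rule: dec_induct)
  case base
  have "{0..<1} = insert 0 ({} :: nat set)" by auto
  moreover have "span_prod ygen (insert 0 {}) X = (\<Prod>c\<in>UNIV. span_prod ygen {} (X - mconst c * ygen 0))"
    by (rule span_prod_insert) (auto intro: lin_indep_ygen)
  ultimately show ?case by (simp add: prod_minus_mconst_mult line_norm_def)
next
  case (step j)
  have ins: "{0..<Suc j} = insert j {0..<j}" "{1..<Suc j} = insert j {1..<j}" using step by auto
  show ?case
    unfolding ins using step.hyps
    by (subst (1 2) span_prod_insert)
      (auto intro: lin_indep_ygen lin_indep_line_norm simp: step.IH line_norm_diff line_norm_scale)
qed

lemma mui_h_eq_flag_h: "mui_h j = flag_h 0 j"
  by (simp add: mui_h_def flag_h_def span_prod_def lspan_def lessThan_atLeast0)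

text \<open>The value 0 at \<open>j = 0\<close> implements the substitution
  \<open>h_1^(p-1) = 0\<close> from the definition of \<open>d_{n,i}(I)\<close>. The remaining
  \<open>mui_h j\<close> are products over spans of line norms, by
  \<open>flag_h_I_eq_span_prod\<close>.\<close>

definition flag_h_I :: "nat \<Rightarrow> 'p::prime_card mod_ring mpoly" where
  "flag_h_I j = (if j < 1 then 0 else mui_h j)"

text \<open>Passing from \<open>n\<close> to \<open>n + 1\<close>, an index set either contains the
  new largest element \<open>n\<close>, whose factor has exponent \<open>p^0\<close> and splits off,
  or avoids it; in the latter case every exponent is one higher than for \<open>m - 1\<close>, which
  yields a p-th power. These are the two summands of the recursion.\<close>

lemma dickson_I_eq_dickson_coeff:
  assumes "1 \<le> n" "m \<le> n"
  shows "dickson_I n m = (dickson_coeff flag_h_I n m :: 'p::prime_card mod_ring mpoly)"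
  using assms
proof (induction n arbitrary: m rule: dec_induct)
  case base
  have "m = 0 \<or> m = 1" using base by auto
  then show ?case
  proof
    assume "m = 0"
    have "dickson_I 1 0 = (0 :: 'p mod_ring mpoly)"
      unfolding dickson_I_def by (rule sum.neutral) auto
    then show ?thesis using CARD_minus_1_pos[where 'p = 'p] \<open>m = 0\<close>
      by (simp add: flag_h_I_def power_0_left)
  next
    assume "m = 1"
    moreover have "{J. J \<subseteq> {1..<1::nat} \<and> card J = 0} = {{}}" by auto
    ultimately show ?thesis using CARD_minus_1_pos[where 'p = 'p]
      by (simp add: dickson_I_def flag_h_I_def)
  qed
next
  case (step n)
  let ?p = "CARD('p)"
  define t where "t = (\<lambda>m J s. (mui_h (sorted_list_of_set J ! s) ^ (?p - 1)) ^
       (?p ^ (m + s - sorted_list_of_set J ! s)) :: 'p mod_ring mpoly)"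
  have dI: "dickson_I n m = (\<Sum>J | J \<subseteq> {1..<n} \<and> card J = n - m. \<Prod>s<n - m. t m J s)" for n m
    by (simp add: dickson_I_def t_def)
  show ?case
  proof (cases "m = Suc n")
    case True
    moreover have "{J. J \<subseteq> {1..<Suc n} \<and> card J = 0} = {{}}"
      by (auto dest: finite_subset)
    ultimately show ?thesis by (simp add: dickson_I_def del: dickson_coeff.simps)
  next
    case False
    then have mn: "m \<le> n" using step by simp
    define d where "d = n - m"
    have d: "Suc n - m = Suc d" using mn by (simp add: d_def)
    define S1 where "S1 = {J. J \<subseteq> {1..<n} \<and> card J = Suc d}"
    define S2 where "S2 = {J. J \<subseteq> {1..<n} \<and> card J = d}"
    have fin: "finite S1" "finite S2" unfolding S1_def S2_def by auto
    have split: "{J. J \<subseteq> {1..<Suc n} \<and> card J = Suc d} = S1 \<union> insert n ` S2"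
    proof (intro subset_antisym subsetI)
      fix J assume "J \<in> {J. J \<subseteq> {1..<Suc n} \<and> card J = Suc d}"
      then have J: "J \<subseteq> {1..<Suc n}" "card J = Suc d" "finite J" by (auto intro: finite_subset)
      show "J \<in> S1 \<union> insert n ` S2"
      proof (cases "n \<in> J")
        case True
        then have "J = insert n (J - {n})" "J - {n} \<subseteq> {1..<n}" "card (J - {n}) = d"
          using J by (auto simp: less_Suc_eq)
        then show ?thesis unfolding S2_def by blast
      next
        case False
        then have "J \<subseteq> {1..<n}" using J by (auto simp: less_Suc_eq subset_iff)
        then show ?thesis using J by (simp add: S1_def)
      qed
    next
      fix J assume "J \<in> S1 \<union> insert n ` S2"
      then show "J \<in> {J. J \<subseteq> {1..<Suc n} \<and> card J = Suc d}"
      proof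
        assume "J \<in> insert n ` S2"
        then obtain K where K: "K \<subseteq> {1..<n}" "card K = d" "J = insert n K" by (auto simp: S2_def)
        moreover have "n \<notin> K" "finite K" using K by (auto intro: finite_subset)
        ultimately show ?thesis using step by auto
      qed (auto simp: S1_def)
    qed
    have "dickson_I (Suc n) m = (\<Sum>J\<in>S1. \<Prod>s<Suc d. t m J s) + (\<Sum>J\<in>insert n ` S2. \<Prod>s<Suc d. t m J s)"
      unfolding dI d split by (rule sum.union_disjoint) (use fin in \<open>auto simp: S1_def\<close>)
    also have "(\<Sum>J\<in>insert n ` S2. \<Prod>s<Suc d. t m J s) = (\<Sum>J\<in>S2. \<Prod>s<Suc d. t m (insert n J) s)"
    proof (rule sum.reindex[unfolded comp_def])
      show "inj_on (insert n) S2"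
      proof (rule inj_onI)
        fix J K assume "J \<in> S2" "K \<in> S2" "insert n J = insert n K"
        moreover have "n \<notin> J" "n \<notin> K" using calculation by (auto simp: S2_def)
        ultimately show "J = K" by (metis insert_ident)
      qed
    qed
    also have "\<dots> = (\<Sum>J\<in>S2. mui_h n ^ (?p - 1) * (\<Prod>s<d. t m J s))"
    proof (rule sum.cong[OF refl])
      fix J assume "J \<in> S2"
      then have J: "J \<subseteq> {1..<n}" "card J = d" "finite J" by (auto simp: S2_def intro: finite_subset)
      have "sorted_list_of_set (insert n J) = insort n (sorted_list_of_set J)"
        using J by (intro sorted_list_of_set_insert) auto
      also have "\<dots> = sorted_list_of_set J @ [n]"
        by (rule sorted_insort_is_snoc) (use J in auto)
      finally have l: "sorted_list_of_set (insert n J) = sorted_list_of_set J @ [n]" .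
      have len: "length (sorted_list_of_set J) = d" using J by simp
      have "t m (insert n J) s = t m J s" if "s < d" for s
        using that len by (simp add: t_def l nth_append)
      moreover have "t m (insert n J) d = mui_h n ^ (?p - 1)"
        using len mn by (simp add: t_def l nth_append d_def)
      ultimately show "(\<Prod>s<Suc d. t m (insert n J) s) = mui_h n ^ (?p - 1) * (\<Prod>s<d. t m J s)"
        by (simp add: mult.commute)
    qed
    also have "\<dots> = flag_h_I n ^ (?p - 1) * dickson_coeff flag_h_I n m"
    proof -
      have "flag_h_I n = (mui_h n :: 'p mod_ring mpoly)" using step.hyps by (simp add: flag_h_I_def)
      then show ?thesis unfolding step.IH[OF mn, symmetric] dI d_def S2_def by (simp add: sum_distrib_left)
    qed
    also have "(\<Sum>J\<in>S1. \<Prod>s<Suc d. t m J s) = (if m = 0 then 0 else dickson_coeff flag_h_I n (m - 1) ^ ?p)"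
    proof (cases "m = 0")
      case True
      have "S1 = {}"
      proof -
        have False if "J \<in> S1" for J
        proof -
          have "card J \<le> card {1..<n}" using that by (intro card_mono) (auto simp: S1_def)
          then show False using that True by (simp add: S1_def d_def)
        qed
        then show ?thesis by auto
      qed
      then show ?thesis using True by simp
    next
      case False
      have d1: "n - (m - 1) = Suc d" using False mn by (simp add: d_def)
      have "t m J s = t (m - 1) J s ^ ?p" if "J \<in> S1" "s < Suc d" for J s
      proof -
        have J: "J \<subseteq> {1..<n}" "card J = Suc d" "finite J" using that by (auto simp: S1_def intro: finite_subset)
        let ?l = "sorted_list_of_set J"
        have len: "length ?l = Suc d" using J by simp
        \<comment> \<open>The entries increase strictly and stay below \<open>n\<close>, so the one
          at position \<open>s\<close> is at most \<open>m - 1 + s\<close>. Hence the natural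
          subtraction in the exponent does not truncate and drops by exactly one from
          \<open>m\<close> to \<open>m - 1\<close>.\<close>
        have "?l ! s + r \<le> ?l ! (s + r)" if "s + r < Suc d" for r
          using that
        proof (induction r)
          case (Suc r)
          have "?l ! (s + r) < ?l ! Suc (s + r)"
            using Suc.prems len strict_sorted_list_of_set[of J]
            by (simp add: sorted_wrt_iff_nth_less)
          then show ?case using Suc by simp
        qed simp
        from this[of "d - s"] have "?l ! s + (d - s) \<le> ?l ! d" using that(2) by simp
        moreover have "?l ! d \<in> J" using len J(3) nth_mem[of d ?l] by simp
        then have "?l ! d < n" using J by auto
        ultimately have "?l ! s \<le> m - 1 + s" using that(2) mn False by (simp add: d_def)
        then have "m + s - ?l ! s = Suc (m - 1 + s - ?l ! s)" using False by simp
        then show ?thesis by (simp add: t_def power_mult[symmetric] mult_ac)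
      qed
      then have "(\<Sum>J\<in>S1. \<Prod>s<Suc d. t m J s) = (\<Sum>J\<in>S1. \<Prod>s<Suc d. t (m - 1) J s) ^ ?p"
        unfolding frob_sum[where k = 1 and 'p = 'p, unfolded power_one_right] prod_power_distrib
        by (intro sum.cong prod.cong) auto
      also have "(\<Sum>J\<in>S1. \<Prod>s<Suc d. t (m - 1) J s) = dickson_I n (m - 1)"
        unfolding dI d1 S1_def ..
      finally show ?thesis using step.IH[of "m - 1"] mn False by simp
    qed
    finally show ?thesis by simp
  qed
qed

definition lin_sub :: "'a::comm_ring_1 mat \<Rightarrow> nat \<Rightarrow> 'a mpoly" where
  "lin_sub a k = (\<Sum>i<dim_row a. mconst (a $$ (i, k)) * ygen i)"

lemma poly_act_eq: "poly_act a = msubst (lin_sub a)"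
  by (simp add: poly_act_def lin_sub_def[abs_def])

lemma mconst_power_CARD_minus_1:
  "c \<noteq> 0 \<Longrightarrow> mconst (c :: 'p::prime_card mod_ring) ^ (CARD('p) - 1) = 1"
  by (metis mconst_1 mconst_power mod_ring_power_CARD_minus_1)

lemma poly_act_span:
  assumes "a \<in> carrier_mat n n"
  shows "poly_act a (\<Sum>k<n. mconst (c k) * ygen k) = (\<Sum>i<n. mconst (\<Sum>k<n. a $$ (i, k) * c k) * ygen i)"
proof -
  have "poly_act a (\<Sum>k<n. mconst (c k) * ygen k) = (\<Sum>k<n. \<Sum>i<n. mconst (a $$ (i, k) * c k) * ygen i)"
    using assms by (simp add: poly_act_eq lin_sub_def msubst_hom sum_distrib_left mconst_mult mult_ac)
  then show ?thesis
    by (subst (asm) sum.swap) (simp add: mconst_sum sum_distrib_right)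
qed

definition parabolic_gens :: "nat \<Rightarrow> nat \<Rightarrow> 'p::prime_card mod_ring mpoly" where
  "parabolic_gens n i = (if i = 0 then mui_h 0 ^ (CARD('p) - 1) else dickson_I n i)"

lemma mui_h_0 [simp]: "mui_h 0 = ygen 0"
  by (simp add: mui_h_def)

lemma flag_h_I_eq_span_prod:
  "1 \<le> j \<Longrightarrow> flag_h_I j = span_prod (\<lambda>i. line_norm (ygen i)) {1..<j} (line_norm (ygen j))"
  by (simp add: flag_h_I_def mui_h_eq_flag_h flag_h_def span_prod_line_norm)

text \<open>The group scales \<open>y_0\<close> by a unit whose \<open>(p-1)\<close>-st power is 1,
  so \<open>line_norm\<close> commutes with the action. As \<open>line_norm (ygen 0)\<close> is
  zero, only the lower right block acts on the span of the other norms, and it does so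
  injectively.\<close>

lemma poly_act_flag_dickson_I:
  fixes a :: "'p::prime_card mod_ring mat"
  assumes a: "a \<in> parabolic 1 (n - 1)" and n: "1 \<le> n" and v: "1 \<le> v" "v \<le> n"
  shows "poly_act a (dickson_coeff flag_h_I n v) = dickson_coeff flag_h_I n v"
  unfolding poly_act_eq
proof (rule dickson_coeff_invariant)
  note aD = parabolicD[OF a n]
  define z where "z = (\<lambda>i. line_norm (ygen i) :: 'p mod_ring mpoly)"
  have z0: "z 0 = 0" by (simp add: z_def)
  have sub0: "lin_sub a 0 = mconst (a $$ (0, 0)) * ygen 0"
    using aD n by (simp add: lin_sub_def sum_lessThan_split_first)
  show indep: "lin_indep (\<lambda>i. line_norm (ygen i) :: 'p mod_ring mpoly) {1..<n}"
    by (rule lin_indep_line_norm) auto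
  have "mconst (a $$ (0, 0)) ^ (CARD('p) - 1) = 1"
    using aD(2) by (rule mconst_power_CARD_minus_1)
  then have "msubst (lin_sub a) (line_norm X) = line_norm (msubst (lin_sub a) X)" for X
    by (simp add: line_norm_def msubst_hom sub0 power_mult_distrib)
  then have az: "msubst (lin_sub a) (z k) = (\<Sum>i\<in>{1..<n}. mconst (a $$ (i, k)) * z i)" for k
    using aD(1) n z0 by (simp add: z_def lin_sub_def line_norm_sum line_norm_add line_norm_scale sum_lessThan_split_first)
  have "msubst (lin_sub a) ` lspan z {1..<n} \<subseteq> lspan z {1..<n}"
    by (rule linear_subst_lspan) (auto simp: az intro!: lspan_sum lspan_scale lspan_base)
  then show "msubst (lin_sub a) ` lspan (\<lambda>i. line_norm (ygen i)) {1..<n}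
      \<subseteq> lspan (\<lambda>i. line_norm (ygen i)) {1..<n}" by (simp add: z_def)
  have "inj_on (msubst (lin_sub a)) (lspan z {1..<n})"
  proof (rule inj_onI)
    fix x y assume "x \<in> lspan z {1..<n}" "y \<in> lspan z {1..<n}"
      and eq: "msubst (lin_sub a) x = msubst (lin_sub a) y"
    then obtain c d where xy: "x = (\<Sum>i\<in>{1..<n}. mconst (c i) * z i)" "y = (\<Sum>i\<in>{1..<n}. mconst (d i) * z i)"
      by (auto simp: lspan_def)
    let ?e = "\<lambda>i. c i - d i"
    have "0 = msubst (lin_sub a) (\<Sum>k\<in>{1..<n}. mconst (?e k) * z k)"
      using eq by (simp add: xy mconst_diff left_diff_distrib sum_subtractf msubst_diff)
    also have "\<dots> = (\<Sum>k\<in>{1..<n}. \<Sum>i\<in>{1..<n}. mconst (a $$ (i, k) * ?e k) * z i)"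
      by (simp add: msubst_hom az sum_distrib_left mconst_mult mult_ac)
    also have "\<dots> = (\<Sum>i\<in>{1..<n}. mconst (\<Sum>k\<in>{1..<n}. a $$ (i, k) * ?e k) * z i)"
      by (subst sum.swap) (simp add: mconst_sum sum_distrib_right)
    finally have "(\<Sum>k\<in>{1..<n}. a $$ (i, k) * ?e k) = 0" if "i \<in> {1..<n}" for i
      using lin_indepD[OF indep[folded z_def], of "\<lambda>i. \<Sum>k\<in>{1..<n}. a $$ (i, k) * ?e k" i] that by simp
    then have "?e k = 0" if "k \<in> {1..<n}" for k using aD(4)[of ?e k] that by blast
    then show "x = y" unfolding xy by (intro sum.cong) auto
  qed
  then show "inj_on (msubst (lin_sub a)) (lspan (\<lambda>i. line_norm (ygen i)) {1..<n})" by (simp add: z_def)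
  \<comment> \<open>Provides the infinite range: the powers of \<open>y_0\<close> go to nonzero
    multiples of distinct monomials.\<close>
  have "inj (\<lambda>j. msubst (lin_sub a) (ygen 0 ^ j))"
  proof (rule injI)
    fix i j assume "msubst (lin_sub a) (ygen 0 ^ i) = msubst (lin_sub a) (ygen 0 ^ j)"
    then have eq: "mconst (a $$ (0, 0) ^ i) * ygen 0 ^ i = mconst (a $$ (0, 0) ^ j) * ygen 0 ^ j"
      by (simp add: msubst_power sub0 power_mult_distrib mconst_power)
    have "mconst (b ^ i) * ygen 0 ^ i = Poly_Mapping.single (Poly_Mapping.single 0 i) (b ^ i)" for b :: "'p mod_ring" and i
      by (simp add: single_eq_mconst_mono)
    with eq have "Poly_Mapping.keys (Poly_Mapping.single (Poly_Mapping.single (0::nat) i) (a $$ (0, 0) ^ i)) =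
       Poly_Mapping.keys (Poly_Mapping.single (Poly_Mapping.single (0::nat) j) (a $$ (0, 0) ^ j))" by simp
    then have "Poly_Mapping.single (0::nat) i = Poly_Mapping.single 0 j" using aD(2) by simp
    then show "i = j" by (metis lookup_single_eq)
  qed
  then have "infinite (range (\<lambda>j. msubst (lin_sub a) (ygen 0 ^ j)))" by (rule range_inj_infinite)
  moreover have "range (\<lambda>j. msubst (lin_sub a) (ygen 0 ^ j)) \<subseteq> range (msubst (lin_sub a))" by auto
  ultimately show "infinite (range (msubst (lin_sub a)))" using finite_subset by blast
qed (use v flag_h_I_eq_span_prod in \<open>auto simp: flag_h_I_def\<close>)

lemma parabolic_gens_invariant:
  assumes n: "1 \<le> n" and i: "i < n"
  shows "(parabolic_gens n i :: 'p::prime_card mod_ring mpoly) \<in> poly_invariants n (parabolic 1 (n - 1))"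
proof (cases "i = 0")
  case True
  have "poly_act a (ygen 0 ^ (CARD('p) - 1)) = ygen 0 ^ (CARD('p) - 1)"
    if a: "a \<in> parabolic 1 (n - 1)" for a :: "'p mod_ring mat"
  proof -
    note aD = parabolicD[OF a n]
    have "lin_sub a 0 = mconst (a $$ (0, 0)) * ygen 0"
      using aD n by (simp add: lin_sub_def sum_lessThan_split_first)
    moreover have "mconst (a $$ (0, 0)) ^ (CARD('p) - 1) = 1"
      using aD(2) by (rule mconst_power_CARD_minus_1)
    ultimately show ?thesis by (simp add: poly_act_eq msubst_power power_mult_distrib)
  qed
  then show ?thesis using True n
    by (auto simp: parabolic_gens_def poly_invariants_def poly_ring_eq_vpoly intro!: vpoly_closed vpoly_ygen)
next
  case False
  then have "parabolic_gens n i = (dickson_coeff flag_h_I n i :: 'p mod_ring mpoly)"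
    using i n by (simp add: parabolic_gens_def dickson_I_eq_dickson_coeff)
  moreover have "dickson_coeff flag_h_I n i \<in> (vpoly {..<n} :: 'p mod_ring mpoly set)"
    using flag_h_vpoly[of _ n 0] by (intro dickson_coeff_vpoly) (auto simp: flag_h_I_def mui_h_eq_flag_h lessThan_atLeast0)
  ultimately show ?thesis
    using poly_act_flag_dickson_I[of _ n i] n i False
    by (auto simp: poly_invariants_def poly_ring_eq_vpoly)
qed

lemma var0_parabolic_gens:
  assumes "i \<in> {Suc 0..<n}"
  shows "var0 0 (parabolic_gens n i) = (flag_dickson (Suc 0) n i ^ CARD('p) :: 'p::prime_card mod_ring mpoly)"
proof -
  have "var0 0 (flag_h_I j) = (flag_h (Suc 0) j ^ CARD('p) :: 'p mod_ring mpoly)" for j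
    using var0_flag_h[of 0 j]
    by (cases "j = 0") (auto simp: flag_h_I_def mui_h_eq_flag_h flag_h_def var0_def power_0_left)
  then show ?thesis
    using assms unfolding var0_def flag_dickson_def dickson_coeff_frob[symmetric]
    by (simp add: parabolic_gens_def dickson_I_eq_dickson_coeff dickson_coeff_msubst)
qed

lemma poly_invariants_msubst:
  assumes "g \<in> vpoly A" "\<And>v. v \<in> A \<Longrightarrow> G v \<in> poly_invariants n P"
  shows "msubst G g \<in> poly_invariants n P"
proof -
  have "msubst G g \<in> vpoly {..<n}"
    by (rule msubst_vpoly[OF assms(1)]) (use assms(2) in \<open>auto simp: poly_invariants_def poly_ring_eq_vpoly\<close>)
  moreover have "poly_act a (msubst G g) = msubst G g" if "a \<in> P" for a
    unfolding poly_act_eq msubst_msubst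
    by (rule msubst_cong[OF assms(1)]) (use assms(2) that in \<open>auto simp: poly_invariants_def poly_act_eq\<close>)
  ultimately show ?thesis by (simp add: poly_invariants_def poly_ring_eq_vpoly)
qed

text \<open>No shear moves \<open>y_0\<close>, so an invariant vanishing at \<open>y_0 = 0\<close>
  can only be divided by \<open>y_0^(p-1)\<close>, the first generator. One restriction then reaches
  the full linear group in \<open>n - 1\<close> variables.\<close>

theorem parabolic_invariants_generated:
  assumes n: "2 \<le> n"
  shows "poly_invariants n (parabolic 1 (n - 1)) =
    msubst (parabolic_gens n) ` (poly_ring n :: 'p::prime_card mod_ring mpoly set)"
proof
  show "msubst (parabolic_gens n) ` (poly_ring n :: 'p mod_ring mpoly set) \<subseteq> poly_invariants n (parabolic 1 (n - 1))"
  proof (intro image_subsetI)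
    fix g :: "'p mod_ring mpoly" assume "g \<in> poly_ring n"
    then show "msubst (parabolic_gens n) g \<in> poly_invariants n (parabolic 1 (n - 1))"
      unfolding poly_ring_eq_vpoly
      by (rule poly_invariants_msubst) (use n parabolic_gens_invariant[of n] in auto)
  qed
next
  let ?p = "CARD('p)"
  \<comment> \<open>The degrees of the generators: \<open>d_{n,v}(I)\<close> has degree
    \<open>p (p^(n-1) - p^(v-1)) = p^n - p^v\<close>.\<close>
  define w where "w = (\<lambda>v. if v = 0 then ?p - 1 else ?p ^ n - ?p ^ v)"
  show "poly_invariants n (parabolic 1 (n - 1)) \<subseteq> msubst (parabolic_gens n) ` (poly_ring n :: 'p mod_ring mpoly set)"
  proof
    fix f :: "'p mod_ring mpoly" assume "f \<in> poly_invariants n (parabolic 1 (n - 1))"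
    then have f: "f \<in> elem_inv 1 0 n" using poly_invariants_elem_inv[of n] by blast
    obtain N where N: "deg_le (\<lambda>_. 1) N f" using deg_le_ex by blast
    have "\<exists>g\<in>vpoly {0..<n}. deg_le w N g \<and> f = msubst (parabolic_gens n) g"
    proof (rule invariants_generated_step[of 0 n "elem_inv 1 0 n" "parabolic_gens n"
        "elem_inv (Suc 0) (Suc 0) n" "\<lambda>v. ?p ^ (n - Suc 0) - ?p ^ (v - Suc 0)" "flag_dickson (Suc 0) n"])
      fix g :: "'p mod_ring mpoly" assume "g \<in> vpoly {0..<n}"
      then have "msubst (parabolic_gens n) g \<in> poly_invariants n (parabolic 1 (n - 1))"
        by (rule poly_invariants_msubst) (use n parabolic_gens_invariant[of n] in auto)
      then show "msubst (parabolic_gens n) g \<in> elem_inv 1 0 n" using poly_invariants_elem_inv[of n] by blast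
    next
      fix f :: "'p mod_ring mpoly" assume f: "f \<in> elem_inv 1 0 n" "var0 0 f = 0"
      have "ygen 0 ^ (?p - 1) dvd f" by (rule elem_inv_var0_dvd[OF f(1) _ f(2)]) (use n in simp)
      then obtain q where q: "f = ygen 0 ^ (?p - 1) * q" by blast
      have "ygen 0 ^ (?p - 1) \<in> (elem_inv 1 0 n :: 'p mod_ring mpoly set)"
        using parabolic_gens_invariant[of n 0] poly_invariants_elem_inv[of n] n
        by (auto simp: parabolic_gens_def)
      then have "q \<in> elem_inv 1 0 n"
        by (rule elem_inv_quotient[OF f(1)[unfolded q]]) simp
      then show "\<exists>q\<in>elem_inv 1 0 n. f = parabolic_gens n 0 * q" using q by (auto simp: parabolic_gens_def)
    next
      fix f :: "'p mod_ring mpoly" and N assume f: "f \<in> elem_inv 1 0 n" "deg_le (\<lambda>_. 1) N f"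
      show "\<exists>h\<in>elem_inv (Suc 0) (Suc 0) n. var0 0 f = h ^ ?p \<and> deg_le (\<lambda>_. 1) (N div ?p) h"
        by (rule elem_inv_var0_root[OF f(1) _ _ f(2)]) (use n in auto)
    next
      fix v assume v: "v \<in> {Suc 0..<n}"
      then have "Suc (n - Suc 0) = n" "Suc (v - Suc 0) = v" by auto
      then show "w v = ?p * (?p ^ (n - Suc 0) - ?p ^ (v - Suc 0))"
        using v unfolding w_def by (auto simp: diff_mult_distrib2 simp flip: power_Suc)
      show "var0 0 (parabolic_gens n v) = (flag_dickson (Suc 0) n v ^ ?p :: 'p mod_ring mpoly)"
        using var0_parabolic_gens[OF v] .
    next
      fix h :: "'p mod_ring mpoly" and N assume "h \<in> elem_inv (Suc 0) (Suc 0) n" "deg_le (\<lambda>_. 1) N h"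
      then show "\<exists>g\<in>vpoly {Suc 0..<n}. deg_le (\<lambda>v. ?p ^ (n - Suc 0) - ?p ^ (v - Suc 0)) N g \<and>
          h = msubst (flag_dickson (Suc 0) n) g"
        using n by (intro dickson_theorem) auto
    next
      fix v assume v: "v \<in> {0..<n}"
      show "homog (\<lambda>_. 1) (w v) (parabolic_gens n v :: 'p mod_ring mpoly)"
      proof (cases "v = 0")
        case True
        then show ?thesis using homog_power[OF homog_ygen, of "\<lambda>_. 1" "?p - 1" 0]
          by (simp add: w_def parabolic_gens_def)
      next
        case False
        have "homog (\<lambda>_. 1) (?p * (?p ^ (n - 1) - ?p ^ (v - 1))) (dickson_coeff flag_h_I n v :: 'p mod_ring mpoly)"
        proof (rule homog_dickson_coeff)
          fix i :: nat assume "1 \<le> i"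
          then have "?p * ?p ^ (i - 1) = ?p ^ i" by (simp flip: power_Suc)
          then show "homog (\<lambda>_. 1) (?p * ?p ^ (i - 1)) (flag_h_I i :: 'p mod_ring mpoly)"
            using homog_flag_h[of 0 i] \<open>1 \<le> i\<close> by (simp add: flag_h_I_def mui_h_eq_flag_h)
        qed (use v False in \<open>auto simp: flag_h_I_def\<close>)
        moreover have "Suc (n - Suc 0) = n" "Suc (v - Suc 0) = v" using v False by auto
        then have "?p * (?p ^ (n - 1) - ?p ^ (v - 1)) = ?p ^ n - ?p ^ v"
          by (auto simp: diff_mult_distrib2 simp flip: power_Suc)
        ultimately show ?thesis using v False n
          by (simp add: w_def parabolic_gens_def dickson_I_eq_dickson_coeff)
      qed
    qed (use n f N CARD_minus_1_pos[where 'p = 'p] in \<open>auto simp: w_def parabolic_gens_def intro: elem_inv_diff\<close>)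
    then show "f \<in> msubst (parabolic_gens n) ` poly_ring n"
      by (auto simp: poly_ring_eq_vpoly lessThan_atLeast0)
  qed
qed

lemma parabolic_gens_independent:
  assumes n: "2 \<le> n"
  shows "inj_on (msubst (parabolic_gens n)) (poly_ring n :: 'p::prime_card mod_ring mpoly set)"
proof (rule inj_onI)
  fix f g :: "'p mod_ring mpoly"
  assume fg: "f \<in> poly_ring n" "g \<in> poly_ring n" "msubst (parabolic_gens n) f = msubst (parabolic_gens n) g"
  have "f - g = 0"
  proof (rule generators_independent_step[of 0 n "flag_dickson (Suc 0) n" "parabolic_gens n"])
    fix g :: "'p mod_ring mpoly" assume "g \<in> vpoly {Suc 0..<n}" "msubst (flag_dickson (Suc 0) n) g = 0"
    then show "g = 0" by (rule flag_dickson_independent[rotated]) (use n in simp)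
  next
    show "f - g \<in> vpoly {0..<n}" using fg by (auto simp: poly_ring_eq_vpoly lessThan_atLeast0 intro: vpoly_diff)
    show "var0 0 (parabolic_gens n 0) = (0 :: 'p mod_ring mpoly)"
      using CARD_minus_1_pos[where 'p = 'p] by (simp add: parabolic_gens_def var0_def msubst_power power_0_left)
  qed (use n fg var0_parabolic_gens in \<open>auto simp: msubst_diff parabolic_gens_def\<close>)
  then show "f = g" by simp
qed

section \<open>The exterior algebra, its contractions and the determinants
  \<open>M_T\<close>\<close>

subsection \<open>Coefficients in the exterior algebra\<close>

lemma ext_coeff_add [simp]: "ext_coeff (f + g) S = ext_coeff f S + ext_coeff g S"
  and ext_coeff_diff [simp]: "ext_coeff (f - g) S = ext_coeff f S - ext_coeff g S"
  and ext_coeff_uminus [simp]: "ext_coeff (- f) S = - ext_coeff f S"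
  and ext_coeff_0 [simp]: "ext_coeff 0 S = 0"
  by (simp_all add: plus_ext.rep_eq minus_ext.rep_eq uminus_ext.rep_eq zero_ext.rep_eq)

lemma ext_coeff_sum: "ext_coeff (sum f A) S = (\<Sum>i\<in>A. ext_coeff (f i) S)"
  by (induction A rule: infinite_finite_induct) simp_all

lemma ext_coeff_const: "ext_coeff (ext_const c) S = (if S = {} then c else 0)"
  by (simp add: ext_const.rep_eq)

lemma ext_coeff_const_mult [simp]: "ext_coeff (ext_const c * f) S = c * ext_coeff f S"
proof (cases "finite S")
  case True
  have "ext_coeff (ext_const c * f) S = (\<Sum>A\<in>Pow S. if A = {} then c * ext_coeff f S else 0)"
    unfolding times_ext.rep_eq ext_const.rep_eq by (intro sum.cong) auto
  then show ?thesis using True by simp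
qed (simp add: ext_coeff_infinite)

lemma ext_coeff_mult_const [simp]: "ext_coeff (f * ext_const c) S = ext_coeff f S * c"
proof (cases "finite S")
  case True
  have "ext_coeff (f * ext_const c) S = (\<Sum>A\<in>Pow S. if A = S then ext_coeff f S * c else 0)"
    unfolding times_ext.rep_eq ext_const.rep_eq by (intro sum.cong) auto
  then show ?thesis using True by simp
qed (simp add: ext_coeff_infinite)

lemma ext_const_commute: "f * ext_const c = ext_const c * f"
  by (rule ext_eqI) (simp add: mult.commute)

lemma ext_const_mult: "ext_const (c * d) = ext_const c * ext_const d"
  and ext_const_add: "ext_const (c + d) = ext_const c + ext_const d"
  and ext_const_diff: "ext_const (c - d) = ext_const c - ext_const d"
  and ext_const_uminus: "ext_const (- c) = - ext_const c"
  and ext_const_0 [simp]: "ext_const 0 = 0" and ext_const_1 [simp]: "ext_const 1 = 1"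
  by (rule ext_eqI; simp add: ext_coeff_const one_ext.rep_eq)+

lemma ext_const_sum: "ext_const (sum f A) = (\<Sum>i\<in>A. ext_const (f i))"
  by (induction A rule: infinite_finite_induct) (simp_all add: ext_const_add)

text \<open>The sign picked up when \<open>x_i\<close> is moved from the front of a product past the
  smaller generators of \<open>S\<close> to its sorted place.\<close>

definition below_sign :: "nat \<Rightarrow> nat set \<Rightarrow> 'a::comm_ring_1" where
  "below_sign i S = (-1) ^ card {s \<in> S. s < i}"

lemma below_sign_square [simp]: "below_sign i S * below_sign i S = 1"
  by (simp add: below_sign_def flip: power_mult_distrib)

lemma below_sign_insert_self [simp]: "below_sign i (insert i S) = below_sign i S"
proof -
  have "{s \<in> insert i S. s < i} = {s \<in> S. s < i}" by auto
  then show ?thesis by (simp add: below_sign_def)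
qed

lemma below_sign_remove_self [simp]: "below_sign i (S - {i}) = below_sign i S"
proof -
  have "{s \<in> S - {i}. s < i} = {s \<in> S. s < i}" by auto
  then show ?thesis by (simp add: below_sign_def)
qed

lemma below_sign_insert:
  assumes "finite S" "i \<notin> S"
  shows "below_sign l (insert i S) = (if i < l then - below_sign l S else below_sign l S)"
proof (cases "i < l")
  case True
  then have "{s \<in> insert i S. s < l} = insert i {s \<in> S. s < l}" by auto
  then show ?thesis using assms True by (simp add: below_sign_def)
next
  case False
  then have "{s \<in> insert i S. s < l} = {s \<in> S. s < l}" by auto
  then show ?thesis using False by (simp add: below_sign_def)
qed

lemma ext_coeff_xgen_mult:
  "ext_coeff (xgen i * f) S = (if i \<in> S then below_sign i S * ext_coeff f (S - {i}) else 0)"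
proof (cases "finite S")
  case True
  have "ext_coeff (xgen i * f) S =
      (\<Sum>A\<in>Pow S. if A = {i} then shuffle_sign {i} (S - {i}) * ext_coeff f (S - {i}) else 0)"
    unfolding times_ext.rep_eq xgen.rep_eq by (intro sum.cong) auto
  also have "\<dots> = (if i \<in> S then shuffle_sign {i} (S - {i}) * ext_coeff f (S - {i}) else 0)"
    using True by simp
  also have "shuffle_sign {i} (S - {i}) = (below_sign i S :: 'a)"
  proof -
    have "{(a, b). a \<in> {i} \<and> b \<in> S - {i} \<and> b < a} = Pair i ` {s \<in> S. s < i}" by auto
    then show ?thesis by (simp add: shuffle_sign_def below_sign_def card_image inj_on_def)
  qed
  finally show ?thesis .
qed (simp add: ext_coeff_infinite)

subsection \<open>Contractions\<close>

text \<open>The antiderivation over the constants with \<open>x_i \<mapsto> u_i\<close> for \<open>i < N\<close>.\<close>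

lift_definition contr :: "nat \<Rightarrow> (nat \<Rightarrow> 'a) \<Rightarrow> 'a::comm_ring_1 ext \<Rightarrow> 'a ext" is
  "\<lambda>N u f S. \<Sum>i\<in>{..<N} - S. below_sign i S * u i * f (insert i S)"
proof -
  fix N u and f :: "nat set \<Rightarrow> 'a"
  assume "\<exists>n. \<forall>S. \<not> S \<subseteq> {..<n} \<longrightarrow> f S = 0"
  then obtain n where "\<And>S. \<not> S \<subseteq> {..<n} \<Longrightarrow> f S = 0" by blast
  then show "\<exists>n. \<forall>S. \<not> S \<subseteq> {..<n} \<longrightarrow> (\<Sum>i\<in>{..<N} - S. below_sign i S * u i * f (insert i S)) = 0"
    by (intro exI[of _ n] allI impI sum.neutral ballI) auto
qed

lemmas ext_coeff_contr = contr.rep_eq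

lemma contr_add: "contr N u (f + g) = contr N u f + contr N u g"
  and contr_diff: "contr N u (f - g) = contr N u f - contr N u g"
  and contr_uminus: "contr N u (- f) = - contr N u f"
  and contr_0 [simp]: "contr N u 0 = 0"
  by (rule ext_eqI; simp add: ext_coeff_contr algebra_simps sum.distrib sum_subtractf sum_negf)+

lemma contr_sum: "contr N u (sum f A) = (\<Sum>i\<in>A. contr N u (f i))"
  by (induction A rule: infinite_finite_induct) (simp_all add: contr_add)

lemma contr_const_mult: "contr N u (ext_const c * f) = ext_const c * contr N u f"
  by (rule ext_eqI) (simp add: ext_coeff_contr sum_distrib_left mult_ac)

lemma contr_const [simp]: "contr N u (ext_const c) = 0"
  by (rule ext_eqI) (simp add: ext_coeff_contr ext_coeff_const)

lemma contr_1 [simp]: "contr N u 1 = 0"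
  using contr_const[of N u 1] by simp

lemma contr_weight_sum:
  "contr N (\<lambda>i. \<Sum>m\<in>A. c m * u m i) f = (\<Sum>m\<in>A. ext_const (c m) * contr N (u m) f)"
proof (rule ext_eqI)
  fix S
  have "ext_coeff (contr N (\<lambda>i. \<Sum>m\<in>A. c m * u m i) f) S =
      (\<Sum>i\<in>{..<N} - S. \<Sum>m\<in>A. c m * (below_sign i S * u m i * ext_coeff f (insert i S)))"
    unfolding ext_coeff_contr by (simp add: sum_distrib_left sum_distrib_right mult_ac)
  also have "\<dots> = (\<Sum>m\<in>A. c m * ext_coeff (contr N (u m) f) S)"
    by (subst sum.swap) (simp add: ext_coeff_contr sum_distrib_left)
  finally show "ext_coeff (contr N (\<lambda>i. \<Sum>m\<in>A. c m * u m i) f) S =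
      ext_coeff (\<Sum>m\<in>A. ext_const (c m) * contr N (u m) f) S"
    by (simp add: ext_coeff_sum)
qed

text \<open>The terms that remove \<open>i\<close> and \<open>l\<close> in either order differ by a
  sign, since removing the smaller index changes the number of elements below the larger
  one.\<close>

lemma contr_anticommute: "contr N u (contr N v f) = - contr N v (contr N u f)"
proof (rule ext_eqI)
  fix S
  show "ext_coeff (contr N u (contr N v f)) S = ext_coeff (- contr N v (contr N u f)) S"
  proof (cases "finite S")
    case True
    define B where "B = {..<N} - S"
    define g where "g = (\<lambda>u v i l. if i = l then 0 else
      below_sign i S * below_sign l (insert i S) * u i * v l * ext_coeff f (insert l (insert i S)))"
    have *: "ext_coeff (contr N u (contr N v f)) S = (\<Sum>i\<in>B. \<Sum>l\<in>B. g u v i l)" for u v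
    proof -
      have "(\<Sum>l\<in>{..<N} - insert i S. below_sign l (insert i S) * v l * ext_coeff f (insert l (insert i S))) =
        (\<Sum>l\<in>B. if i = l then 0 else below_sign l (insert i S) * v l * ext_coeff f (insert l (insert i S)))"
        for i
        by (rule sum.mono_neutral_cong_left) (auto simp: B_def)
      then show ?thesis
        unfolding ext_coeff_contr B_def[symmetric]
        by (auto simp: sum_distrib_left g_def mult_ac intro!: sum.cong)
    qed
    have "g v u l i = - g u v i l" if "i \<in> B" "l \<in> B" for i l
    proof (cases "i = l")
      case False
      have "i \<notin> S" "l \<notin> S" using that by (auto simp: B_def)
      then show ?thesis using False
        by (auto simp: g_def below_sign_insert[OF True] insert_commute mult_ac)
    qed (simp add: g_def)
    then have "(\<Sum>l\<in>B. \<Sum>i\<in>B. g v u l i) = - (\<Sum>l\<in>B. \<Sum>i\<in>B. g u v i l)"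
      by (simp flip: sum_negf)
    then show ?thesis unfolding ext_coeff_uminus * using sum.swap[of "g u v" B B] by simp
  qed (simp add: ext_coeff_infinite)
qed

text \<open>Anticommutation with itself gives twice the square equal to zero; this is one of the
  places where \<open>p\<close> odd enters.\<close>

lemma contr_square:
  fixes f :: "'a::idom ext"
  assumes "(2 :: 'a) \<noteq> 0"
  shows "contr N u (contr N u f) = 0"
proof (rule ext_eqI)
  fix S
  have "ext_coeff (contr N u (contr N u f)) S = - ext_coeff (contr N u (contr N u f)) S"
    using contr_anticommute[of N u u f] by (metis ext_coeff_uminus)
  then have "2 * ext_coeff (contr N u (contr N u f)) S = 0" by (simp add: eq_neg_iff_add_eq_0)
  then show "ext_coeff (contr N u (contr N u f)) S = ext_coeff 0 S" using assms by simp
qed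

text \<open>The Leibniz rule of an antiderivation. If \<open>i\<close> is in \<open>S\<close>, the
  term that contracts the new factor cancels against the corresponding term on the right.\<close>

lemma contr_xgen_mult:
  assumes "i < N"
  shows "contr N u (xgen i * g) = ext_const (u i) * g - xgen i * contr N u g"
proof (rule ext_eqI)
  fix S
  show "ext_coeff (contr N u (xgen i * g)) S = ext_coeff (ext_const (u i) * g - xgen i * contr N u g) S"
  proof (cases "finite S")
    case fin: True
    have lhs: "ext_coeff (contr N u (xgen i * g)) S = (\<Sum>l\<in>{..<N} - S. below_sign l S * u l *
        (if i \<in> insert l S then below_sign i (insert l S) * ext_coeff g (insert l S - {i}) else 0))"
      by (simp add: ext_coeff_contr ext_coeff_xgen_mult)
    show ?thesis
    proof (cases "i \<in> S")
      case False
      have "ext_coeff (contr N u (xgen i * g)) S =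
          (\<Sum>l\<in>{..<N} - S. if l = i then u i * ext_coeff g S else 0)"
        unfolding lhs using False
        by (intro sum.cong) (auto simp: mult.assoc[symmetric] mult.commute[of _ "u i"], simp add: mult.assoc)
      then show ?thesis using False assms by (simp add: ext_coeff_xgen_mult)
    next
      case True
      define S' where "S' = S - {i}"
      have S': "S = insert i S'" "i \<notin> S'" "finite S'" using True fin by (auto simp: S'_def)
      have ins: "{..<N} - S' = insert i ({..<N} - S)" "i \<notin> {..<N} - S" "finite ({..<N} - S)"
        using assms True by (auto simp: S'_def)
      have "ext_coeff (xgen i * contr N u g) S =
          below_sign i S * (\<Sum>l\<in>{..<N} - S'. below_sign l S' * u l * ext_coeff g (insert l S'))"
        using True by (simp add: ext_coeff_xgen_mult ext_coeff_contr S'_def)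
      also have "\<dots> = u i * ext_coeff g S + (\<Sum>l\<in>{..<N} - S. below_sign i S' * below_sign l S' * u l * ext_coeff g (insert l S'))"
      proof -
        have "below_sign i S' * (below_sign i S' * u i * ext_coeff g S) = u i * ext_coeff g S"
          by (simp add: mult.assoc[symmetric])
        then show ?thesis
          unfolding ins(1) sum.insert[OF ins(3,2)] using S'(1)
          by (simp add: distrib_left sum_distrib_left mult.assoc)
      qed
      also have "(\<Sum>l\<in>{..<N} - S. below_sign i S' * below_sign l S' * u l * ext_coeff g (insert l S')) =
          - ext_coeff (contr N u (xgen i * g)) S"
        unfolding lhs sum_negf[symmetric]
      proof (rule sum.cong[OF refl])
        fix l assume l: "l \<in> {..<N} - S"
        then have "l \<noteq> i" "l \<notin> S'" using S' by auto
        moreover have "insert l S - {i} = insert l S'" using S' \<open>l \<noteq> i\<close> by auto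
        moreover have "below_sign i (insert l S) = (below_sign i (insert l S') :: 'a)"
          by (metis S'(1) below_sign_insert_self insert_commute)
        moreover have "below_sign l S = (if i < l then - below_sign l S' else below_sign l S' :: 'a)"
          unfolding S'(1) using S' by (simp add: below_sign_insert)
        ultimately show "below_sign i S' * below_sign l S' * u l * ext_coeff g (insert l S') =
          - (below_sign l S * u l * (if i \<in> insert l S then below_sign i (insert l S) * ext_coeff g (insert l S - {i}) else 0))"
          using True S' by (auto simp: below_sign_insert mult_ac)
      qed
      finally show ?thesis by simp
    qed
  qed (simp add: ext_coeff_infinite)
qed

lemma contr_lin_form_mult:
  assumes "m \<le> N"
  shows "contr N u ((\<Sum>r<m. ext_const (c r) * xgen r) * g) =
    ext_const (\<Sum>r<m. c r * u r) * g - (\<Sum>r<m. ext_const (c r) * xgen r) * contr N u g"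
proof -
  have "contr N u (ext_const (c r) * xgen r * g) = ext_const (c r * u r) * g - ext_const (c r) * xgen r * contr N u g"
    if "r < m" for r
    using that assms by (simp add: mult.assoc contr_const_mult contr_xgen_mult right_diff_distrib ext_const_mult)
  then show ?thesis
    by (simp add: sum_distrib_right contr_sum ext_const_sum sum_subtractf)
qed

definition set_prod :: "(nat \<Rightarrow> 'a::ring_1) \<Rightarrow> nat set \<Rightarrow> 'a" where
  "set_prod l S = (\<Prod>k\<leftarrow>sorted_list_of_set S. l k)"

lemma set_prod_empty [simp]: "set_prod l {} = 1"
  by (simp add: set_prod_def)

lemma set_prod_insert_min:
  assumes "finite A" "\<And>a. a \<in> A \<Longrightarrow> b < a"
  shows "set_prod l (insert b A) = l b * set_prod l A"
proof -
  have "b \<notin> A" using assms by blast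
  then have "sorted_list_of_set (insert b A) = insort b (sorted_list_of_set A)"
    using assms by (intro sorted_list_of_set_insert) auto
  also have "\<dots> = b # sorted_list_of_set A"
    using assms by (intro insort_is_Cons) (auto intro: less_imp_le)
  finally show ?thesis by (simp add: set_prod_def)
qed

text \<open>The factors need only obey the Leibniz rule, so the lemma covers the generators
  \<open>x_k\<close> as well as their images \<open>lin_x a k\<close> under a matrix.\<close>

lemma contr_set_prod:
  assumes "finite S" "\<And>k g. k \<in> S \<Longrightarrow> contr N u (l k * g) = ext_const (e k) * g - l k * contr N u g"
  shows "contr N u (set_prod l S) = (\<Sum>k\<in>S. ext_const (below_sign k S * e k) * set_prod l (S - {k}))"
  using assms
proof (induction S rule: finite_linorder_min_induct)
  case (insert b A)
  have b: "b \<notin> A" using insert by blast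
  have "contr N u (set_prod l (insert b A)) = ext_const (e b) * set_prod l A - l b * contr N u (set_prod l A)"
    using insert by (simp add: set_prod_insert_min)
  also have "contr N u (set_prod l A) = (\<Sum>k\<in>A. ext_const (below_sign k A * e k) * set_prod l (A - {k}))"
    using insert by simp
  also have "l b * \<dots> = - (\<Sum>k\<in>A. ext_const (below_sign k (insert b A) * e k) * set_prod l (insert b A - {k}))"
    unfolding sum_distrib_left sum_negf[symmetric]
  proof (rule sum.cong[OF refl])
    fix k assume k: "k \<in> A"
    then have kb: "b < k" using insert by blast
    have s: "insert b A - {k} = insert b (A - {k})" using kb by auto
    have "set_prod l (insert b (A - {k})) = l b * set_prod l (A - {k})"
      using insert by (intro set_prod_insert_min) auto
    then show "l b * (ext_const (below_sign k A * e k) * set_prod l (A - {k})) =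
        - (ext_const (below_sign k (insert b A) * e k) * set_prod l (insert b A - {k}))"
      using kb b insert.hyps(1) unfolding s
      by (simp add: below_sign_insert ext_const_uminus ext_const_commute[of "l b", symmetric] flip: mult.assoc)
  qed
  also have "ext_const (e b) * set_prod l A = ext_const (below_sign b (insert b A) * e b) * set_prod l (insert b A - {b})"
  proof -
    have "{s \<in> A. s < b} = {}" using insert by auto
    then have "below_sign b A = (1 :: 'a)" unfolding below_sign_def by (metis card.empty power_0)
    then show ?thesis using b by simp
  qed
  finally show ?case using b insert.hyps(1) by simp
qed simp

lemma ext_coeff_set_prod_xgen:
  assumes "finite T"
  shows "ext_coeff (set_prod xgen T) S = (if S = T then 1 else 0)"
  using assms
proof (induction T arbitrary: S rule: finite_linorder_min_induct)
  case empty
  then show ?case by (simp add: one_ext.rep_eq)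
next
  case (insert b A)
  have b: "b \<notin> A" using insert by blast
  have "{s \<in> insert b A. s < b} = {}" using insert by auto
  then have "below_sign b (insert b A) = (1 :: 'a)" unfolding below_sign_def by (metis card.empty power_0)
  moreover have "b \<in> S \<and> S - {b} = A \<longleftrightarrow> S = insert b A" using b by blast
  ultimately show ?case
    using insert by (auto simp: set_prod_insert_min ext_coeff_xgen_mult)
qed

lemma contr_set_prod_xgen:
  assumes "finite S" "S \<subseteq> {..<N}"
  shows "contr N u (set_prod xgen S) = (\<Sum>k\<in>S. ext_const (below_sign k S * u k) * set_prod xgen (S - {k}))"
  by (rule contr_set_prod) (use assms in \<open>auto intro!: contr_xgen_mult\<close>)

subsection \<open>Iterated contractions\<close>

definition contrs :: "nat \<Rightarrow> (nat \<Rightarrow> nat \<Rightarrow> 'a) \<Rightarrow> nat list \<Rightarrow> 'a::comm_ring_1 ext \<Rightarrow> 'a ext" where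
  "contrs N u js f = foldr (\<lambda>j. contr N (u j)) js f"

lemma contrs_Nil [simp]: "contrs N u [] f = f"
  and contrs_Cons [simp]: "contrs N u (j # js) f = contr N (u j) (contrs N u js f)"
  by (simp_all add: contrs_def)

lemma contrs_append: "contrs N u (js @ ks) f = contrs N u js (contrs N u ks f)"
  by (simp add: contrs_def)

lemma contrs_add: "contrs N u js (f + g) = contrs N u js f + contrs N u js g"
  and contrs_diff: "contrs N u js (f - g) = contrs N u js f - contrs N u js g"
  and contrs_uminus: "contrs N u js (- f) = - contrs N u js f"
  and contrs_const_mult: "contrs N u js (ext_const c * f) = ext_const c * contrs N u js f"
  and contrs_0 [simp]: "contrs N u js 0 = 0"
  by (induction js) (simp_all add: contr_add contr_diff contr_uminus contr_const_mult)

lemma contrs_sum: "contrs N u js (sum f A) = (\<Sum>i\<in>A. contrs N u js (f i))"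
  by (induction A rule: infinite_finite_induct) (simp_all add: contrs_add)

lemma contrs_remove1:
  assumes "j \<in> set js"
  shows "contrs N u js f = contr N (u j) (contrs N u (remove1 j js) f) \<or>
    contrs N u js f = - contr N (u j) (contrs N u (remove1 j js) f)"
  using assms
proof (induction js)
  case (Cons i js)
  then show ?case
    using contr_anticommute[of N "u i" "u j" "contrs N u (remove1 j js) f"]
    by (auto simp: contr_uminus)
qed simp

text \<open>The sign of the permutation is left open, as a sign can always be moved into a
  coefficient.\<close>

lemma contrs_perm:
  assumes "mset js = mset ks"
  shows "contrs N u js f = contrs N u ks f \<or> contrs N u js f = - contrs N u ks f"
  using assms
proof (induction js arbitrary: ks)
  case (Cons j js)
  then have "j \<in> set ks" by (metis list.set_intros(1) mset_eq_setD)
  moreover have "mset js = mset (remove1 j ks)" using Cons.prems by (metis mset_remove1 remove1.simps(2))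
  then have "contrs N u js f = contrs N u (remove1 j ks) f \<or> contrs N u js f = - contrs N u (remove1 j ks) f"
    by (rule Cons.IH)
  ultimately show ?case using contrs_remove1[of j ks N u f] by (auto simp: contr_uminus)
qed simp

lemma contrs_not_distinct:
  fixes f :: "'a::idom ext"
  assumes "(2 :: 'a) \<noteq> 0" "\<not> distinct js"
  shows "contrs N u js f = 0"
  using assms(2)
proof (induction js)
  case (Cons j js)
  show ?case
  proof (cases "j \<in> set js")
    case True
    then show ?thesis using contrs_remove1[OF True, of N u f] contr_square[OF assms(1)]
      by (auto simp: contr_uminus)
  next
    case False
    then show ?thesis using Cons by simp
  qed
qed simp

subsection \<open>Mui invariants as iterated contractions of the volume form\<close>

definition col_prod :: "(nat \<Rightarrow> 'a::monoid_mult) list \<Rightarrow> nat list \<Rightarrow> 'a" where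
  "col_prod cs ix = prod_list (map2 (\<lambda>f i. f i) cs ix)"

lemma col_prod_simps [simp]: "col_prod [] ix = 1" "col_prod (f # fs) (i # ix) = f i * col_prod fs ix"
  by (simp_all add: col_prod_def)

lemma col_prod_append: "length fs = length ix \<Longrightarrow> col_prod (fs @ gs) (ix @ js) = col_prod fs ix * col_prod gs js"
  by (simp add: col_prod_def)

text \<open>Columns form a list here, because the arguments insert a column and move it past
  others.\<close>

definition coldet :: "nat \<Rightarrow> (nat \<Rightarrow> 'a::ring_1) list \<Rightarrow> 'a" where
  "coldet n cs = (\<Sum>\<sigma> | \<sigma> permutes {..<n}. of_int (sign \<sigma>) * col_prod cs (map \<sigma> [0..<n]))"

lemma column_det_eq_coldet:
  assumes "length cs = n"
  shows "column_det n (\<lambda>i j. (cs ! j) i) = coldet n cs"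
proof -
  have "map (\<lambda>j. (cs ! j) (\<sigma> j)) [0..<n] = map2 (\<lambda>f i. f i) cs (map \<sigma> [0..<n])" for \<sigma> :: "nat \<Rightarrow> nat"
    by (rule nth_equalityI) (use assms in auto)
  then show ?thesis by (simp add: column_det_def coldet_def col_prod_def)
qed

text \<open>Commuting entries are essential: two columns of generators \<open>x_i\<close> have
  anticommuting entries, which is why repeated x-columns do not make the determinant vanish. In
  \<open>coldet_move\<close> one of the two columns consists of constants.\<close>

lemma coldet_swap:
  assumes n: "n = length ys + 2 + length bs" and comm: "\<And>i j. f i * g j = g j * f i"
  shows "coldet n (ys @ f # g # bs) = - coldet n (ys @ g # f # bs)"
proof -
  let ?a = "length ys"
  let ?t = "Transposition.transpose ?a (Suc ?a)"
  have t: "?t permutes {..<n}" using n by (intro permutes_swap_id) auto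
  have tt: "?t \<circ> ?t = id" by (simp add: fun_eq_iff)
  have upt: "[0..<n] = [0..<?a] @ [?a, Suc ?a] @ [Suc (Suc ?a)..<n]"
  proof -
    have "[0..<n] = [0..<?a] @ [?a..<n]" using upt_add_eq_append[of 0 ?a "n - ?a"] n by simp
    also have "[?a..<n] = ?a # Suc ?a # [Suc (Suc ?a)..<n]"
    proof -
      have "?a < n" "Suc ?a < n" using n by auto
      then show ?thesis by (simp add: upt_conv_Cons)
    qed
    finally show ?thesis by simp
  qed
  have tm: "col_prod (ys @ f # g # bs) (map (\<sigma> \<circ> ?t) [0..<n]) = col_prod (ys @ g # f # bs) (map \<sigma> [0..<n])" for \<sigma>
  proof -
    have 1: "map (\<sigma> \<circ> ?t) [0..<?a] = map \<sigma> [0..<?a]" "map (\<sigma> \<circ> ?t) [Suc (Suc ?a)..<n] = map \<sigma> [Suc (Suc ?a)..<n]"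
      by (auto simp: Transposition.transpose_def)
    have "map (\<sigma> \<circ> ?t) [0..<n] = map \<sigma> [0..<?a] @ [\<sigma> (Suc ?a), \<sigma> ?a] @ map \<sigma> [Suc (Suc ?a)..<n]"
      unfolding upt map_append 1 by simp
    moreover have "map \<sigma> [0..<n] = map \<sigma> [0..<?a] @ [\<sigma> ?a, \<sigma> (Suc ?a)] @ map \<sigma> [Suc (Suc ?a)..<n]"
      unfolding upt map_append by simp
    ultimately show ?thesis
      by (simp only: col_prod_append length_map length_upt diff_zero append_Cons append_Nil col_prod_simps
          comm[of "\<sigma> (Suc ?a)" "\<sigma> ?a"] flip: mult.assoc)
  qed
  have "coldet n (ys @ f # g # bs) =
      (\<Sum>\<sigma> | \<sigma> permutes {..<n}. of_int (sign (\<sigma> \<circ> ?t)) * col_prod (ys @ f # g # bs) (map (\<sigma> \<circ> ?t) [0..<n]))"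
    unfolding coldet_def
    by (rule sum.reindex_bij_witness[of _ "\<lambda>\<sigma>. \<sigma> \<circ> ?t" "\<lambda>\<sigma>. \<sigma> \<circ> ?t"])
      (use t tt in \<open>auto simp: comp_assoc intro: permutes_compose\<close>)
  also have "\<dots> = (\<Sum>\<sigma> | \<sigma> permutes {..<n}. - (of_int (sign \<sigma>) * col_prod (ys @ g # f # bs) (map \<sigma> [0..<n])))"
  proof (rule sum.cong[OF refl])
    fix \<sigma> assume "\<sigma> \<in> {\<sigma>. \<sigma> permutes {..<n}}"
    then have "permutation \<sigma>" using permutation_permutes by blast
    then have "sign (\<sigma> \<circ> ?t) = - sign \<sigma>"
      by (simp add: sign_compose permutation_swap_id sign_swap_id)
    then show "of_int (sign (\<sigma> \<circ> ?t)) * col_prod (ys @ f # g # bs) (map (\<sigma> \<circ> ?t) [0..<n]) =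
      - (of_int (sign \<sigma>) * col_prod (ys @ g # f # bs) (map \<sigma> [0..<n]))"
      unfolding tm by simp
  qed
  finally show ?thesis by (simp add: coldet_def sum_negf)
qed

lemma coldet_move:
  assumes "n = length ys + Suc m + length bs" and comm: "\<And>i j. f i * g j = g j * f i"
  shows "coldet n (ys @ f # replicate m g @ bs) = (-1) ^ m * coldet n (ys @ replicate m g @ f # bs)"
  using assms(1)
proof (induction m arbitrary: ys)
  case (Suc m)
  have "coldet n (ys @ f # replicate (Suc m) g @ bs) = - coldet n ((ys @ [g]) @ f # replicate m g @ bs)"
    using coldet_swap[of n ys "replicate m g @ bs" f g] Suc.prems comm by simp
  also have "coldet n ((ys @ [g]) @ f # replicate m g @ bs) = (-1) ^ m * coldet n ((ys @ [g]) @ replicate m g @ f # bs)"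
    by (rule Suc.IH) (use Suc.prems in simp)
  finally show ?case by simp
qed simp

definition const_col :: "(nat \<Rightarrow> 'a::comm_ring_1) \<Rightarrow> nat \<Rightarrow> 'a ext" where
  "const_col u i = ext_const (u i)"

text \<open>The Leibniz rule along the x-columns: the \<open>i\<close>-th term replaces one
  generator by its image, after \<open>i\<close> sign changes. The columns of constants contribute
  nothing.\<close>

lemma contr_col_prod:
  assumes "length ix = k + length us" "set ix \<subseteq> {..<N}"
  shows "contr N u (col_prod (replicate k xgen @ map const_col us) ix) =
    (\<Sum>i<k. (-1) ^ i * col_prod (replicate i xgen @ const_col u # replicate (k - Suc i) xgen @ map const_col us) ix)"
  using assms
proof (induction k arbitrary: ix)
  case 0
  have "\<exists>c. col_prod (map const_col us) ix = ext_const c"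
    if "length ix = length us" for ix
    using that
  proof (induction us arbitrary: ix)
    case Nil
    then show ?case using ext_const_1 by (metis col_prod_simps(1) list.simps(8))
  next
    case (Cons v us)
    then obtain i ix' where ix': "ix = i # ix'" "length ix' = length us" by (cases ix) auto
    then obtain c where "col_prod (map const_col us) ix' = ext_const c" using Cons.IH by blast
    then have "col_prod (map const_col (v # us)) ix = ext_const (v i * c)"
      using ix' by (simp add: const_col_def[of v] ext_const_mult)
    then show ?case by blast
  qed
  from this[of ix] 0 obtain c where "col_prod (map const_col us) ix = ext_const c" by auto
  then show ?case by simp
next
  case (Suc k)
  then obtain i0 ix' where ix': "ix = i0 # ix'" "length ix' = k + length us" "set ix' \<subseteq> {..<N}" "i0 < N"
    by (cases ix) auto
  have "contr N u (col_prod (replicate (Suc k) xgen @ map const_col us) ix) =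
      ext_const (u i0) * col_prod (replicate k xgen @ map const_col us) ix' -
      xgen i0 * contr N u (col_prod (replicate k xgen @ map const_col us) ix')"
    using ix' by (simp add: contr_xgen_mult)
  also have "\<dots> = (-1) ^ 0 * col_prod (replicate 0 xgen @ const_col u # replicate (Suc k - Suc 0) xgen @ map const_col us) ix +
    (\<Sum>i<k. (-1) ^ Suc i * col_prod (replicate (Suc i) xgen @ const_col u # replicate (Suc k - Suc (Suc i)) xgen @ map const_col us) ix)"
  proof -
    have sgn: "x * ((-1) ^ i * y) = (-1) ^ i * (x * (y :: 'a ext))" for x y and i :: nat
      by (cases "even i") simp_all
    show ?thesis
      unfolding Suc.IH[OF ix'(2,3)] ix'(1)
      by (simp add: const_col_def sum_distrib_left sgn sum_negf)
  qed
  also have "\<dots> = (\<Sum>i<Suc k. (-1) ^ i * col_prod (replicate i xgen @ const_col u # replicate (Suc k - Suc i) xgen @ map const_col us) ix)"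
    by (rule sum.lessThan_Suc_shift[symmetric])
  finally show ?case .
qed

lemma contr_of_int_mult: "contr N u (of_int c * f) = of_int c * contr N u f"
proof -
  have "of_int c = (ext_const (of_int c) :: 'a ext)"
    by (induction c rule: int_induct[where k = 0]) (simp_all add: ext_const_add ext_const_diff)
  then show ?thesis by (simp add: contr_const_mult)
qed

text \<open>The \<open>k + 1\<close> terms of the Leibniz rule become equal once the new column is
  moved behind the x-columns: the signs \<open>(-1)^i\<close> and \<open>(-1)^(k-i)\<close> combine
  to \<open>(-1)^k\<close>. The factor \<open>k + 1\<close> is the quotient of the factorials in the
  normalisation of \<open>M_T\<close>.\<close>

lemma contr_coldet:
  assumes "n = Suc k + length us"
  shows "contr n u (coldet n (replicate (Suc k) xgen @ map const_col us)) =
    (-1) ^ k * (of_nat (Suc k) * coldet n (replicate k xgen @ map const_col (u # us)))"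
proof -
  have "contr n u (coldet n (replicate (Suc k) xgen @ map const_col us)) =
      (\<Sum>\<sigma> | \<sigma> permutes {..<n}. of_int (sign \<sigma>) *
        (\<Sum>i<Suc k. (-1) ^ i * col_prod (replicate i xgen @ const_col u # replicate (Suc k - Suc i) xgen @ map const_col us) (map \<sigma> [0..<n])))"
    unfolding coldet_def contr_sum
  proof (rule sum.cong[OF refl], unfold contr_of_int_mult, subst contr_col_prod)
    fix \<sigma> assume "\<sigma> \<in> {\<sigma>. \<sigma> permutes {..<n}}"
    then show "set (map \<sigma> [0..<n]) \<subseteq> {..<n}" using permutes_in_image by fastforce
  qed (use assms in auto)
  also have "\<dots> = (\<Sum>i<Suc k. (-1) ^ i * coldet n (replicate i xgen @ const_col u # replicate (Suc k - Suc i) xgen @ map const_col us))"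
  proof -
    have sgn: "x * ((-1) ^ i * y) = (-1) ^ i * (x * (y :: 'a ext))" for x y and i :: nat
      by (cases "even i") simp_all
    show ?thesis
      unfolding coldet_def sum_distrib_left by (subst sum.swap) (simp only: sgn)
  qed
  also have "\<dots> = (\<Sum>i<Suc k. (-1) ^ k * coldet n (replicate k xgen @ map const_col (u # us)))"
  proof (rule sum.cong[OF refl])
    fix i assume i: "i \<in> {..<Suc k}"
    have "coldet n (replicate i xgen @ const_col u # replicate (k - i) xgen @ map const_col us) =
      (-1) ^ (k - i) * coldet n (replicate i xgen @ replicate (k - i) xgen @ const_col u # map const_col us)"
      by (rule coldet_move) (use assms i in \<open>auto simp: const_col_def ext_const_commute\<close>)
    moreover have "replicate i xgen @ replicate (k - i) xgen @ ws = replicate k (xgen :: nat \<Rightarrow> 'a ext) @ ws" for ws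
      using i by (simp flip: replicate_add append_assoc)
    moreover have "(-1) ^ i * ((-1) ^ (k - i) * y) = (-1) ^ k * (y :: 'a ext)" for y
      using i by (simp flip: power_add mult.assoc)
    ultimately show "(-1) ^ i * coldet n (replicate i xgen @ const_col u # replicate (Suc k - Suc i) xgen @ map const_col us) =
      (-1) ^ k * coldet n (replicate k xgen @ map const_col (u # us))"
      by simp
  qed
  also have "\<dots> = (-1) ^ k * (of_nat (Suc k) * coldet n (replicate k xgen @ map const_col (u # us)))"
    by (simp only: sum_constant card_lessThan) (simp only: mult.assoc[symmetric] mult_of_nat_commute[of "Suc k" "(-1) ^ k"])
  finally show ?thesis .
qed

text \<open>The sign of a permutation in the determinant cancels against the sign of reordering the
  anticommuting generators, so all \<open>n!\<close> terms agree.\<close>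

lemma coldet_volume: "coldet n (replicate n xgen) = (of_nat (fact n) * set_prod xgen {..<n} :: 'a::comm_ring_1 ext)"
proof -
  have sl: "sorted_list_of_set {..<n} = [0..<n]" by (simp add: lessThan_atLeast0)
  have cp: "col_prod (replicate n xgen) (map \<sigma> [0..<n]) = (\<Prod>j\<leftarrow>[0..<n]. xgen (\<sigma> j) :: 'a ext)" for \<sigma>
  proof -
    have "map2 (\<lambda>f i. f i) (replicate n xgen) (map \<sigma> [0..<n]) = map (\<lambda>j. xgen (\<sigma> j) :: 'a ext) [0..<n]"
      by (rule nth_equalityI) auto
    then show ?thesis unfolding col_prod_def by (rule arg_cong)
  qed
  have "coldet n (replicate n xgen) =
      (\<Sum>\<sigma> | \<sigma> permutes {..<n}. of_int (sign \<sigma>) * (of_int (sign \<sigma>) * set_prod xgen {..<n} :: 'a ext))"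
    unfolding coldet_def
  proof (intro sum.cong refl)
    fix \<sigma> assume "\<sigma> \<in> {\<sigma>. \<sigma> permutes {..<n}}"
    then have "(\<Prod>j\<leftarrow>[0..<n]. xgen ((id \<circ> \<sigma>) j)) = (of_int (sign \<sigma>) * (\<Prod>j\<leftarrow>[0..<n]. xgen (id j)) :: 'a ext)"
      by (intro prod_xgen_permutes) simp
    then have "(\<Prod>j\<leftarrow>[0..<n]. xgen (\<sigma> j)) = (of_int (sign \<sigma>) * set_prod xgen {..<n} :: 'a ext)"
      unfolding set_prod_def sl by simp
    then show "of_int (sign \<sigma>) * col_prod (replicate n xgen) (map \<sigma> [0..<n]) =
        (of_int (sign \<sigma>) * (of_int (sign \<sigma>) * set_prod xgen {..<n}) :: 'a ext)"
      unfolding cp by simp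
  qed
  also have "\<dots> = (\<Sum>\<sigma> | \<sigma> permutes {..<n}. set_prod xgen {..<n})"
    by (rule sum.cong) (auto simp: sign_def)
  finally show ?thesis by (simp add: card_permutations)
qed

lemma ext_of_nat_mult_cancel:
  fixes f g :: "'a::{idom,ring_char_0} ext"
  assumes "of_nat k * f = of_nat k * g" "k \<noteq> 0"
  shows "f = g"
proof (rule ext_eqI)
  fix S
  have "of_nat k * ext_coeff f S = of_nat k * ext_coeff g S"
    using assms(1) by (metis ext_coeff_of_nat_mult)
  then show "ext_coeff f S = ext_coeff g S" using assms(2) by simp
qed

text \<open>Every contraction turns one x-column into a column of constants, and the factor from
  \<open>contr_coldet\<close> is cancelled on the spot. This needs characteristic zero, hence the
  sort.\<close>

lemma foldr_contr_volume:
  fixes us :: "(nat \<Rightarrow> 'a::{idom,ring_char_0}) list"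
  assumes "n = k + length us"
  shows "of_nat (fact k) * foldr (contr n) us (set_prod xgen {..<n}) = coldet n (replicate k xgen @ map const_col us) \<or>
    of_nat (fact k) * foldr (contr n) us (set_prod xgen {..<n}) = - coldet n (replicate k xgen @ map const_col us)"
  using assms
proof (induction us arbitrary: k)
  case Nil
  then show ?case by (simp add: coldet_volume)
next
  case (Cons u us)
  let ?X = "foldr (contr n) us (set_prod xgen {..<n})"
  let ?d = "coldet n (replicate k xgen @ map const_col (u # us))"
  have n: "n = Suc k + length us" using Cons.prems by simp
  have c: "contr n u (of_nat m * f) = of_nat m * contr n u f" for m f
    using contr_of_int_mult[of n u "int m" f] by simp
  have sgn: "(-1) ^ k * y = y \<or> (-1) ^ k * y = - y" for y :: "'a ext" by (cases "even k") auto
  have "contr n u (of_nat (fact (Suc k)) * ?X) = of_nat (Suc k) * ?d \<or>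
    contr n u (of_nat (fact (Suc k)) * ?X) = - (of_nat (Suc k) * ?d)"
    using Cons.IH[OF n] contr_coldet[OF n, of u] sgn[of "of_nat (Suc k) * ?d"]
    by (auto simp only: contr_uminus minus_minus)
  then have "of_nat (Suc k) * (of_nat (fact k) * contr n u ?X) = of_nat (Suc k) * ?d \<or>
    of_nat (Suc k) * (of_nat (fact k) * contr n u ?X) = of_nat (Suc k) * - ?d"
    by (simp only: c fact_Suc of_nat_mult of_nat_id mult.assoc mult_minus_right)
  then have "of_nat (fact k) * contr n u ?X = ?d \<or> of_nat (fact k) * contr n u ?X = - ?d"
    using ext_of_nat_mult_cancel[of "Suc k" "of_nat (fact k) * contr n u ?X"] by blast
  then show ?case by simp
qed

text \<open>Cancelling the factorial over the integers removes the division from the definition; the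
  right hand side can then be reduced modulo \<open>p\<close>.\<close>

lemma mui_M_int_eq_contr:
  assumes "T \<subseteq> {..<n}"
  shows "mui_M_int p n T = contrs n (\<lambda>j i. ygen i ^ (p ^ j)) (sorted_list_of_set ({..<n} - T)) (set_prod xgen {..<n}) \<or>
    mui_M_int p n T = - contrs n (\<lambda>j i. ygen i ^ (p ^ j)) (sorted_list_of_set ({..<n} - T)) (set_prod xgen {..<n})"
proof -
  define us where "us = map (\<lambda>j i. (ygen i :: int mpoly) ^ (p ^ j)) (sorted_list_of_set ({..<n} - T))"
  have fin: "finite T" using assms finite_subset by blast
  have "length us = n - card T" unfolding us_def using assms fin by (simp add: card_Diff_subset)
  moreover have "card T \<le> n" using card_mono[OF finite_lessThan assms] by simp
  ultimately have n: "n = card T + length us" by simp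
  have cs: "mui_columns p n T = replicate (card T) xgen @ map const_col us"
    by (simp add: mui_columns_def us_def const_col_def[abs_def] comp_def)
  have "mui_det p n T = coldet n (mui_columns p n T)"
    unfolding mui_det_def by (rule column_det_eq_coldet) (unfold cs, use n in simp)
  then have d: "of_nat (fact (card T)) * mui_M_int p n T = coldet n (replicate (card T) xgen @ map const_col us)"
    using mui_M_int_eq[OF assms, of p] cs by simp
  have f: "foldr (contr n) us (set_prod xgen {..<n}) =
    contrs n (\<lambda>j i. ygen i ^ (p ^ j)) (sorted_list_of_set ({..<n} - T)) (set_prod xgen {..<n})"
    by (simp add: us_def contrs_def foldr_map comp_def)
  let ?X = "foldr (contr n) us (set_prod xgen {..<n})"
  have "of_nat (fact (card T)) * mui_M_int p n T = of_nat (fact (card T)) * ?X \<or>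
    of_nat (fact (card T)) * mui_M_int p n T = of_nat (fact (card T)) * - ?X"
    using foldr_contr_volume[OF n] unfolding d by (auto simp only: mult_minus_right minus_minus)
  then have "mui_M_int p n T = ?X \<or> mui_M_int p n T = - ?X"
    using ext_of_nat_mult_cancel[of "fact (card T)" "mui_M_int p n T"] fact_nonzero[where 'a = nat] by blast
  then show ?thesis unfolding f .
qed

subsection \<open>Reduction modulo p\<close>

definition mod_red :: "int mpoly \<Rightarrow> 'a::comm_ring_1 mpoly" where
  "mod_red = Poly_Mapping.map of_int"

lemma lookup_mod_red: "Poly_Mapping.lookup (mod_red f) m = of_int (Poly_Mapping.lookup f m)"
  by (simp add: mod_red_def map.rep_eq when_def)

lemma mod_red_add: "mod_red (f + g) = mod_red f + mod_red g"
  and mod_red_uminus: "mod_red (- f) = - mod_red f"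
  and mod_red_0 [simp]: "mod_red 0 = 0"
  by (rule poly_mapping_eqI; simp add: lookup_mod_red lookup_add)+

lemma mod_red_sum: "mod_red (sum f A) = (\<Sum>i\<in>A. mod_red (f i))"
  by (induction A rule: infinite_finite_induct) (simp_all add: mod_red_add)

lemma mod_red_single: "mod_red (Poly_Mapping.single m c) = Poly_Mapping.single m (of_int c)"
  by (rule poly_mapping_eqI) (simp add: lookup_mod_red lookup_single when_def)

lemma mod_red_mult: "mod_red (f * g) = mod_red f * mod_red g"
proof -
  let ?s = "\<lambda>f. (\<Sum>m\<in>Poly_Mapping.keys f. Poly_Mapping.single m (Poly_Mapping.lookup f m))"
  have "mod_red (?s f * ?s g) = mod_red (?s f) * mod_red (?s g)"
    by (simp add: sum_product mod_red_sum mult_single mod_red_single)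
  then show ?thesis using mpoly_sum_single[of f] mpoly_sum_single[of g] by simp
qed

lemma mod_red_1 [simp]: "mod_red 1 = 1"
  by (metis mod_red_single of_int_1 single_one)

lemma mod_red_power: "mod_red (f ^ k) = mod_red f ^ k"
  by (induction k) (simp_all add: mod_red_mult)

lemma mod_red_ygen: "mod_red (ygen i) = ygen i"
  by (simp add: ygen_def mod_red_single)

lemma ext_coeff_map_mod_red: "ext_coeff (ext_map mod_red f) S = mod_red (ext_coeff f S)"
  by (simp add: ext_map.rep_eq)

lemma mod_red_below_sign: "mod_red (below_sign i S) = below_sign i S"
  by (simp add: below_sign_def mod_red_power mod_red_uminus)

lemma ext_map_contr: "ext_map mod_red (contr N u f) = contr N (\<lambda>i. mod_red (u i)) (ext_map mod_red f)"
  by (rule ext_eqI)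
    (simp add: ext_coeff_map_mod_red ext_coeff_contr mod_red_sum mod_red_mult mod_red_below_sign)

lemma ext_map_contrs: "ext_map mod_red (contrs N u js f) = contrs N (\<lambda>j i. mod_red (u j i)) js (ext_map mod_red f)"
  by (induction js) (simp_all add: ext_map_contr)

text \<open>The single contractions are Milnor's primitive operations \<open>Q_j\<close>, which
  vanish on the \<open>y_i\<close> and send \<open>x_i\<close> to \<open>y_i^(p^j)\<close>. The last
  entry of the list acts first.\<close>

definition milnor :: "nat \<Rightarrow> nat list \<Rightarrow> 'p::prime_card mod_ring mpoly ext \<Rightarrow> 'p mod_ring mpoly ext" where
  "milnor n = contrs n (\<lambda>j i. ygen i ^ (CARD('p) ^ j))"

lemma mui_M_eq_milnor:
  assumes "T \<subseteq> {..<n}"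
  shows "(mui_M n T :: 'p::prime_card mod_ring mpoly ext) = milnor n (sorted_list_of_set ({..<n} - T)) (set_prod xgen {..<n}) \<or>
    (mui_M n T :: 'p mod_ring mpoly ext) = - milnor n (sorted_list_of_set ({..<n} - T)) (set_prod xgen {..<n})"
proof -
  have v: "ext_map mod_red (set_prod xgen {..<n}) = (set_prod xgen {..<n} :: 'p mod_ring mpoly ext)"
    by (rule ext_eqI) (simp add: ext_coeff_map_mod_red ext_coeff_set_prod_xgen)
  have m: "ext_map mod_red (- f) = - ext_map mod_red f" for f
    by (rule ext_eqI) (simp add: ext_coeff_map_mod_red mod_red_uminus)
  have "mui_M n T = (ext_map mod_red (mui_M_int CARD('p) n T) :: 'p mod_ring mpoly ext)"
    by (simp add: mui_M_def mod_red_def)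
  then show ?thesis
    using mui_M_int_eq_contr[OF assms, of "CARD('p)"]
    by (auto simp: ext_map_contrs v m mod_red_power mod_red_ygen milnor_def)
qed

section \<open>The action on the cohomology algebra and the duality between contractions and
  \<open>M_T\<close>\<close>

subsection \<open>The algebra of n variables\<close>

lemma cohom_iff:
  "f \<in> cohom n \<longleftrightarrow> (\<forall>S. (ext_coeff f S \<noteq> 0 \<longrightarrow> S \<subseteq> {..<n}) \<and> ext_coeff f S \<in> vpoly {..<n})"
  by (auto simp: cohom_def poly_ring_eq_vpoly) (metis vpoly_0)

lemma cohom_add: "f \<in> cohom n \<Longrightarrow> g \<in> cohom n \<Longrightarrow> f + g \<in> cohom n"
  unfolding cohom_iff by (metis add_0 ext_coeff_add vpoly_add)

lemma cohom_uminus: "f \<in> cohom n \<Longrightarrow> - f \<in> cohom n"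
  by (simp add: cohom_iff vpoly_uminus)

lemma cohom_diff: "f \<in> cohom n \<Longrightarrow> g \<in> cohom n \<Longrightarrow> f - g \<in> cohom n"
  using cohom_add[of f n "- g"] cohom_uminus[of g n] by simp

lemma cohom_const: "c \<in> vpoly {..<n} \<Longrightarrow> ext_const c \<in> cohom n"
  by (auto simp: cohom_iff ext_coeff_const)

lemma cohom_0: "0 \<in> cohom n"
  by (simp add: cohom_iff)

lemma cohom_const_mult: "c \<in> vpoly {..<n} \<Longrightarrow> f \<in> cohom n \<Longrightarrow> ext_const c * f \<in> cohom n"
  unfolding cohom_iff by (metis ext_coeff_const_mult mult_zero_right vpoly_mult)

lemma cohom_sum: "(\<And>i. i \<in> A \<Longrightarrow> f i \<in> cohom n) \<Longrightarrow> sum f A \<in> cohom n"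
  by (induction A rule: infinite_finite_induct) (simp_all add: cohom_add cohom_0)

lemma cohom_set_prod_xgen: "S \<subseteq> {..<n} \<Longrightarrow> set_prod xgen S \<in> cohom n"
  using finite_subset[of S "{..<n}"] by (auto simp: cohom_iff ext_coeff_set_prod_xgen)

lemma below_sign_vpoly: "below_sign i S \<in> vpoly A"
  unfolding below_sign_def by (intro vpoly_power vpoly_uminus vpoly_1)

lemma cohom_contr:
  assumes "\<And>i. i < n \<Longrightarrow> u i \<in> vpoly {..<n}" "f \<in> cohom n"
  shows "contr n u f \<in> cohom n"
  unfolding cohom_iff
proof (intro allI conjI impI)
  fix S
  show "ext_coeff (contr n u f) S \<in> vpoly {..<n}"
    unfolding ext_coeff_contr
    by (intro vpoly_sum vpoly_mult below_sign_vpoly) (use assms in \<open>auto simp: cohom_iff\<close>)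
  assume "ext_coeff (contr n u f) S \<noteq> 0"
  then obtain i where "below_sign i S * u i * ext_coeff f (insert i S) \<noteq> 0"
    unfolding ext_coeff_contr by (rule sum.not_neutral_contains_not_neutral)
  then have "ext_coeff f (insert i S) \<noteq> 0" by auto
  then show "S \<subseteq> {..<n}" using assms(2) by (auto simp: cohom_iff)
qed

lemma cohom_milnor: "f \<in> cohom n \<Longrightarrow> milnor n js f \<in> cohom n"
  unfolding milnor_def by (induction js) (auto intro!: cohom_contr vpoly_power vpoly_ygen)

definition lin_x :: "'a::comm_ring_1 mat \<Rightarrow> nat \<Rightarrow> 'a mpoly ext" where
  "lin_x a k = (\<Sum>i<dim_row a. ext_const (mconst (a $$ (i, k))) * xgen i)"

lemma poly_act_0 [simp]: "poly_act a 0 = 0"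
  by (simp add: poly_act_def)

text \<open>Replaces the support of \<open>f\<close> by an index set independent of
  \<open>f\<close>, so that additivity can be seen termwise.\<close>

lemma ext_act_eq_sum:
  assumes "f \<in> cohom n"
  shows "ext_act a f = (\<Sum>S\<in>Pow {..<n}. ext_const (poly_act a (ext_coeff f S)) * set_prod (lin_x a) S)"
  unfolding ext_act_def set_prod_def lin_x_def
  by (rule sum.mono_neutral_left) (use assms in \<open>auto simp: cohom_iff\<close>)

lemma ext_act_add:
  assumes "f \<in> cohom n" "g \<in> cohom n"
  shows "ext_act a (f + g) = ext_act a f + ext_act a g"
  unfolding ext_act_eq_sum[OF assms(1)] ext_act_eq_sum[OF assms(2)] ext_act_eq_sum[OF cohom_add[OF assms]]
  by (simp add: poly_act_def msubst_add ext_const_add distrib_right sum.distrib)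

lemma ext_act_const_mult:
  assumes "f \<in> cohom n" "c \<in> vpoly {..<n}"
  shows "ext_act a (ext_const c * f) = ext_const (poly_act a c) * ext_act a f"
  unfolding ext_act_eq_sum[OF assms(1)] ext_act_eq_sum[OF cohom_const_mult[OF assms(2,1)]]
  by (simp add: poly_act_def msubst_mult ext_const_mult sum_distrib_left mult.assoc)

lemma ext_act_uminus:
  assumes "f \<in> cohom n" shows "ext_act a (- f) = - ext_act a f"
  unfolding ext_act_eq_sum[OF assms] ext_act_eq_sum[OF cohom_uminus[OF assms]]
  by (simp add: poly_act_def msubst_uminus ext_const_uminus sum_negf)

lemma ext_act_0 [simp]: "ext_act a 0 = 0"
  by (simp add: ext_act_eq_sum[OF cohom_0[of 0]])

lemma ext_act_const:
  assumes "c \<in> vpoly {..<n}" shows "ext_act a (ext_const c) = ext_const (poly_act a c)"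
proof -
  have "ext_act a (ext_const c) = (\<Sum>S\<in>Pow {..<n}. if S = {} then ext_const (poly_act a c) else 0)"
    unfolding ext_act_eq_sum[OF cohom_const[OF assms]] by (intro sum.cong) (auto simp: ext_coeff_const)
  then show ?thesis by simp
qed

text \<open>Frobenius powers are additive and fix the matrix entries, so \<open>y_k^(p^j)\<close>
  transforms by the same matrix as \<open>x_k\<close>. Contracting \<open>lin_x a k\<close>
  therefore gives the image of \<open>y_k^(p^j)\<close>, and the Leibniz rule does the rest.\<close>

lemma contr_ext_act:
  fixes f :: "'p::prime_card mod_ring mpoly ext"
  assumes a: "a \<in> carrier_mat n n" and f: "f \<in> cohom n"
  shows "contr n (\<lambda>i. ygen i ^ (CARD('p) ^ j)) (ext_act a f) =
    ext_act a (contr n (\<lambda>i. ygen i ^ (CARD('p) ^ j)) f)"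
proof -
  define u where "u = (\<lambda>i. ygen i ^ (CARD('p) ^ j) :: 'p mod_ring mpoly)"
  define e where "e = (\<lambda>k. poly_act a (u k))"
  define t where "t = (\<lambda>S k. ext_const (below_sign k S * e k * poly_act a (ext_coeff f S)) * set_prod (lin_x a) (S - {k}))"
  have e: "e k = (\<Sum>r<n. mconst (a $$ (r, k)) * u r)" for k
    using a by (simp add: e_def u_def poly_act_eq lin_sub_def msubst_power frob_sum power_mult_distrib)
  have sp: "contr n u (set_prod (lin_x a) S) = (\<Sum>k\<in>S. ext_const (below_sign k S * e k) * set_prod (lin_x a) (S - {k}))"
    if "S \<in> Pow {..<n}" for S
  proof (rule contr_set_prod)
    show "finite S" using that finite_subset by auto
    show "contr n u (lin_x a k * g) = ext_const (e k) * g - lin_x a k * contr n u g" for k g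
      using contr_lin_form_mult[of n n u "\<lambda>r. mconst (a $$ (r, k))" g] a by (simp add: lin_x_def e)
  qed
  have "contr n u (ext_act a f) = (\<Sum>S\<in>Pow {..<n}. \<Sum>k\<in>S. t S k)"
  proof -
    have cc: "ext_const A * (ext_const B * P) = ext_const (B * A) * P"
      for A B :: "'p mod_ring mpoly" and P
      by (simp only: mult.commute[of B A] ext_const_mult mult.assoc)
    show ?thesis
      unfolding ext_act_eq_sum[OF f] contr_sum contr_const_mult t_def
      by (rule sum.cong[OF refl]) (simp only: sp sum_distrib_left cc)
  qed
  also have "\<dots> = (\<Sum>(S, k)\<in>Sigma (Pow {..<n}) (\<lambda>S. S). t S k)"
    by (rule sum.Sigma) (auto intro: finite_subset)
  \<comment> \<open>Pairs are relabelled by the set that remains after the contraction, which is how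
    the coefficients of \<open>contr n u f\<close> are indexed.\<close>
  also have "\<dots> = (\<Sum>(S, k)\<in>Sigma (Pow {..<n}) (\<lambda>S. {..<n} - S). t (insert k S) k)"
    by (rule sum.reindex_bij_witness[of _ "\<lambda>(S, k). (insert k S, k)" "\<lambda>(S, k). (S - {k}, k)"])
      (auto simp: insert_absorb)
  also have "\<dots> = (\<Sum>S\<in>Pow {..<n}. \<Sum>k\<in>{..<n} - S. t (insert k S) k)"
    by (rule sum.Sigma[symmetric]) auto
  also have "\<dots> = ext_act a (contr n u f)"
  proof -
    have c: "contr n u f \<in> cohom n"
      by (rule cohom_contr[OF _ f]) (auto simp: u_def intro!: vpoly_power vpoly_ygen)
    have bs: "poly_act a (below_sign k S) = below_sign k S" for k S
      by (simp add: poly_act_def below_sign_def msubst_power msubst_uminus)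
    have "poly_act a (ext_coeff (contr n u f) S) =
        (\<Sum>k\<in>{..<n} - S. below_sign k S * e k * poly_act a (ext_coeff f (insert k S)))" for S
      using bs by (simp add: ext_coeff_contr poly_act_eq msubst_sum msubst_mult e_def)
    moreover have "insert k S - {k} = S" if "k \<in> {..<n} - S" for k and S :: "nat set" using that by auto
    ultimately show ?thesis
      unfolding ext_act_eq_sum[OF c] t_def
      by (intro sum.cong refl) (simp add: ext_const_sum sum_distrib_right)
  qed
  finally show ?thesis by (simp add: u_def)
qed

lemma milnor_ext_act:
  assumes "a \<in> carrier_mat n n" "f \<in> cohom n"
  shows "milnor n js (ext_act a f) = ext_act a (milnor n js f)"
proof (induction js)
  case (Cons j js)
  have "milnor n js f \<in> cohom n" using assms(2) by (rule cohom_milnor)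
  then show ?case using Cons contr_ext_act[OF assms(1)] by (simp add: milnor_def)
qed (simp add: milnor_def)

lemma ext_coeff_lin_x_mult:
  "ext_coeff (lin_x a k * g) S = (\<Sum>i<dim_row a. if i \<in> S then mconst (a $$ (i, k)) * (below_sign i S * ext_coeff g (S - {i})) else 0)"
  unfolding lin_x_def sum_distrib_right ext_coeff_sum
  by (intro sum.cong refl) (simp add: mult.assoc ext_coeff_xgen_mult)

text \<open>A nonempty product of the forms \<open>lin_x a k\<close> has no constant term, so only
  the constant term of \<open>f\<close> contributes.\<close>

lemma ext_coeff_ext_act_empty:
  assumes "f \<in> cohom n"
  shows "ext_coeff (ext_act a f) {} = poly_act a (ext_coeff f {})"
proof -
  have "ext_coeff (set_prod (lin_x a) S) {} = 0" if "S \<in> Pow {..<n}" "S \<noteq> {}" for S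
  proof -
    have fin: "finite S" using that finite_subset by auto
    have "set_prod (lin_x a) (insert (Min S) (S - {Min S})) = lin_x a (Min S) * set_prod (lin_x a) (S - {Min S})"
    proof (rule set_prod_insert_min)
      fix x assume "x \<in> S - {Min S}"
      then show "Min S < x" using Min_le[OF fin, of x] by auto
    qed (use fin in simp)
    moreover have "insert (Min S) (S - {Min S}) = S" using Min_in[OF fin that(2)] by auto
    ultimately show ?thesis by (simp add: ext_coeff_lin_x_mult)
  qed
  then have "ext_coeff (ext_act a f) {} = (\<Sum>S\<in>Pow {..<n}. if S = {} then poly_act a (ext_coeff f {}) else 0)"
    unfolding ext_act_eq_sum[OF assms] ext_coeff_sum
    by (intro sum.cong refl) (simp add: one_ext.rep_eq)
  then show ?thesis by simp
qed

subsection \<open>The Moore determinant and duality\<close>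

lemma two_nonzero:
  assumes "odd CARD('p)" shows "(2 :: 'p::prime_card mod_ring mpoly) \<noteq> 0"
proof
  assume "(2 :: 'p mod_ring mpoly) = 0"
  then have "of_nat 2 = (0 :: 'p mod_ring mpoly)" by simp
  then have "CARD('p) dvd 2" by (simp only: of_nat_eq_0_iff_char_dvd CHAR_mpoly)
  then have "CARD('p) \<le> 2" by (rule dvd_imp_le) simp
  with assms CARD_gt_1[where 'p = 'p] show False by (cases "CARD('p) = 2") auto
qed

lemma mui_h_polynomial:
  "span_prod ygen {0..<j} X = (\<Sum>m\<le>j. (-1) ^ (j - m) * dickson_coeff mui_h j m * (X :: 'p::prime_card mod_ring mpoly) ^ (CARD('p) ^ m))"
  using span_prod_eq_sum[of ygen 0 j mui_h X] lin_indep_ygen[of "{0..<j}"]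
  by (simp add: mui_h_eq_flag_h flag_h_def)

lemma contr_span_prod:
  "contr n (\<lambda>i. span_prod ygen {0..<j} (ygen i)) f =
    (\<Sum>m\<le>j. ext_const ((-1) ^ (j - m) * dickson_coeff mui_h j m) * contr n (\<lambda>i. (ygen i :: 'p::prime_card mod_ring mpoly) ^ (CARD('p) ^ m)) f)"
  unfolding mui_h_polynomial by (rule contr_weight_sum)

lemma span_prod_ygen_below: "i < j \<Longrightarrow> span_prod ygen {0..<j} (ygen i) = (0 :: 'p::prime_card mod_ring mpoly)"
  unfolding span_prod_def
  by (rule prod_zero) (auto intro!: bexI[of _ "ygen i"] lspan_base finite_lspan)

lemma mui_h_eq_span_prod: "mui_h j = span_prod ygen {0..<j} (ygen j)"
  by (simp add: mui_h_eq_flag_h flag_h_def)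

lemma mui_h_nonzero [simp]: "mui_h j \<noteq> 0"
  by (simp add: mui_h_eq_flag_h flag_h_nonzero)

text \<open>
  The last operator may be replaced by the contraction with \<open>y_i \<mapsto> \<Prod>(y_i - v)\<close>, which differs
  from it by multiples of the other operators and only sees \<open>x_j\<close>.
\<close>

lemma milnor_volume:
  assumes odd: "odd CARD('p::prime_card)" and "j \<le> n"
  shows "milnor n [0..<j] (set_prod xgen {..<j}) = ext_const (mui_L j :: 'p mod_ring mpoly) \<or>
    milnor n [0..<j] (set_prod xgen {..<j}) = - ext_const (mui_L j :: 'p mod_ring mpoly)"
  using assms(2)
proof (induction j)
  case 0
  then show ?case by (simp add: milnor_def mui_L_def)
next
  case (Suc j)
  let ?X = "set_prod xgen {..<Suc j} :: 'p mod_ring mpoly ext"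
  let ?F = "\<lambda>i. span_prod ygen {0..<j} (ygen i) :: 'p mod_ring mpoly"
  let ?u = "\<lambda>m i. (ygen i :: 'p mod_ring mpoly) ^ (CARD('p) ^ m)"
  have zero: "milnor n [0..<j] (contr n (?u m) ?X) = 0" if "m < j" for m
  proof -
    have "milnor n [0..<j] (contr n (?u m) ?X) = milnor n ([0..<j] @ [m]) ?X"
      by (simp add: milnor_def contrs_append)
    also have "\<dots> = 0" unfolding milnor_def
      by (rule contrs_not_distinct[OF two_nonzero[OF odd]]) (use that in auto)
    finally show ?thesis .
  qed
  have "milnor n [0..<j] (contr n ?F ?X) = (\<Sum>m\<le>j. ext_const ((-1) ^ (j - m) * dickson_coeff mui_h j m) * milnor n [0..<j] (contr n (?u m) ?X))"
    unfolding contr_span_prod milnor_def contrs_sum contrs_const_mult ..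
  also have "\<dots> = (\<Sum>m\<le>j. if m = j then milnor n [0..<j] (contr n (?u j) ?X) else 0)"
    by (rule sum.cong) (auto simp: zero)
  also have "\<dots> = milnor n [0..<Suc j] ?X"
    by (simp add: milnor_def contrs_append)
  finally have "milnor n [0..<Suc j] ?X = milnor n [0..<j] (contr n ?F ?X)" ..
  also have "contr n ?F ?X = (\<Sum>k\<in>{..<Suc j}. if k = j then ext_const (below_sign j {..<Suc j} * mui_h j) * set_prod xgen {..<j} else 0)"
    unfolding contr_set_prod_xgen[OF finite_lessThan, of "Suc j" n, unfolded lessThan_subset_iff, OF Suc.prems]
  proof (rule sum.cong[OF refl])
    fix k assume k: "k \<in> {..<Suc j}"
    have e: "{..<Suc j} - {j} = {..<j}" by auto
    show "ext_const (below_sign k {..<Suc j} * ?F k) * set_prod xgen ({..<Suc j} - {k}) =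
        (if k = j then ext_const (below_sign j {..<Suc j} * mui_h j) * set_prod xgen {..<j} else 0)"
    proof (cases "k = j")
      case True
      then show ?thesis by (simp only: e mui_h_eq_span_prod refl if_True)
    next
      case False
      then show ?thesis using k by (simp add: span_prod_ygen_below)
    qed
  qed
  also have "\<dots> = ext_const (below_sign j {..<Suc j} * mui_h j) * set_prod xgen {..<j}"
    by simp
  also have "milnor n [0..<j] \<dots> = ext_const (below_sign j {..<Suc j} * mui_h j) * milnor n [0..<j] (set_prod xgen {..<j})"
    unfolding milnor_def contrs_const_mult ..
  finally have eq: "milnor n [0..<Suc j] ?X = ext_const (below_sign j {..<Suc j} * mui_h j) * milnor n [0..<j] (set_prod xgen {..<j})" .
  have "below_sign j {..<Suc j} = (1 :: 'p mod_ring mpoly) \<or> below_sign j {..<Suc j} = (-1 :: 'p mod_ring mpoly)"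
    unfolding below_sign_def by (cases "even (card {s \<in> {..<Suc j}. s < j})") auto
  moreover have "ext_const (mui_h j) * ext_const (mui_L j) = ext_const (mui_L (Suc j) :: 'p mod_ring mpoly)"
    by (simp add: mui_L_def mult.commute flip: ext_const_mult)
  ultimately show ?case
    using Suc unfolding eq by (auto simp: ext_const_uminus)
qed

text \<open>Exchanging the weights \<open>y_i^(p^j)\<close> for
  \<open>F_j(y_i) = span_prod ygen {0..<j} (ygen i)\<close> makes the system triangular:
  \<open>F_j(y_i) = 0\<close> for \<open>i < j\<close>, and the diagonal entries
  \<open>mui_h i\<close> are nonzero. Starting with the largest \<open>i\<close>, each operator
  isolates one coefficient.\<close>

lemma contr_kernel:
  fixes g :: "'p::prime_card mod_ring mpoly ext"
  assumes g: "g \<in> cohom n" and z: "\<And>j. j < n \<Longrightarrow> contr n (\<lambda>i. ygen i ^ (CARD('p) ^ j)) g = 0"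
  shows "g = ext_const (ext_coeff g {})"
proof (rule ext_eqI)
  have F: "contr n (\<lambda>i. span_prod ygen {0..<j} (ygen i)) g = 0" if "j < n" for j
    unfolding contr_span_prod by (rule sum.neutral) (use z that in auto)
  have "i \<in> {..<n} - S \<Longrightarrow> ext_coeff g (insert i S) = 0" for i S
  proof (induction "n - i" arbitrary: i rule: less_induct)
    case less
    have "0 = ext_coeff (contr n (\<lambda>l. span_prod ygen {0..<i} (ygen l)) g) S"
      using F[of i] less.prems by simp
    also have "\<dots> = (\<Sum>l\<in>{..<n} - S. if l = i then below_sign i S * mui_h i * ext_coeff g (insert i S) else 0)"
      unfolding ext_coeff_contr
    proof (rule sum.cong[OF refl])
      fix l assume l: "l \<in> {..<n} - S"
      consider "l < i" | "l = i" | "i < l" by linarith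
      then show "below_sign l S * span_prod ygen {0..<i} (ygen l) * ext_coeff g (insert l S) =
          (if l = i then below_sign i S * mui_h i * ext_coeff g (insert i S) else 0)"
      proof cases
        case 3
        then have "ext_coeff g (insert l S) = 0" using less.hyps[of l] l less.prems by auto
        then show ?thesis using 3 by simp
      qed (auto simp: span_prod_ygen_below mui_h_eq_span_prod)
    qed
    also have "\<dots> = below_sign i S * mui_h i * ext_coeff g (insert i S)"
      using less.prems by simp
    finally have "below_sign i S * (below_sign i S * (mui_h i * ext_coeff g (insert i S))) = 0"
      by (simp add: mult.assoc)
    then have "mui_h i * ext_coeff g (insert i S) = 0" by (simp add: mult.assoc[symmetric])
    then show ?case by simp
  qed note zero = this
  fix S
  show "ext_coeff g S = ext_coeff (ext_const (ext_coeff g {})) S"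
  proof (cases "S = {}")
    case False
    then obtain i where i: "i \<in> S" by blast
    have "ext_coeff g S = 0"
    proof (rule ccontr)
      assume nz: "ext_coeff g S \<noteq> 0"
      then have "S \<subseteq> {..<n}" using g by (simp add: cohom_iff)
      then have "i \<in> {..<n} - (S - {i})" using i by auto
      then show False using zero[of i "S - {i}"] nz i by (simp add: insert_absorb)
    qed
    then show ?thesis using False by (simp add: ext_coeff_const)
  qed (simp add: ext_coeff_const)
qed

definition milnor_coeff :: "nat \<Rightarrow> nat set \<Rightarrow> 'p::prime_card mod_ring mpoly ext \<Rightarrow> 'p mod_ring mpoly" where
  "milnor_coeff n T f = ext_coeff (milnor n (sorted_list_of_set T) f) {}"

lemma milnor_coeff_add: "milnor_coeff n T (f + g) = milnor_coeff n T f + milnor_coeff n T g"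
  and milnor_coeff_diff: "milnor_coeff n T (f - g) = milnor_coeff n T f - milnor_coeff n T g"
  and milnor_coeff_const_mult: "milnor_coeff n T (ext_const c * f) = c * milnor_coeff n T f"
  and milnor_coeff_sum: "milnor_coeff n T (sum h A) = (\<Sum>i\<in>A. milnor_coeff n T (h i))"
  by (simp_all add: milnor_coeff_def milnor_def contrs_add contrs_diff contrs_const_mult contrs_sum ext_coeff_sum)

lemma milnor_coeff_empty [simp]: "milnor_coeff n {} f = ext_coeff f {}"
  by (simp add: milnor_coeff_def milnor_def)

text \<open>Descending induction on the size of \<open>T\<close>: once all further contractions of
  an iterated contraction vanish, it is a constant by \<open>contr_kernel\<close>, and that constant
  is the assumed zero.\<close>

lemma milnor_coeff_nondegenerate:
  fixes f :: "'p::prime_card mod_ring mpoly ext"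
  assumes odd: "odd CARD('p)" and f: "f \<in> cohom n"
    and z: "\<And>T. T \<subseteq> {..<n} \<Longrightarrow> milnor_coeff n T f = 0"
  shows "f = 0"
proof -
  have "T \<subseteq> {..<n} \<Longrightarrow> milnor n (sorted_list_of_set T) f = 0" for T
  proof (induction "n - card T" arbitrary: T rule: less_induct)
    case less
    let ?g = "milnor n (sorted_list_of_set T) f"
    have fin: "finite T" using less.prems finite_subset by auto
    have "contr n (\<lambda>i. ygen i ^ (CARD('p) ^ j)) ?g = 0" if j: "j < n" for j
    proof -
      have c: "contr n (\<lambda>i. ygen i ^ (CARD('p) ^ j)) ?g = milnor n (j # sorted_list_of_set T) f"
        by (simp add: milnor_def)
      show ?thesis
      proof (cases "j \<in> T")
        case True
        then show ?thesis unfolding c unfolding milnor_def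
          by (intro contrs_not_distinct[OF two_nonzero[OF odd]]) (use fin in simp)
      next
        case False
        have sub: "insert j T \<subseteq> {..<n}" using less.prems j by auto
        have "card (insert j T) \<le> n" using card_mono[OF _ sub] by simp
        then have "n - card (insert j T) < n - card T" using False fin by simp
        then have "milnor n (sorted_list_of_set (insert j T)) f = 0" using less.hyps sub by blast
        moreover have "mset (j # sorted_list_of_set T) = mset (sorted_list_of_set (insert j T))"
          using False fin by simp
        then have "milnor n (j # sorted_list_of_set T) f = milnor n (sorted_list_of_set (insert j T)) f \<or>
          milnor n (j # sorted_list_of_set T) f = - milnor n (sorted_list_of_set (insert j T)) f"
          unfolding milnor_def by (rule contrs_perm)
        ultimately show ?thesis unfolding c by (simp only: minus_zero simp_thms)
      qed
    qed
    then have "?g = ext_const (ext_coeff ?g {})" by (rule contr_kernel[OF cohom_milnor[OF f]])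
    moreover have "ext_coeff ?g {} = 0" using z[OF less.prems] by (simp add: milnor_coeff_def)
    ultimately show ?case by simp
  qed
  from this[of "{}"] show ?thesis by (simp add: milnor_def)
qed

text \<open>Each contraction lowers the exterior degree by one, so only coefficients of one degree
  enter. With \<open>d = 0\<close> this proves vanishing, with \<open>d\<close> a variable it
  transfers divisibility.\<close>

lemma contrs_coeff_dvd:
  assumes "finite S" "\<And>S'. finite S' \<Longrightarrow> card S' = card S + length js \<Longrightarrow> d dvd ext_coeff f S'"
  shows "d dvd ext_coeff (contrs N u js f) S"
  using assms
proof (induction js arbitrary: S)
  case (Cons j js)
  show ?case
    unfolding contrs_Cons ext_coeff_contr
  proof (intro dvd_sum dvd_mult Cons.IH)
    fix i and S' :: "nat set" assume "i \<in> {..<N} - S" "finite S'" "card S' = card (insert i S) + length js"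
    then show "d dvd ext_coeff f S'" using Cons.prems by simp
  qed (use Cons.prems in simp)
qed simp

lemma milnor_coeff_dvd:
  assumes "finite T" "\<And>S. finite S \<Longrightarrow> card S = card T \<Longrightarrow> d dvd ext_coeff f S"
  shows "d dvd milnor_coeff n T f"
  unfolding milnor_coeff_def milnor_def
  by (rule contrs_coeff_dvd) (use assms in auto)

text \<open>The contractions by \<open>T\<close> and by the complement of \<open>T'\<close> act
  together on the volume form. If \<open>T\<close> differs from \<open>T'\<close>, then either an
  operator is repeated or their number is not \<open>n\<close>, and the constant term vanishes in
  both cases.\<close>

lemma milnor_coeff_mui_M_eq_0:
  fixes T T' :: "nat set"
  assumes odd: "odd CARD('p::prime_card)" and T: "T \<subseteq> {..<n}" "T' \<subseteq> {..<n}" "T \<noteq> T'"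
  shows "milnor_coeff n T (mui_M n T' :: 'p mod_ring mpoly ext) = 0"
proof -
  let ?js = "sorted_list_of_set T @ sorted_list_of_set ({..<n} - T')"
  let ?X = "set_prod xgen {..<n} :: 'p mod_ring mpoly ext"
  have fin: "finite T" "finite T'" using T finite_subset by auto
  have len: "length ?js = card T + (n - card T')" using fin T by (simp add: card_Diff_subset)
  have "ext_coeff (milnor n ?js ?X) {} = 0"
  proof (cases "distinct ?js \<and> length ?js = n")
    case True
    then have "T \<inter> ({..<n} - T') = {}" using fin by auto
    then have "T \<subseteq> T'" using T by auto
    moreover have "card T = card T'"
      using True len card_mono[OF finite_lessThan T(2)] by simp
    ultimately have "T = T'" using fin card_subset_eq by blast
    with T(3) show ?thesis by simp
  next
    case False
    then consider "\<not> distinct ?js" | "length ?js \<noteq> n" by blast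
    then show ?thesis
    proof cases
      case 1
      then show ?thesis unfolding milnor_def by (simp only: contrs_not_distinct[OF two_nonzero[OF odd] 1] ext_coeff_0)
    next
      case 2
      have "0 dvd ext_coeff (milnor n ?js ?X) {}"
        unfolding milnor_def
      proof (rule contrs_coeff_dvd)
        fix S' :: "nat set" assume "finite S'" "card S' = card {} + length ?js"
        then have "S' \<noteq> {..<n}" using 2 by auto
        then show "0 dvd ext_coeff ?X S'" by (simp add: ext_coeff_set_prod_xgen)
      qed simp
      then show ?thesis by simp
    qed
  qed
  then have z: "ext_coeff (milnor n (sorted_list_of_set T) (milnor n (sorted_list_of_set ({..<n} - T')) ?X)) {} = 0"
    by (simp add: milnor_def contrs_append)
  show ?thesis
    using mui_M_eq_milnor[OF T(2), where 'p = 'p] z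
    by (auto simp: milnor_coeff_def) (simp add: milnor_def contrs_uminus)
qed

text \<open>Here the two index lists together form a permutation of \<open>0, ..., n - 1\<close>,
  and the full contraction of the volume form is the Moore determinant up to sign.\<close>

lemma milnor_coeff_mui_M_self:
  assumes odd: "odd CARD('p::prime_card)" and T: "T \<subseteq> {..<n}"
  shows "\<exists>s. s * s = 1 \<and> s \<in> {1, -1} \<and> milnor_coeff n T (mui_M n T) = s * (mui_L n :: 'p mod_ring mpoly)"
proof -
  let ?js = "sorted_list_of_set T @ sorted_list_of_set ({..<n} - T)"
  let ?X = "set_prod xgen {..<n} :: 'p mod_ring mpoly ext"
  have fin: "finite T" using T finite_subset by auto
  have ms: "mset (sorted_list_of_set A) = mset_set A" if "finite A" for A :: "nat set"
    using mset_set_set[of "sorted_list_of_set A"] that by simp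
  have "mset ?js = mset_set (T \<union> ({..<n} - T))" using fin ms by (subst mset_set_Union) auto
  also have "\<dots> = mset [0..<n]" using T by (simp add: Un_absorb1 lessThan_atLeast0)
  finally have "milnor n ?js ?X = milnor n [0..<n] ?X \<or> milnor n ?js ?X = - milnor n [0..<n] ?X"
    unfolding milnor_def by (rule contrs_perm)
  then have "milnor n ?js ?X = ext_const (mui_L n) \<or> milnor n ?js ?X = - ext_const (mui_L n)"
    using milnor_volume[OF odd order_refl, of n] by auto
  then have "milnor n (sorted_list_of_set T) (mui_M n T) = ext_const (mui_L n :: 'p mod_ring mpoly) \<or>
      milnor n (sorted_list_of_set T) (mui_M n T) = - ext_const (mui_L n :: 'p mod_ring mpoly)"
  proof -
    have ap: "milnor n (sorted_list_of_set T) (milnor n (sorted_list_of_set ({..<n} - T)) ?X) = milnor n ?js ?X"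
      by (simp add: milnor_def contrs_append)
    have um: "milnor n js (- f) = - milnor n js f" for js and f :: "'p mod_ring mpoly ext"
      by (simp add: milnor_def contrs_uminus)
    show ?thesis
      using mui_M_eq_milnor[OF T, where 'p = 'p]
        \<open>milnor n ?js ?X = ext_const (mui_L n) \<or> milnor n ?js ?X = - ext_const (mui_L n)\<close>
      by (elim disjE) (simp_all only: um ap minus_minus simp_thms)
  qed
  then show ?thesis
    unfolding milnor_coeff_def
  proof
    assume h: "milnor n (sorted_list_of_set T) (mui_M n T) = ext_const (mui_L n :: 'p mod_ring mpoly)"
    show "\<exists>s. s * s = 1 \<and> s \<in> {1, -1} \<and>
        ext_coeff (milnor n (sorted_list_of_set T) (mui_M n T)) {} = s * (mui_L n :: 'p mod_ring mpoly)"
      by (rule exI[of _ 1]) (simp add: h ext_coeff_const)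
  next
    assume h: "milnor n (sorted_list_of_set T) (mui_M n T) = - ext_const (mui_L n :: 'p mod_ring mpoly)"
    show "\<exists>s. s * s = 1 \<and> s \<in> {1, -1} \<and>
        ext_coeff (milnor n (sorted_list_of_set T) (mui_M n T)) {} = s * (mui_L n :: 'p mod_ring mpoly)"
      by (rule exI[of _ "-1"]) (simp add: h ext_coeff_const)
  qed
qed

lemma mui_M_cohom:
  assumes "T \<subseteq> {..<n}" shows "(mui_M n T :: 'p::prime_card mod_ring mpoly ext) \<in> cohom n"
  using mui_M_eq_milnor[OF assms, where 'p = 'p]
  by (auto intro!: cohom_uminus cohom_milnor cohom_set_prod_xgen)

lemma mui_L_vpoly: "mui_L n \<in> vpoly {..<n}"
  unfolding mui_L_def
  using flag_h_vpoly[of _ n 0] by (intro vpoly_prod) (auto simp: mui_h_eq_flag_h lessThan_atLeast0)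

text \<open>By the two pairing lemmas both sides have the same \<open>milnor_coeff\<close> for every
  \<open>T\<close>; nondegeneracy makes them equal. The sign \<open>s T\<close> is that of the
  self-pairing of \<open>M_T\<close>, and it squares to 1.\<close>

lemma milnor_expansion:
  fixes f :: "'p::prime_card mod_ring mpoly ext"
  assumes odd: "odd CARD('p)" and f: "f \<in> cohom n"
  obtains s :: "nat set \<Rightarrow> 'p mod_ring mpoly" where "\<And>T. s T \<in> {1, -1}"
    "ext_const (mui_L n) * f = (\<Sum>T\<in>Pow {..<n}. ext_const (s T * milnor_coeff n T f) * mui_M n T)"
proof -
  have "\<exists>s :: 'p mod_ring mpoly. s \<in> {1, -1} \<and> (T \<subseteq> {..<n} \<longrightarrow> s * s = 1 \<and> milnor_coeff n T (mui_M n T) = s * mui_L n)" for T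
    using milnor_coeff_mui_M_self[OF odd, of T n] by (cases "T \<subseteq> {..<n}") auto
  then obtain s :: "nat set \<Rightarrow> 'p mod_ring mpoly" where s: "\<And>T. s T \<in> {1, -1}"
    "\<And>T. T \<subseteq> {..<n} \<Longrightarrow> s T * s T = 1" "\<And>T. T \<subseteq> {..<n} \<Longrightarrow> milnor_coeff n T (mui_M n T) = s T * mui_L n"
    by metis
  let ?R = "\<Sum>T\<in>Pow {..<n}. ext_const (s T * milnor_coeff n T f) * mui_M n T"
  have g: "milnor_coeff n T f \<in> vpoly {..<n}" for T
    using cohom_milnor[OF f] by (auto simp: milnor_coeff_def cohom_iff)
  have sv: "s T \<in> vpoly {..<n}" for T 
    using s(1)[of T] vpoly_uminus[OF vpoly_1, where 'a = "'p mod_ring"] by auto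
  have "ext_const (mui_L n) * f - ?R = 0"
  proof (rule milnor_coeff_nondegenerate[OF odd])
    show "ext_const (mui_L n) * f - ?R \<in> cohom n"
      by (intro cohom_diff cohom_sum cohom_const_mult f mui_L_vpoly mui_M_cohom vpoly_mult g sv) auto
    fix T assume T: "T \<subseteq> {..<n}"
    have "milnor_coeff n T ?R = (\<Sum>T'\<in>Pow {..<n}. if T' = T then mui_L n * milnor_coeff n T f else 0)"
      unfolding milnor_coeff_sum milnor_coeff_const_mult
    proof (rule sum.cong[OF refl])
      fix T' assume T': "T' \<in> Pow {..<n}"
      show "s T' * milnor_coeff n T' f * milnor_coeff n T (mui_M n T') =
          (if T' = T then mui_L n * milnor_coeff n T f else 0)"
      proof (cases "T' = T")
        case True
        have "s T * milnor_coeff n T f * (s T * mui_L n) = (s T * s T) * (mui_L n * milnor_coeff n T f)"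
          by (simp only: mult_ac)
        then show ?thesis using True s(2,3)[OF T] by simp
      next
        case False
        then show ?thesis using milnor_coeff_mui_M_eq_0[OF odd T, of T'] T' by auto
      qed
    qed
    also have "\<dots> = mui_L n * milnor_coeff n T f" using T by simp
    finally show "milnor_coeff n T (ext_const (mui_L n) * f - ?R) = 0"
      by (simp add: milnor_coeff_diff milnor_coeff_const_mult)
  qed
  then have "ext_const (mui_L n) * f = ?R" by (rule eq_iff_diff_eq_0[THEN iffD2])
  then show ?thesis by (rule that[OF s(1)])
qed

subsection \<open>Invariance of the basis elements\<close>

lemma lin_sub_eq_sum: "a \<in> carrier_mat n n \<Longrightarrow> lin_sub a k = (\<Sum>i<n. mconst (a $$ (i, k)) * ygen i)"
  by (auto simp: lin_sub_def)

lemma poly_act_ygen_0: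
  fixes a :: "'p::prime_card mod_ring mat"
  assumes a: "a \<in> parabolic 1 (n - 1)" and n: "1 \<le> n"
  shows "poly_act a (ygen 0) = mconst (a $$ (0, 0)) * ygen 0"
  using parabolicD[OF a n] n by (simp add: poly_act_eq lin_sub_eq_sum sum_lessThan_split_first)

lemma poly_act_lin_form_nonzero:
  fixes a :: "'p::prime_card mod_ring mat"
  assumes a: "a \<in> parabolic 1 (n - 1)" and n: "1 \<le> n" and j: "j < n" and v: "v \<in> lspan ygen {0..<j}"
  shows "poly_act a (ygen j - v) \<noteq> 0"
proof
  assume z: "poly_act a (ygen j - v) = 0"
  obtain c where c: "v = (\<Sum>i\<in>{0..<j}. mconst (c i) * ygen i)" using v by (auto simp: lspan_def)
  define d where "d = (\<lambda>k. if k = j then 1 else if k < j then - c k else 0)"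
  have "(\<Sum>k<n. mconst (d k) * ygen k) = (\<Sum>k\<in>insert j {0..<j}. mconst (d k) * ygen k)"
    by (rule sum.mono_neutral_right) (use j in \<open>auto simp: d_def\<close>)
  also have "\<dots> = ygen j - v"
    by (simp add: d_def c mconst_uminus sum_negf)
  finally have "(\<Sum>i<n. mconst (\<Sum>k<n. a $$ (i, k) * d k) * ygen i) = 0"
    using poly_act_span[OF parabolicD(1)[OF a n], of d] z by simp
  then have "(\<Sum>k<n. a $$ (i, k) * d k) = 0" if "i < n" for i
    using lin_indepD[OF lin_indep_ygen[OF finite_lessThan[of n]],
      where c = "\<lambda>i. \<Sum>k<n. a $$ (i, k) * d k" and i = i] that by simp
  then have "d j = 0" using parabolic_inj[OF a n _ j, of d] by blast
  then show False by (simp add: d_def)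
qed

text \<open>Injectivity of the matrix keeps every linear factor of \<open>L_n\<close> nonzero. This
  later shows that the scalar by which \<open>L_n\<close> is multiplied is a unit.\<close>

lemma poly_act_mui_L_nonzero:
  fixes a :: "'p::prime_card mod_ring mat"
  assumes a: "a \<in> parabolic 1 (n - 1)" and n: "1 \<le> n"
  shows "poly_act a (mui_L n) \<noteq> 0"
proof -
  have "poly_act a (mui_L n) = (\<Prod>j<n. \<Prod>v\<in>lspan ygen {0..<j}. poly_act a (ygen j - v))"
    by (simp add: mui_L_def mui_h_eq_span_prod span_prod_def poly_act_eq msubst_prod)
  then show ?thesis
    using poly_act_lin_form_nonzero[OF a n] by (simp add: finite_lspan)
qed

lemma ext_coeff_set_prod_lin_x:
  assumes "finite T"
  shows "ext_coeff (set_prod (lin_x a) T) S \<in> range mconst \<and>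
    (ext_coeff (set_prod (lin_x a) T) S \<noteq> 0 \<longrightarrow> card S = card T \<and> S \<subseteq> {..<dim_row a})"
  using assms
proof (induction T arbitrary: S rule: finite_linorder_min_induct)
  case empty
  have "(0 :: 'a mpoly) \<in> range mconst" "(1 :: 'a mpoly) \<in> range mconst"
    by (metis mconst_0 rangeI, metis mconst_1 rangeI)
  then show ?case by (auto simp: one_ext.rep_eq)
next
  case (insert b A)
  have b: "b \<notin> A" using insert by blast
  let ?t = "\<lambda>i. if i \<in> S then mconst (a $$ (i, b)) * (below_sign i S * ext_coeff (set_prod (lin_x a) A) (S - {i})) else 0"
  have eq: "ext_coeff (set_prod (lin_x a) (insert b A)) S = (\<Sum>i<dim_row a. ?t i)"
    using insert by (simp add: set_prod_insert_min ext_coeff_lin_x_mult)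
  have "below_sign i S \<in> (range mconst :: 'a mpoly set)" for i
  proof -
    have "below_sign i S = (mconst (below_sign i S) :: 'a mpoly)"
      by (simp add: below_sign_def mconst_power mconst_uminus)
    then show ?thesis by (rule range_eqI)
  qed
  then have "\<exists>c. ?t i = mconst c" for i
  proof -
    obtain b' where b': "below_sign i S = (mconst b' :: 'a mpoly)"
      using \<open>\<And>i. below_sign i S \<in> (range mconst :: 'a mpoly set)\<close>[of i] by auto
    obtain e where e: "ext_coeff (set_prod (lin_x a) A) (S - {i}) = mconst e"
      using insert.IH[of "S - {i}"] by auto
    have "?t i = mconst (if i \<in> S then a $$ (i, b) * (b' * e) else 0)"
      unfolding b' e by (simp add: mconst_mult)
    then show ?thesis by (rule exI)
  qed
  then obtain c where "\<And>i. ?t i = mconst (c i)" by metis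
  then have 1: "ext_coeff (set_prod (lin_x a) (insert b A)) S \<in> range mconst"
    unfolding eq by (simp flip: mconst_sum)
  have 2: "card S = card (insert b A) \<and> S \<subseteq> {..<dim_row a}"
    if "ext_coeff (set_prod (lin_x a) (insert b A)) S \<noteq> 0"
  proof -
    from that obtain i where i: "i \<in> {..<dim_row a}" "?t i \<noteq> 0"
      unfolding eq by (rule sum.not_neutral_contains_not_neutral)
    then have "i \<in> S" "ext_coeff (set_prod (lin_x a) A) (S - {i}) \<noteq> 0" by (auto split: if_splits)
    then have c: "card (S - {i}) = card A" "S - {i} \<subseteq> {..<dim_row a}" "i \<in> S" using insert.IH by auto
    have sub: "S \<subseteq> {..<dim_row a}" using c(2) i(1) by auto
    then have "finite S" by (rule finite_subset) simp
    then have "card S = Suc (card A)" using card_Suc_Diff1[OF _ c(3)] c(1) by metis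
    also have "\<dots> = card (insert b A)" by (rule card_insert_disjoint[OF insert.hyps(1) b, symmetric])
    finally show ?thesis using sub by blast
  qed
  show ?case using 1 2 by blast
qed

lemma ext_act_volume:
  assumes "a \<in> carrier_mat n n"
  obtains \<delta> where "ext_act a (set_prod xgen {..<n}) = ext_const (mconst \<delta>) * set_prod xgen {..<n}"
proof -
  have "ext_act a (set_prod xgen {..<n}) = (\<Sum>S\<in>Pow {..<n}. if S = {..<n} then set_prod (lin_x a) {..<n} else 0)"
    unfolding ext_act_eq_sum[OF cohom_set_prod_xgen[OF order_refl]]
    by (rule sum.cong) (auto simp: ext_coeff_set_prod_xgen poly_act_def)
  then have eq: "ext_act a (set_prod xgen {..<n}) = set_prod (lin_x a) {..<n}" by simp
  note c = ext_coeff_set_prod_lin_x[OF finite_lessThan[of n], of a]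
  obtain \<delta> where \<delta>: "ext_coeff (set_prod (lin_x a) {..<n}) {..<n} = mconst \<delta>" using c[of "{..<n}"] by auto
  have "set_prod (lin_x a) {..<n} = ext_const (mconst \<delta>) * set_prod xgen {..<n}"
  proof (rule ext_eqI)
    fix S
    have "ext_coeff (set_prod (lin_x a) {..<n}) S = 0" if "S \<noteq> {..<n}"
    proof (rule ccontr)
      assume "\<not> ?thesis"
      then have "card S = card {..<n}" "S \<subseteq> {..<n}" using c[of S] assms by auto
      then show False using that card_subset_eq[of "{..<n}" S] by simp
    qed
    then show "ext_coeff (set_prod (lin_x a) {..<n}) S = ext_coeff (ext_const (mconst \<delta>) * set_prod xgen {..<n}) S"
      using \<delta> by (cases "S = {..<n}") (simp_all add: ext_coeff_set_prod_xgen)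
  qed
  then show ?thesis using that[of \<delta>] eq by simp
qed

text \<open>The scalar is read off from the volume form. \<open>L_n\<close> and all
  \<open>M_T\<close> are iterated contractions of that form up to sign, and contractions commute
  with the action, so all of them are multiplied by the same scalar, the determinant of
  \<open>a\<close>.\<close>

lemma parabolic_det_char:
  fixes a :: "'p::prime_card mod_ring mat"
  assumes odd: "odd CARD('p)" and a: "a \<in> parabolic 1 (n - 1)" and n: "1 \<le> n"
  obtains \<delta> where "\<delta> \<noteq> 0" "poly_act a (mui_L n) = mconst \<delta> * mui_L n"
    "\<And>T. T \<subseteq> {..<n} \<Longrightarrow> ext_act a (mui_M n T) = ext_const (mconst \<delta>) * mui_M n T"
proof -
  have car: "a \<in> carrier_mat n n" using parabolicD(1)[OF a n] .
  let ?X = "set_prod xgen {..<n} :: 'p mod_ring mpoly ext"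
  have X: "?X \<in> cohom n" by (rule cohom_set_prod_xgen) simp
  obtain \<delta> where \<delta>: "ext_act a ?X = ext_const (mconst \<delta>) * ?X" using ext_act_volume[OF car] by blast
  have m: "ext_act a (milnor n js ?X) = ext_const (mconst \<delta>) * milnor n js ?X" for js
    unfolding milnor_ext_act[OF car X, symmetric] \<delta> by (simp add: milnor_def contrs_const_mult)
  have M: "ext_act a (mui_M n T) = ext_const (mconst \<delta>) * mui_M n T" if "T \<subseteq> {..<n}" for T
    using mui_M_eq_milnor[OF that, where 'p = 'p]
    by (elim disjE) (simp_all add: m ext_act_uminus[OF cohom_milnor[OF X]])
  have "ext_act a (ext_const (mui_L n)) = ext_const (mconst \<delta>) * ext_const (mui_L n :: 'p mod_ring mpoly)"
    using milnor_volume[OF odd order_refl, of n]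
  proof
    assume h: "milnor n [0..<n] ?X = ext_const (mui_L n)"
    show ?thesis using m[of "[0..<n]"] unfolding h .
  next
    assume "milnor n [0..<n] ?X = - ext_const (mui_L n)"
    then have h: "ext_const (mui_L n) = - milnor n [0..<n] ?X" by simp
    show ?thesis unfolding h ext_act_uminus[OF cohom_milnor[OF X]] m by simp
  qed
  then have "ext_coeff (ext_const (poly_act a (mui_L n))) {} = ext_coeff (ext_const (mconst \<delta> * mui_L n :: 'p mod_ring mpoly)) {}"
    unfolding ext_act_const[OF mui_L_vpoly] by (simp add: ext_const_mult)
  then have L: "poly_act a (mui_L n) = mconst \<delta> * mui_L n" by (simp add: ext_coeff_const)
  have "\<delta> \<noteq> 0" using L poly_act_mui_L_nonzero[OF a n] by auto
  then show ?thesis by (rule that[OF _ L M])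
qed

text \<open>\<open>M_T\<close> contributes one factor \<open>\<delta>\<close> and
  \<open>L_n^(p-2)\<close> contributes \<open>p - 2\<close> of them;
  \<open>\<delta>^(p-1) = 1\<close>.\<close>

lemma mui_M_invariant:
  assumes odd: "odd CARD('p::prime_card)" and n: "1 \<le> n" and T: "T \<subseteq> {..<n}"
  shows "mui_M n T * ext_const (mui_L n ^ (CARD('p) - 2)) \<in>
    (cohom_invariants n (parabolic 1 (n - 1)) :: 'p mod_ring mpoly ext set)"
proof -
  let ?e = "CARD('p) - 2"
  have Lv: "mui_L n ^ ?e \<in> vpoly {..<n}" by (intro vpoly_power mui_L_vpoly)
  have "ext_act a (ext_const (mui_L n ^ ?e) * mui_M n T) = ext_const (mui_L n ^ ?e) * (mui_M n T :: 'p mod_ring mpoly ext)"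
    if a: "a \<in> parabolic 1 (n - 1)" for a
  proof -
    obtain \<delta> where \<delta>: "\<delta> \<noteq> 0" "poly_act a (mui_L n) = mconst \<delta> * mui_L n"
      "\<And>T. T \<subseteq> {..<n} \<Longrightarrow> ext_act a (mui_M n T) = ext_const (mconst \<delta>) * mui_M n T"
      using parabolic_det_char[OF odd a n] by blast
    have "Suc ?e = CARD('p) - 1" using CARD_gt_1[where 'p = 'p] by simp
    then have d: "mconst \<delta> ^ ?e * mconst \<delta> = 1"
      using mconst_power_CARD_minus_1[OF \<delta>(1)] by (metis power_Suc2)
    have "poly_act a (mui_L n ^ ?e) = mconst \<delta> ^ ?e * mui_L n ^ ?e"
      using \<delta>(2) by (simp add: poly_act_eq msubst_power power_mult_distrib)
    then have "ext_act a (ext_const (mui_L n ^ ?e) * mui_M n T) =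
        ext_const (mconst \<delta> ^ ?e * mui_L n ^ ?e * mconst \<delta>) * mui_M n T"
      unfolding ext_act_const_mult[OF mui_M_cohom[OF T] Lv] \<delta>(3)[OF T]
      by (simp add: ext_const_mult mult.assoc)
    also have "mconst \<delta> ^ ?e * mui_L n ^ ?e * mconst \<delta> = mui_L n ^ ?e"
    proof -
      have "mconst \<delta> ^ ?e * mui_L n ^ ?e * mconst \<delta> = (mconst \<delta> ^ ?e * mconst \<delta>) * mui_L n ^ ?e"
        by (simp only: mult_ac)
      then show ?thesis by (simp only: d mult_1_left)
    qed
    finally show ?thesis .
  qed
  then show ?thesis
    unfolding ext_const_commute cohom_invariants_def
    by (auto intro!: cohom_const_mult Lv mui_M_cohom[OF T])
qed

lemma mui_M_1: "mui_M 1 {0} = (xgen 0 :: 'p::prime_card mod_ring mpoly ext)"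
proof -
  have "mui_columns CARD('p) 1 {0} = replicate 1 xgen" by (simp add: mui_columns_def lessThan_Suc)
  then have "mui_det CARD('p) 1 {0} = coldet 1 (replicate 1 xgen)"
    unfolding mui_det_def using column_det_eq_coldet[of "replicate 1 xgen" 1] by simp
  also have "\<dots> = set_prod xgen {..<1}" unfolding coldet_volume by simp
  also have "\<dots> = xgen 0"
  proof -
    have "{..<1} = {0::nat}" by auto
    then show ?thesis by (simp add: set_prod_def)
  qed
  finally have "mui_M_int CARD('p) 1 {0} = xgen 0"
    using mui_M_int_eq[of "{0}" 1 "CARD('p)"] by simp
  then have "mui_M 1 {0} = (ext_map mod_red (xgen 0) :: 'p mod_ring mpoly ext)"
    by (simp add: mui_M_def mod_red_def)
  also have "\<dots> = xgen 0" by (rule ext_eqI) (simp add: ext_coeff_map_mod_red xgen.rep_eq)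
  finally show ?thesis .
qed

lemma xgen_cohom: "i < n \<Longrightarrow> xgen i \<in> cohom n"
  using cohom_set_prod_xgen[of "{i}" n] by (simp add: set_prod_def)

lemma ext_coeff_xgen: "ext_coeff (xgen i) S = (if S = {i} then 1 else 0)"
  by (simp add: xgen.rep_eq)

lemma line_form_invariant:
  assumes odd: "odd CARD('p::prime_card)" and n: "1 \<le> n"
  shows "mui_M 1 {0} * ext_const (mui_h 0 ^ (CARD('p) - 2)) \<in>
    (cohom_invariants n (parabolic 1 (n - 1)) :: 'p mod_ring mpoly ext set)"
proof -
  let ?e = "CARD('p) - 2"
  have yv: "ygen 0 ^ ?e \<in> vpoly {..<n}" using n by (intro vpoly_power vpoly_ygen) auto
  have x: "xgen 0 \<in> cohom n" using n by (intro xgen_cohom) simp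
  have "ext_act a (ext_const (ygen 0 ^ ?e) * xgen 0) = ext_const (ygen 0 ^ ?e) * (xgen 0 :: 'p mod_ring mpoly ext)"
    if a: "a \<in> parabolic 1 (n - 1)" for a :: "'p mod_ring mat"
  proof -
    note aD = parabolicD[OF a n]
    have "Suc ?e = CARD('p) - 1" using CARD_gt_1[where 'p = 'p] by simp
    then have d: "mconst (a $$ (0, 0)) ^ ?e * mconst (a $$ (0, 0)) = 1"
      using mconst_power_CARD_minus_1[OF aD(2)] by (metis power_Suc2)
    have "ext_act a (xgen 0) = (\<Sum>S\<in>Pow {..<n}. if S = {0} then lin_x a 0 else 0)"
      unfolding ext_act_eq_sum[OF x] by (rule sum.cong) (auto simp: ext_coeff_xgen set_prod_def poly_act_def)
    also have "\<dots> = lin_x a 0" using n by simp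
    also have "\<dots> = ext_const (mconst (a $$ (0, 0))) * xgen 0"
      using aD n by (simp add: lin_x_def sum_lessThan_split_first)
    finally have "ext_act a (ext_const (ygen 0 ^ ?e) * xgen 0) =
        ext_const (mconst (a $$ (0, 0)) ^ ?e * ygen 0 ^ ?e * mconst (a $$ (0, 0))) * xgen 0"
      unfolding ext_act_const_mult[OF x yv]
      using poly_act_ygen_0[OF a n] by (simp add: poly_act_eq msubst_power power_mult_distrib ext_const_mult mult.assoc)
    also have "mconst (a $$ (0, 0)) ^ ?e * ygen 0 ^ ?e * mconst (a $$ (0, 0)) = ygen 0 ^ ?e"
    proof -
      have "mconst (a $$ (0, 0)) ^ ?e * ygen 0 ^ ?e * mconst (a $$ (0, 0)) =
          (mconst (a $$ (0, 0)) ^ ?e * mconst (a $$ (0, 0))) * ygen 0 ^ ?e"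
        by (simp only: mult_ac)
      then show ?thesis by (simp only: d mult_1_left)
    qed
    finally show ?thesis .
  qed
  then show ?thesis
    unfolding ext_const_commute cohom_invariants_def mui_M_1 mui_h_0
    using cohom_const_mult[OF yv x] by simp
qed

section \<open>The structure of the invariants as a module\<close>

subsection \<open>Divisibility of the coefficients of an invariant\<close>

text \<open>Lists are allowed to be unsorted, because replacing one index by another in a sorted
  list destroys the order.\<close>

lemma ext_coeff_prod_list_xgen:
  "(\<not> (distinct ks \<and> set ks = S) \<longrightarrow> ext_coeff (\<Prod>k\<leftarrow>ks. xgen k) S = (0 :: 'a::comm_ring_1)) \<and>
   (distinct ks \<and> set ks = S \<longrightarrow> ext_coeff (\<Prod>k\<leftarrow>ks. xgen k) S \<in> {1, - 1 :: 'a})"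
proof (induction ks arbitrary: S)
  case Nil
  then show ?case by (auto simp: one_ext.rep_eq)
next
  case (Cons k ks)
  let ?c = "ext_coeff (\<Prod>k\<leftarrow>ks. xgen k) (S - {k}) :: 'a"
  have c: "ext_coeff (\<Prod>k\<leftarrow>k # ks. xgen k) S = (if k \<in> S then below_sign k S * ?c else 0)"
    by (simp add: ext_coeff_xgen_mult)
  have bs: "below_sign k S \<in> {1, -1 :: 'a}"
    unfolding below_sign_def by (cases "even (card {s \<in> S. s < k})") auto
  have iff: "distinct (k # ks) \<and> set (k # ks) = S \<longleftrightarrow> k \<in> S \<and> distinct ks \<and> set ks = S - {k}"
    by auto
  show ?case
  proof (cases "k \<in> S \<and> distinct ks \<and> set ks = S - {k}")
    case True
    then have "?c \<in> {1, -1}" using Cons.IH by blast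
    then have "below_sign k S * ?c \<in> {1, -1}" using bs by (elim insertE emptyE) simp_all
    then have "ext_coeff (\<Prod>k\<leftarrow>k # ks. xgen k) S \<in> {1, - 1 :: 'a}"
      by (simp only: c conjunct1[OF True] if_True)
    then show ?thesis using True iff by blast
  next
    case False
    have "ext_coeff (\<Prod>k\<leftarrow>k # ks. xgen k) S = (0 :: 'a)"
    proof (cases "k \<in> S")
      case True
      then have "\<not> (distinct ks \<and> set ks = S - {k})" using False by blast
      then have "?c = 0" by (rule conjunct1[OF Cons.IH, THEN mp])
      then show ?thesis by (simp only: c mult_zero_right if_cancel)
    next
      case False
      then show ?thesis by (simp only: c if_False)
    qed
    then show ?thesis using False iff by blast
  qed
qed

text \<open>Scaling \<open>x_i\<close> and \<open>y_i\<close> together multiplies the monomial of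
  \<open>S\<close> by \<open>\<mu>\<close>, so the exponents of \<open>y_i\<close> in its
  coefficient are congruent to \<open>-1\<close> modulo \<open>p - 1\<close>. Exponent 0 would mean
  \<open>p = 2\<close>.\<close>

lemma ygen_dvd_coeff_scale:
  fixes f :: "'p::prime_card mod_ring mpoly ext"
  assumes odd: "odd CARD('p)" and f: "f \<in> cohom_invariants n (parabolic 1 (n - 1))" and i: "i < n" "i \<in> S"
  shows "ygen i dvd ext_coeff f S"
proof -
  have fc: "f \<in> cohom n" using f by (simp add: cohom_invariants_def)
  have inv: "mconst (\<mu> ^ 1) * scale_var i \<mu> (ext_coeff f S) = ext_coeff f S" if \<mu>: "\<mu> \<noteq> 0" for \<mu>
  proof (cases "S \<subseteq> {..<n}")
    case False
    then have "ext_coeff f S = 0" using fc by (auto simp: cohom_iff)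
    then show ?thesis by (simp add: scale_var_def)
  next
    case True
    let ?a = "multrow_mat n i \<mu>"
    have l: "lin_x ?a k = ext_const (if k = i then mconst \<mu> else 1) * xgen k" if "k < n" for k
    proof -
      have "lin_x ?a k = (\<Sum>r<n. if r = k then ext_const (if k = i then mconst \<mu> else 1) * xgen k else 0)"
        unfolding lin_x_def using that by (intro sum.cong) (auto simp: multrow_mat_def)
      then show ?thesis using that by simp
    qed
    have sp: "set_prod (lin_x ?a) S' = ext_const (if i \<in> S' then mconst \<mu> else 1) * set_prod xgen S'"
      if "finite S'" "S' \<subseteq> {..<n}" for S'
      using that
    proof (induction S' rule: finite_linorder_min_induct)
      case (insert b A)
      have b: "b \<notin> A" "b < n" using insert by auto
      have cc: "ext_const A * x * (ext_const B * y) = ext_const (A * B) * (x * y)"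
        for A B :: "'p mod_ring mpoly" and x y
      proof -
        have "ext_const A * x * (ext_const B * y) = ext_const A * (x * ext_const B) * y"
          by (simp only: mult.assoc)
        also have "\<dots> = ext_const (A * B) * (x * y)"
          by (simp only: ext_const_commute[of x B] ext_const_mult mult.assoc)
        finally show ?thesis .
      qed
      show ?case
        using insert b by (auto simp: set_prod_insert_min l[OF b(2)] cc)
    qed simp
    have "f = ext_act ?a f"
      using f multrow_mat_parabolic[OF i(1) \<mu>] by (simp add: cohom_invariants_def)
    then have "ext_coeff f S = ext_coeff (ext_act ?a f) S" by simp
    also have "\<dots> = (\<Sum>S'\<in>Pow {..<n}. if S' = S then mconst \<mu> * poly_act ?a (ext_coeff f S) else 0)"
      unfolding ext_act_eq_sum[OF fc] ext_coeff_sum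
    proof (rule sum.cong[OF refl])
      fix S' assume "S' \<in> Pow {..<n}"
      then have "S' \<subseteq> {..<n}" "finite S'" using finite_subset by auto
      then show "ext_coeff (ext_const (poly_act ?a (ext_coeff f S')) * set_prod (lin_x ?a) S') S =
          (if S' = S then mconst \<mu> * poly_act ?a (ext_coeff f S) else 0)"
        using i by (auto simp: sp ext_coeff_set_prod_xgen)
    qed
    also have "\<dots> = mconst \<mu> * scale_var i \<mu> (ext_coeff f S)"
      using True fc i poly_act_multrow[of "ext_coeff f S" n i \<mu>] by (simp add: cohom_iff)
    finally show ?thesis by simp
  qed
  show ?thesis
    unfolding ygen_dvd_iff_keys
  proof (intro ballI notI)
    fix m assume "m \<in> Poly_Mapping.keys (ext_coeff f S)" "Poly_Mapping.lookup m i = 0"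
    then have "CARD('p) - 1 dvd 1" using scale_var_keys[of 1 i "ext_coeff f S" m] inv by simp
    then have "CARD('p) = 2" using CARD_gt_1[where 'p = 'p] by simp
    with odd show False by simp
  qed
qed

text \<open>Apply the shear that adds \<open>x_i\<close> to \<open>x_l\<close> and compare
  coefficients at \<open>S1\<close>, which is \<open>S\<close> with \<open>l\<close> replaced by
  \<open>i\<close>. Only \<open>S1\<close> and \<open>S\<close> contribute, so up to sign the
  sheared coefficient of \<open>S\<close> is the change of the coefficient of \<open>S1\<close>,
  which \<open>y_i\<close> divides; modulo \<open>y_i\<close> the shear itself is trivial. The shear
  belongs to the group only for \<open>1 \<le> l\<close>.\<close>

lemma ygen_dvd_coeff_shear:
  fixes f :: "'p::prime_card mod_ring mpoly ext"
  assumes f: "f \<in> cohom_invariants n (parabolic 1 (n - 1))"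
    and i: "i < n" "i \<notin> S" and l: "l \<in> S" "1 \<le> l" and S: "S \<subseteq> {..<n}"
  shows "ygen i dvd ext_coeff f S"
proof -
  have fc: "f \<in> cohom n" using f by (simp add: cohom_invariants_def)
  have li: "l \<noteq> i" "l < n" using i l S by auto
  let ?a = "addrow_mat n 1 i l :: 'p mod_ring mat"
  let ?r = "\<lambda>k. if k = l then i else k"
  define S1 where "S1 = insert i (S - {l})"
  define Q where "Q = (\<lambda>S'. (\<Prod>k\<leftarrow>map ?r (sorted_list_of_set S'). xgen k) :: 'p mod_ring mpoly ext)"
  have lx: "lin_x ?a k = xgen k + (if k = l then xgen i else 0)" if "k < n" for k
  proof -
    have "lin_x ?a k = (\<Sum>r<n. (if r = k then xgen k else 0) + (if r = i then if k = l then xgen i else 0 else 0))"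
      unfolding lin_x_def using that li by (intro sum.cong) (auto simp: addrow_mat_def)
    then show ?thesis using that i by (simp add: sum.distrib)
  qed
  have pl: "(\<Prod>k\<leftarrow>ks. lin_x ?a k) = (\<Prod>k\<leftarrow>ks. xgen k) + (if l \<in> set ks then \<Prod>k\<leftarrow>map ?r ks. xgen k else 0)"
    if "distinct ks" "set ks \<subseteq> {..<n}" for ks
    using that
  proof (induction ks)
    case (Cons k ks)
    have "prod_list (map (xgen \<circ> ?r) ks) = (\<Prod>k\<leftarrow>ks. xgen k :: 'p mod_ring mpoly ext)" if "l \<notin> set ks"
      by (rule arg_cong[of _ _ prod_list], rule map_cong) (use that in auto)
    then show ?case using Cons lx[of k] by (auto simp: distrib_left distrib_right)
  qed simp
  have sp: "set_prod (lin_x ?a) S' = set_prod xgen S' + (if l \<in> S' then Q S' else 0)"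
    if "S' \<subseteq> {..<n}" for S'
    using pl[of "sorted_list_of_set S'"] that finite_subset[OF that] by (simp add: set_prod_def Q_def)
  \<comment> \<open>If replacing \<open>l\<close> by \<open>i\<close> in \<open>S'\<close> gives
    \<open>S1\<close> without repetition, then \<open>i\<close> is not in \<open>S'\<close>, and
    removing \<open>i\<close> again recovers \<open>S\<close>.\<close>
  have Qc: "ext_coeff (Q S') S1 = 0" if "S' \<subseteq> {..<n}" "l \<in> S'" "S' \<noteq> S" for S'
  proof -
    have fin: "finite S'" using that finite_subset by auto
    have "\<not> (distinct (map ?r (sorted_list_of_set S')) \<and> set (map ?r (sorted_list_of_set S')) = S1)"
    proof
      assume h: "distinct (map ?r (sorted_list_of_set S')) \<and> set (map ?r (sorted_list_of_set S')) = S1"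
      then have inj: "inj_on ?r S'" and im: "?r ` S' = S1" using fin by (auto simp: distinct_map)
      have "i \<notin> S'" using inj_onD[OF inj, of l i] that(2) li by auto
      then have "?r ` S' = insert i (S' - {l})" using that(2) by auto
      then have "insert i (S' - {l}) = insert i (S - {l})" using im unfolding S1_def by simp
      then have "S' - {l} = S - {l}"
        using insert_ident[of i "S' - {l}" "S - {l}"] \<open>i \<notin> S'\<close> i by blast
      then show False using that(2,3) l by blast
    qed
    then show ?thesis using ext_coeff_prod_list_xgen unfolding Q_def by blast
  qed
  have QS: "ext_coeff (Q S) S1 \<in> {1, -1}"
  proof -
    have fin: "finite S" using S finite_subset by auto
    have "inj_on ?r S" using i by (auto simp: inj_on_def)
    moreover have "?r ` S = S1" unfolding S1_def using l by auto
    ultimately have "distinct (map ?r (sorted_list_of_set S)) \<and> set (map ?r (sorted_list_of_set S)) = S1"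
      using fin by (simp add: distinct_map)
    then show ?thesis using ext_coeff_prod_list_xgen unfolding Q_def by blast
  qed
  have S1: "S1 \<subseteq> {..<n}" "S1 \<noteq> S" "l \<notin> S1" unfolding S1_def using S i li by auto
  define \<phi> where "\<phi> = (shear_var l i 1 :: 'p mod_ring mpoly \<Rightarrow> _)"
  have act: "poly_act ?a (ext_coeff f S') = \<phi> (ext_coeff f S')" for S'
    using fc poly_act_addrow[of "ext_coeff f S'" n l i 1] li i by (simp add: cohom_iff \<phi>_def)
  have "f = ext_act ?a f"
    using f addrow_mat_parabolic[of i n l "1 :: 'p mod_ring"] i li l by (simp add: cohom_invariants_def)
  then have "ext_coeff f S1 = ext_coeff (ext_act ?a f) S1" by simp
  also have "\<dots> = (\<Sum>S'\<in>Pow {..<n}. (if S' = S1 then \<phi> (ext_coeff f S1) else 0) +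
      (if S' = S then \<phi> (ext_coeff f S) * ext_coeff (Q S) S1 else 0))"
    unfolding ext_act_eq_sum[OF fc] ext_coeff_sum
  proof (rule sum.cong[OF refl])
    fix S' assume "S' \<in> Pow {..<n}"
    then have S': "S' \<subseteq> {..<n}" "finite S'" using finite_subset by auto
    consider "S' = S1" | "S' = S" | "S' \<noteq> S1" "S' \<noteq> S" by blast
    then show "ext_coeff (ext_const (poly_act ?a (ext_coeff f S')) * set_prod (lin_x ?a) S') S1 =
        (if S' = S1 then \<phi> (ext_coeff f S1) else 0) + (if S' = S then \<phi> (ext_coeff f S) * ext_coeff (Q S) S1 else 0)"
    proof cases
      case 1
      then show ?thesis using S1 S' by (simp add: sp act ext_coeff_set_prod_xgen)
    next
      case 2
      then show ?thesis using S1 S' l by (simp add: sp act ext_coeff_set_prod_xgen)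
    next
      case 3
      then show ?thesis using S' Qc[OF S'(1)] by (simp add: sp ext_coeff_set_prod_xgen)
    qed
  qed
  also have "\<dots> = \<phi> (ext_coeff f S1) + \<phi> (ext_coeff f S) * ext_coeff (Q S) S1"
    using S1(1) S by (simp add: sum.distrib)
  finally have e0: "ext_coeff f S1 = \<phi> (ext_coeff f S1) + \<phi> (ext_coeff f S) * ext_coeff (Q S) S1" .
  have eq: "ext_coeff f S1 - \<phi> (ext_coeff f S1) = \<phi> (ext_coeff f S) * ext_coeff (Q S) S1"
    by (rule diff_eq_eq[THEN iffD2]) (subst add.commute, rule e0)
  have dv: "ygen i dvd g - \<phi> g" for g
  proof -
    have "ygen i dvd msubst ygen g - msubst (ygen(l := ygen l + mconst 1 * ygen i)) g"
      by (rule msubst_diff_dvd) auto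
    then show ?thesis by (simp add: \<phi>_def shear_var_def)
  qed
  have "ygen i dvd \<phi> (ext_coeff f S) * ext_coeff (Q S) S1" using dv[of "ext_coeff f S1"] unfolding eq .
  then have "ygen i dvd \<phi> (ext_coeff f S)" using QS by auto
  then have "ygen i dvd (ext_coeff f S - \<phi> (ext_coeff f S)) + \<phi> (ext_coeff f S)"
    by (rule dvd_add[OF dv])
  then show ?thesis by simp
qed

text \<open>For \<open>i\<close> in \<open>S\<close> use the scaling, otherwise a shear of some
  positive index in \<open>S\<close>. Such an index is missing exactly for \<open>S = {0}\<close>,
  and this gap is the source of the extra generator \<open>x_0 y_0^(p-2)\<close>.\<close>

lemma ygen_dvd_coeff:
  fixes f :: "'p::prime_card mod_ring mpoly ext"
  assumes odd: "odd CARD('p)" and f: "f \<in> cohom_invariants n (parabolic 1 (n - 1))" and i: "i < n"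
    and S: "S \<noteq> {}" "S \<noteq> {0} \<or> i = 0"
  shows "ygen i dvd ext_coeff f S"
proof (cases "S \<subseteq> {..<n}")
  case False
  then have "ext_coeff f S = 0" using f by (auto simp: cohom_invariants_def cohom_iff)
  then show ?thesis by simp
next
  case True
  show ?thesis
  proof (cases "i \<in> S")
    case True
    then show ?thesis using ygen_dvd_coeff_scale[OF odd f i] by blast
  next
    case False
    have "\<exists>l\<in>S. 1 \<le> l"
    proof (rule ccontr)
      assume "\<not> ?thesis"
      then have "S \<subseteq> {0}" by (auto simp: not_le)
      then have "S = {0}" using S(1) by blast
      then show False using S(2) False by simp
    qed
    then show ?thesis using ygen_dvd_coeff_shear[OF f i False _ _ True] by blast
  qed
qed

text \<open>Two starting points are needed: the shears carry \<open>y_{n-1}\<close> to all forms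
  \<open>y_j - v\<close> with \<open>j \<ge> 1\<close>, but never to the fixed line
  \<open>y_0\<close>.\<close>

lemma mui_L_power_dvd:
  fixes g :: "'p::prime_card mod_ring mpoly"
  assumes g: "g \<in> poly_invariants n (parabolic 1 (n - 1))" and n: "2 \<le> n"
    and d: "ygen 0 dvd g" "ygen (n - 1) dvd g"
  shows "mui_L n ^ (CARD('p) - 1) dvd g"
proof -
  have ge: "g \<in> elem_inv 1 0 n" using g poly_invariants_elem_inv[of n] by blast
  have p: "ygen 0 ^ (CARD('p) - 1) dvd g" "ygen (n - 1) ^ (CARD('p) - 1) dvd g"
  proof -
    have "scale_var i \<mu> g = g" if "i < n" "\<mu> \<noteq> 0" for i \<mu>
      using ge that by (auto simp: elem_inv_def)
    then show "ygen 0 ^ (CARD('p) - 1) dvd g" "ygen (n - 1) ^ (CARD('p) - 1) dvd g"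
      using d n by (auto intro!: ygen_power_dvd_of_scale_var simp del: One_nat_def)
  qed
  have "(\<Prod>j\<in>{..<n}. span_prod ygen {0..<j} (ygen j)) ^ (CARD('p) - 1) dvd g"
  proof (rule span_prod_flag_power_dvd)
    fix j v assume j: "j \<in> {..<n}" and v: "v \<in> lspan (ygen :: nat \<Rightarrow> 'p mod_ring mpoly) {0..<j}"
    show "(ygen j - v) ^ (CARD('p) - 1) dvd g"
    proof (cases "j = 0")
      case True
      then show ?thesis using v p(1) by (simp add: lspan_def)
    next
      case False
      show ?thesis
        by (rule shear_var_lin_form_power_dvd[of 1 n 0 g "n - 1"])
          (use ge n j v p(2) False in \<open>auto simp: elem_inv_def\<close>)
    qed
  qed simp
  then show ?thesis by (simp add: mui_L_def mui_h_eq_span_prod)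
qed

subsection \<open>The invariants of the cohomology algebra\<close>

lemma poly_invariants_quotient:
  fixes G q :: "'a::idom mpoly"
  assumes "G * q \<in> poly_invariants n P" "G \<in> poly_invariants n P" "G \<noteq> 0"
  shows "q \<in> poly_invariants n P"
proof -
  have "q \<in> vpoly {..<n}"
    using assms by (intro vpoly_quotient[of G q]) (auto simp: poly_invariants_def poly_ring_eq_vpoly)
  moreover have "poly_act a q = q" if "a \<in> P" for a
  proof -
    have "poly_act a G = G" "poly_act a (G * q) = G * q" using assms that by (auto simp: poly_invariants_def)
    then have "G * poly_act a q = G * q" by (simp add: poly_act_eq msubst_mult)
    with assms(3) show ?thesis by simp
  qed
  ultimately show ?thesis by (simp add: poly_invariants_def poly_ring_eq_vpoly)
qed

lemma poly_invariants_uminus: "f \<in> poly_invariants n P \<Longrightarrow> - f \<in> poly_invariants n P"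
  by (auto simp: poly_invariants_def poly_ring_eq_vpoly poly_act_eq msubst_uminus intro: vpoly_uminus)

lemma cohom_invariants_add:
  assumes "f \<in> cohom_invariants n P" "g \<in> cohom_invariants n P"
  shows "f + g \<in> cohom_invariants n P"
  using assms ext_act_add[of f n g] by (simp add: cohom_invariants_def cohom_add)

lemma cohom_invariants_uminus:
  assumes "f \<in> cohom_invariants n P"
  shows "- f \<in> cohom_invariants n P"
  using assms ext_act_uminus[of f n] by (simp add: cohom_invariants_def cohom_uminus)

lemma cohom_invariants_diff:
  assumes "f \<in> cohom_invariants n P" "g \<in> cohom_invariants n P"
  shows "f - g \<in> cohom_invariants n P"
  using cohom_invariants_add[OF assms(1) cohom_invariants_uminus[OF assms(2)]] by simp

lemma cohom_invariants_const: "c \<in> poly_invariants n P \<Longrightarrow> ext_const c \<in> cohom_invariants n P"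
  using ext_act_const[of c n] by (simp add: cohom_invariants_def poly_invariants_def poly_ring_eq_vpoly cohom_const)

lemma cohom_invariants_const_mult:
  assumes "c \<in> poly_invariants n P" "f \<in> cohom_invariants n P"
  shows "ext_const c * f \<in> cohom_invariants n P"
  using assms ext_act_const_mult[of f n c]
  by (simp add: cohom_invariants_def poly_invariants_def poly_ring_eq_vpoly cohom_const_mult)

lemma cohom_invariants_sum:
  "(\<And>i. i \<in> A \<Longrightarrow> f i \<in> cohom_invariants n P) \<Longrightarrow> sum f A \<in> cohom_invariants n P"
proof (induction A rule: infinite_finite_induct)
  case (insert i A)
  then show ?case by (simp add: cohom_invariants_add)
qed (simp_all add: cohom_invariants_def cohom_0)

lemma milnor_coeff_invariant:
  fixes f :: "'p::prime_card mod_ring mpoly ext"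
  assumes f: "f \<in> cohom_invariants n P" and P: "P \<subseteq> carrier_mat n n"
  shows "milnor_coeff n T f \<in> poly_invariants n P"
proof -
  let ?g = "milnor n (sorted_list_of_set T) f"
  have fc: "f \<in> cohom n" using f by (simp add: cohom_invariants_def)
  have g: "?g \<in> cohom n" by (rule cohom_milnor[OF fc])
  have "poly_act a (ext_coeff ?g {}) = ext_coeff ?g {}" if "a \<in> P" for a
  proof -
    have "ext_act a ?g = ?g"
      using milnor_ext_act[of a n f "sorted_list_of_set T"] P that f fc by (auto simp: cohom_invariants_def)
    then show ?thesis using ext_coeff_ext_act_empty[OF g, of a] by simp
  qed
  then show ?thesis using g by (simp add: milnor_coeff_def poly_invariants_def poly_ring_eq_vpoly cohom_iff)
qed

lemma milnor_coeff_singleton: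
  "milnor_coeff n {t} f = (\<Sum>l<n. ygen l ^ (CARD('p) ^ t) * ext_coeff (f :: 'p::prime_card mod_ring mpoly ext) {l})"
  by (simp add: milnor_coeff_def milnor_def ext_coeff_contr below_sign_def)

lemma milnor_coeff_xgen:
  assumes "finite T" "T \<noteq> {}" "i < n"
  shows "milnor_coeff n T (xgen i :: 'p::prime_card mod_ring mpoly ext) =
    (if card T = 1 then ygen i ^ (CARD('p) ^ the_elem T) else 0)"
proof (cases "card T = 1")
  case True
  then obtain t where T: "T = {t}" using card_1_singletonE by blast
  have "milnor_coeff n T (xgen i :: 'p mod_ring mpoly ext) =
      (\<Sum>l<n. ygen l ^ (CARD('p) ^ t) * ext_coeff (xgen i) {l})"
    unfolding T by (rule milnor_coeff_singleton)
  also have "\<dots> = (\<Sum>l<n. if l = i then (ygen i :: 'p mod_ring mpoly) ^ (CARD('p) ^ t) else 0)"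
    by (rule sum.cong) (auto simp: ext_coeff_xgen)
  finally show ?thesis using True assms(3) T by simp
next
  case False
  have "0 dvd milnor_coeff n T (xgen i :: 'p mod_ring mpoly ext)"
  proof (rule milnor_coeff_dvd[OF assms(1)])
    fix S :: "nat set" assume "card S = card T"
    then have "S \<noteq> {i}" using False by auto
    then show "0 dvd ext_coeff (xgen i :: 'p mod_ring mpoly ext) S" by (simp add: ext_coeff_xgen)
  qed
  then show ?thesis using False by simp
qed

lemma milnor_coeff_const:
  assumes "finite T" "T \<noteq> {}"
  shows "milnor_coeff n T (ext_const c :: 'p::prime_card mod_ring mpoly ext) = 0"
proof -
  have "0 dvd milnor_coeff n T (ext_const c)"
  proof (rule milnor_coeff_dvd[OF assms(1)])
    fix S :: "nat set" assume "finite S" "card S = card T"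
    then have "S \<noteq> {}" using assms by auto
    then show "0 dvd ext_coeff (ext_const c) S" by (simp add: ext_coeff_const)
  qed
  then show ?thesis by simp
qed

section \<open>Existence and uniqueness of the coefficients of an invariant\<close>

locale parabolic_cohomology =
  fixes n :: nat and p :: nat and FI :: "'p::prime_card mod_ring mpoly set"
    and I :: "nat set set" and B :: "nat set \<Rightarrow> 'p mod_ring mpoly ext" and x :: "'p mod_ring mpoly ext"
  assumes p: "p = CARD('p)" and odd: "odd p" and n: "2 \<le> n"
    and FI: "FI = poly_invariants n (parabolic 1 (n - 1))"
    and I: "I = {T. T \<subseteq> {..<n} \<and> T \<noteq> {} \<and> 1 \<le> Max T}"
    and B: "B = (\<lambda>T. mui_M n T * ext_const (mui_L n ^ (p - 2)))"
    and x: "x = mui_M 1 {0} * ext_const (mui_h 0 ^ (p - 2))"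
begin

lemma odd_CARD: "odd CARD('p)"
  using odd p by simp

lemma p_ge_3: "3 \<le> p"
  using odd CARD_gt_1[where 'p = 'p] unfolding p by (cases "CARD('p) = 2") auto

text \<open>Among the nonempty sets the condition on the maximum rules out \<open>{0}\<close> alone,
  which is the form in which it is used.\<close>

lemma I_iff: "T \<in> I \<longleftrightarrow> T \<subseteq> {..<n} \<and> T \<noteq> {} \<and> T \<noteq> {0}"
proof
  assume "T \<in> I"
  then show "T \<subseteq> {..<n} \<and> T \<noteq> {} \<and> T \<noteq> {0}" unfolding I by auto
next
  assume T: "T \<subseteq> {..<n} \<and> T \<noteq> {} \<and> T \<noteq> {0}"
  then have "\<not> T \<subseteq> {0}" by (simp add: subset_singleton_iff)
  then obtain t where t: "t \<in> T" "t \<noteq> 0" by auto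
  have "finite T" by (rule finite_subset[of T "{..<n}"]) (use T in simp_all)
  then have "t \<le> Max T" using t(1) by (rule Max_ge)
  then have "1 \<le> Max T" using t(2) by linarith
  then show "T \<in> I" unfolding I mem_Collect_eq using T by (intro conjI) simp_all
qed

lemma finite_I: "finite I"
  unfolding I by simp

lemma x_eq: "x = ext_const (ygen 0 ^ (p - 2)) * xgen 0"
  unfolding x mui_M_1 mui_h_0 by (rule ext_const_commute)

lemma B_eq: "B T = ext_const (mui_L n ^ (p - 2)) * mui_M n T"
  unfolding B by (rule ext_const_commute)

lemma x_invariant: "x \<in> cohom_invariants n (parabolic 1 (n - 1))"
  unfolding x p by (rule line_form_invariant[OF odd_CARD]) (use n in simp)

lemma B_invariant: "T \<in> I \<Longrightarrow> B T \<in> cohom_invariants n (parabolic 1 (n - 1))"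
  unfolding B p by (rule mui_M_invariant[OF odd_CARD]) (use n I_iff[of T] in auto)

lemma parabolic_carrier: "parabolic 1 (n - 1) \<subseteq> (carrier_mat n n :: 'p mod_ring mat set)"
  using parabolicD(1)[of _ n] n by auto

definition combination :: "'p mod_ring mpoly \<times> 'p mod_ring mpoly \<times> (nat set \<Rightarrow> 'p mod_ring mpoly) \<Rightarrow> 'p mod_ring mpoly ext" where
  "combination = (\<lambda>(a, b, c). ext_const a + ext_const b * x + (\<Sum>T\<in>I. ext_const (c T) * B T))"

lemma mui_L_nonzero: "mui_L n \<noteq> (0 :: 'p mod_ring mpoly)"
  by (simp add: mui_L_def)

lemma milnor_coeff_B:
  assumes "T \<subseteq> {..<n}" "T' \<in> I"
  shows "T \<noteq> T' \<Longrightarrow> milnor_coeff n T (B T') = 0"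
    and "T = T' \<Longrightarrow> milnor_coeff n T (B T') \<noteq> 0"
proof -
  have T': "T' \<subseteq> {..<n}" using assms(2) I_iff by blast
  show "milnor_coeff n T (B T') = 0" if "T \<noteq> T'"
    unfolding B_eq milnor_coeff_const_mult milnor_coeff_mui_M_eq_0[OF odd_CARD assms(1) T' that] by simp
  show "milnor_coeff n T (B T') \<noteq> 0" if "T = T'"
  proof -
    obtain s :: "'p mod_ring mpoly" where "s * s = 1" "milnor_coeff n T' (mui_M n T') = s * mui_L n"
      using milnor_coeff_mui_M_self[OF odd_CARD T'] by blast
    moreover from this have "s \<noteq> 0" by auto
    ultimately show ?thesis using that mui_L_nonzero by (simp add: B_eq milnor_coeff_const_mult)
  qed
qed

lemma milnor_coeff_x:
  assumes "T \<subseteq> {..<n}" "T \<noteq> {}"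
  shows "milnor_coeff n T x = (if card T = 1 then ygen 0 ^ (p - 2) * ygen 0 ^ (p ^ the_elem T) else 0)"
  using assms n finite_subset[OF assms(1)] by (simp add: x_eq milnor_coeff_const_mult milnor_coeff_xgen p)

lemma milnor_coeff_x_empty: "milnor_coeff n {} x = 0"
  by (simp add: x_eq ext_coeff_xgen)

text \<open>The functionals are triangular on the proposed basis: \<open>{}\<close> sees only
  \<open>a\<close>, \<open>{0}\<close> sees \<open>b\<close> but no \<open>B T\<close>, and after
  that each \<open>T\<close> in \<open>I\<close> isolates \<open>c T\<close>.\<close>

lemma combination_eq_0:
  assumes "combination (a, b, c) = 0"
  shows "a = 0" "b = 0" "T \<in> I \<Longrightarrow> c T = 0"
proof -
  have z: "milnor_coeff n T (ext_const a) + b * milnor_coeff n T x + (\<Sum>T'\<in>I. c T' * milnor_coeff n T (B T')) = 0" for T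
  proof -
    have "milnor_coeff n T (combination (a, b, c)) = 0" unfolding assms by (simp add: milnor_coeff_def milnor_def)
    then show ?thesis by (simp add: combination_def milnor_coeff_add milnor_coeff_sum milnor_coeff_const_mult)
  qed
  have s: "(\<Sum>T'\<in>I. c T' * milnor_coeff n T (B T')) = (if T \<in> I then c T * milnor_coeff n T (B T) else 0)"
    if "T \<subseteq> {..<n}" for T
  proof -
    have "(\<Sum>T'\<in>I. c T' * milnor_coeff n T (B T')) = (\<Sum>T'\<in>I. if T' = T then c T * milnor_coeff n T (B T) else 0)"
      by (rule sum.cong) (use milnor_coeff_B(1)[OF that] in auto)
    then show ?thesis using finite_I by simp
  qed
  have "{} \<notin> I" "{0} \<notin> I" by (simp_all add: I_iff)
  then show "a = 0" using z[of "{}"] s[of "{}"] by (simp add: milnor_coeff_x_empty[unfolded milnor_coeff_empty] ext_coeff_const)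
  have "b * (ygen 0 ^ (p - 2) * ygen 0) = 0"
    using z[of "{0}"] s[of "{0}"] \<open>{0} \<notin> I\<close> n by (simp add: milnor_coeff_x milnor_coeff_const)
  then show b: "b = 0" by simp
  assume T: "T \<in> I"
  then have T': "T \<subseteq> {..<n}" "T \<noteq> {}" "finite T" using I_iff[of T] finite_subset[of T "{..<n}"] by auto
  have "c T * milnor_coeff n T (B T) = 0"
    using z[of T] s[OF T'(1)] T b T' by (simp add: milnor_coeff_const)
  then show "c T = 0" using milnor_coeff_B(2)[OF T'(1) T] by simp
qed

lemma combination_diff:
  "combination (a, b, c) - combination (a', b', c') = combination (a - a', b - b', \<lambda>T. c T - c' T)"
  by (simp add: combination_def ext_const_diff left_diff_distrib sum_subtractf)

lemma combination_inj: "inj_on combination (FI \<times> FI \<times> (I \<rightarrow>\<^sub>E FI))"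
proof (rule inj_onI)
  fix u v assume uv: "u \<in> FI \<times> FI \<times> (I \<rightarrow>\<^sub>E FI)" "v \<in> FI \<times> FI \<times> (I \<rightarrow>\<^sub>E FI)" "combination u = combination v"
  obtain a b c where eu: "u = (a, b, c)" by (rule prod_cases3[of u])
  obtain a' b' c' where ev: "v = (a', b', c')" by (rule prod_cases3[of v])
  note e = eu ev
  have "combination (a - a', b - b', \<lambda>T. c T - c' T) = 0"
    using uv(3) unfolding e combination_diff[symmetric] by simp
  from combination_eq_0[OF this] have "a = a'" "b = b'" "\<And>T. T \<in> I \<Longrightarrow> c T = c' T" by auto
  moreover have "c = c'"
    by (rule PiE_ext[of c I "\<lambda>_. FI" c']) (use uv e calculation in auto)
  ultimately show "u = v" using e by simp
qed

lemma combination_invariant: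
  assumes "u \<in> FI \<times> FI \<times> (I \<rightarrow>\<^sub>E FI)"
  shows "combination u \<in> cohom_invariants n (parabolic 1 (n - 1))"
proof -
  obtain a b c where u: "u = (a, b, c)" "a \<in> FI" "b \<in> FI" "c \<in> I \<rightarrow>\<^sub>E FI" using assms by auto
  have "c T \<in> FI" if "T \<in> I" for T using u(4) that by auto
  then show ?thesis
    using u unfolding u(1) combination_def prod.case FI
    by (intro cohom_invariants_add cohom_invariants_const cohom_invariants_const_mult
        cohom_invariants_sum x_invariant B_invariant) auto
qed

lemma ygen_prime: "prime_elem (ygen i :: 'p mod_ring mpoly)"
  using prime_elem_lin_form[of 0 "{}" i] by simp

lemma ygen_not_dvd_ygen: "i \<noteq> j \<Longrightarrow> \<not> ygen i dvd (ygen j :: 'p mod_ring mpoly)"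
  using lin_form_dvd_iff[of 0 "{}" i "ygen j :: 'p mod_ring mpoly"] by simp

lemma combination_surj:
  assumes f: "f \<in> cohom_invariants n (parabolic 1 (n - 1))"
  shows "\<exists>u\<in>FI \<times> FI \<times> (I \<rightarrow>\<^sub>E FI). combination u = f"
proof -
  have coeff_FI: "milnor_coeff n T h \<in> FI" if "h \<in> cohom_invariants n (parabolic 1 (n - 1))" for T h
    unfolding FI by (rule milnor_coeff_invariant[OF that parabolic_carrier])
  have y0: "ygen 0 ^ (p - 1) \<in> FI"
    using parabolic_gens_invariant[of n 0] n unfolding FI parabolic_gens_def p by simp
  define a where "a = milnor_coeff n {} f"
  have aFI: "a \<in> FI" unfolding a_def by (rule coeff_FI[OF f])
  have "ygen 0 dvd milnor_coeff n {0} f"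
  proof (rule milnor_coeff_dvd)
    fix S :: "nat set" assume "finite S" "card S = card {0::nat}"
    then have "S \<noteq> {}" by auto
    then show "ygen 0 dvd ext_coeff f S" using ygen_dvd_coeff[OF odd_CARD f] n by simp
  qed simp
  moreover have "milnor_coeff n {0} f \<in> elem_inv 1 0 n"
    using coeff_FI[OF f] poly_invariants_elem_inv[of n] unfolding FI by blast
  ultimately have "ygen 0 ^ (p - 1) dvd milnor_coeff n {0} f"
    unfolding p using n by (intro elem_inv_var0_dvd[of _ 1 0 n]) (auto simp: ygen_dvd_iff_var0)
  \<comment> \<open>\<open>y_0^(p-1)\<close> is the value of this functional on \<open>x\<close>, so
    \<open>b\<close> is the coefficient that \<open>x\<close> must have.\<close>
  then obtain b where b: "milnor_coeff n {0} f = ygen 0 ^ (p - 1) * b" by blast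
  have bFI: "b \<in> FI"
    using poly_invariants_quotient[of "ygen 0 ^ (p - 1)" b] coeff_FI[OF f, of "{0}"] y0 unfolding b FI by simp
  define f1 where "f1 = f - ext_const a - ext_const b * x"
  have f1: "f1 \<in> cohom_invariants n (parabolic 1 (n - 1))"
    unfolding f1_def using f aFI bFI unfolding FI
    by (intro cohom_invariants_diff cohom_invariants_const cohom_invariants_const_mult x_invariant) auto
  have f1c: "f1 \<in> cohom n" using f1 by (simp add: cohom_invariants_def)
  have p2: "Suc (p - 2) = p - 1" using p_ge_3 by simp
  have g0: "milnor_coeff n {} f1 = 0"
    by (simp add: f1_def a_def x_eq ext_coeff_const ext_coeff_xgen)
  have g1: "milnor_coeff n {0} f1 = 0"
    using n p2 b by (simp add: f1_def milnor_coeff_diff milnor_coeff_const_mult milnor_coeff_const milnor_coeff_x flip: power_Suc2)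
  have dvd0: "ygen 0 dvd ext_coeff f1 S" if "S \<noteq> {}" for S
    using ygen_dvd_coeff[OF odd_CARD f1, of 0 S] n that by simp
  \<comment> \<open>The case \<open>S = {0}\<close> is the gap left by
    \<open>ygen_dvd_coeff\<close>. It is closed by \<open>g1\<close>: \<open>y_0\<close> times the
    coefficient at \<open>x_0\<close> equals minus a sum of terms divisible by
    \<open>y_{n-1}\<close>, and this prime does not divide \<open>y_0\<close>.\<close>
  have dvdn: "ygen (n - 1) dvd ext_coeff f1 S" if S: "S \<noteq> {}" for S
  proof (cases "S = {0}")
    case False
    then show ?thesis using ygen_dvd_coeff[OF odd_CARD f1, of "n - 1" S] n S by simp
  next
    case True
    have "0 = (\<Sum>i<n. ygen i * ext_coeff f1 {i})"
      using g1 unfolding milnor_coeff_singleton by simp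
    also have "\<dots> = ygen 0 * ext_coeff f1 {0} + (\<Sum>i\<in>{1..<n}. ygen i * ext_coeff f1 {i})"
      using n by (intro sum_lessThan_split_first) simp
    finally have "ygen 0 * ext_coeff f1 {0} = - (\<Sum>i\<in>{1..<n}. ygen i * ext_coeff f1 {i})"
      by (simp add: eq_neg_iff_add_eq_0)
    moreover have "ygen (n - 1) dvd (\<Sum>i\<in>{1..<n}. ygen i * ext_coeff f1 {i})"
      by (intro dvd_sum dvd_mult ygen_dvd_coeff[OF odd_CARD f1]) (use n in auto)
    ultimately have "ygen (n - 1) dvd ygen 0 * ext_coeff f1 {0}" by simp
    moreover have "\<not> ygen (n - 1) dvd (ygen 0 :: 'p mod_ring mpoly)"
      by (rule ygen_not_dvd_ygen) (use n in simp)
    ultimately show ?thesis using prime_elem_dvd_multD[OF ygen_prime] True by blast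
  qed
  have Lp: "mui_L n ^ (p - 1) \<noteq> (0 :: 'p mod_ring mpoly)" using mui_L_nonzero by simp
  have "\<exists>d\<in>FI. milnor_coeff n T f1 = mui_L n ^ (p - 1) * d" if T: "T \<in> I" for T
  proof -
    have T': "T \<subseteq> {..<n}" "T \<noteq> {}" "finite T" using T I_iff[of T] finite_subset[of T "{..<n}"] by auto
    have ne: "S \<noteq> {}" if "finite S" "card S = card T" for S :: "nat set"
      using that T' by auto
    have gFI: "milnor_coeff n T f1 \<in> FI" by (rule coeff_FI[OF f1])
    have "mui_L n ^ (p - 1) dvd milnor_coeff n T f1"
      unfolding p
    proof (rule mui_L_power_dvd)
      show "milnor_coeff n T f1 \<in> poly_invariants n (parabolic 1 (n - 1))" using gFI unfolding FI .
      show "ygen 0 dvd milnor_coeff n T f1" "ygen (n - 1) dvd milnor_coeff n T f1"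
        by (rule milnor_coeff_dvd[OF T'(3)], rule dvd0, rule ne, assumption+)
          (rule milnor_coeff_dvd[OF T'(3)], rule dvdn, rule ne, assumption+)
    qed (rule n)
    then obtain d where d: "milnor_coeff n T f1 = mui_L n ^ (p - 1) * d" by blast
    \<comment> \<open>The divisor is itself invariant, so the quotient lies in \<open>FI\<close> and
      not merely in the polynomial ring.\<close>
    have "mui_L n ^ (p - 1) \<in> poly_invariants n (parabolic 1 (n - 1) :: 'p mod_ring mat set)"
    proof -
      have "poly_act a (mui_L n ^ (p - 1)) = mui_L n ^ (p - 1)" if a: "a \<in> parabolic 1 (n - 1)" for a :: "'p mod_ring mat"
      proof -
        have "1 \<le> n" using n by simp
        obtain \<delta> where "\<delta> \<noteq> 0" "poly_act a (mui_L n) = mconst \<delta> * mui_L n"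
          using parabolic_det_char[OF odd_CARD a \<open>1 \<le> n\<close>] by blast
        then show ?thesis using mconst_power_CARD_minus_1[of \<delta>]
          by (simp add: poly_act_eq msubst_power power_mult_distrib p)
      qed
      then show ?thesis by (simp add: poly_invariants_def poly_ring_eq_vpoly vpoly_power mui_L_vpoly)
    qed
    then have "d \<in> FI" using poly_invariants_quotient[of "mui_L n ^ (p - 1)" d] gFI Lp unfolding d FI by simp
    with d show ?thesis by blast
  qed
  then obtain d where d: "\<And>T. T \<in> I \<Longrightarrow> d T \<in> FI" "\<And>T. T \<in> I \<Longrightarrow> milnor_coeff n T f1 = mui_L n ^ (p - 1) * d T"
    by metis
  obtain s :: "nat set \<Rightarrow> 'p mod_ring mpoly" where s: "\<And>T. s T \<in> {1, -1}"
    "ext_const (mui_L n) * f1 = (\<Sum>T\<in>Pow {..<n}. ext_const (s T * milnor_coeff n T f1) * mui_M n T)"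
    using milnor_expansion[OF odd_CARD f1c] by blast
  \<comment> \<open>Restriction makes \<open>c\<close> extensional outside \<open>I\<close>, as
    membership in \<open>PiE\<close> demands.\<close>
  define c where "c = restrict (\<lambda>T. s T * d T) I"
  have "ext_const (mui_L n) * f1 = (\<Sum>T\<in>I. ext_const (s T * milnor_coeff n T f1) * mui_M n T)"
    unfolding s(2)
  proof (rule sum.mono_neutral_right)
    show "\<forall>T\<in>Pow {..<n} - I. ext_const (s T * milnor_coeff n T f1) * mui_M n T = 0"
    proof
      fix T assume "T \<in> Pow {..<n} - I"
      then have "T = {} \<or> T = {0}" using I_iff[of T] by auto
      then have "milnor_coeff n T f1 = 0" using g0 g1 by auto
      then show "ext_const (s T * milnor_coeff n T f1) * mui_M n T = 0" by simp
    qed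
    show "I \<subseteq> Pow {..<n}" unfolding I by auto
  qed simp
  also have "\<dots> = ext_const (mui_L n) * (\<Sum>T\<in>I. ext_const (c T) * B T)"
    unfolding sum_distrib_left
  proof (rule sum.cong[OF refl])
    fix T assume T: "T \<in> I"
    \<comment> \<open>\<open>L_n^(p-1)\<close> splits into the factor \<open>L_n\<close> of the
      expansion, to be cancelled below, and the factor \<open>L_n^(p-2)\<close> contained in
      \<open>B T\<close>.\<close>
    have "s T * milnor_coeff n T f1 = mui_L n * (c T * mui_L n ^ (p - 2))"
      using d(2)[OF T] T p2 by (simp add: c_def mult_ac flip: power_Suc)
    then show "ext_const (s T * milnor_coeff n T f1) * mui_M n T = ext_const (mui_L n) * (ext_const (c T) * B T)"
      by (simp add: B_eq ext_const_mult mult.assoc)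
  qed
  finally have eq: "ext_const (mui_L n) * f1 = ext_const (mui_L n) * (\<Sum>T\<in>I. ext_const (c T) * B T)" .
  have "f1 = (\<Sum>T\<in>I. ext_const (c T) * B T)"
  proof (rule ext_eqI)
    fix S
    have "mui_L n * ext_coeff f1 S = mui_L n * ext_coeff (\<Sum>T\<in>I. ext_const (c T) * B T) S"
      by (simp only: ext_coeff_const_mult[symmetric] eq)
    then show "ext_coeff f1 S = ext_coeff (\<Sum>T\<in>I. ext_const (c T) * B T) S" using mui_L_nonzero by simp
  qed
  then have "combination (a, b, c) = f" by (simp add: combination_def f1_def algebra_simps)
  moreover have "c \<in> I \<rightarrow>\<^sub>E FI"
  proof (rule PiE_I)
    fix T assume T: "T \<in> I"
    have "s T * d T = d T \<or> s T * d T = - d T" using s(1)[of T] by auto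
    then show "c T \<in> FI" using d(1)[OF T] T poly_invariants_uminus unfolding FI by (auto simp: c_def)
  qed (simp add: c_def)
  ultimately show ?thesis using aFI bFI by blast
qed

lemma combination_bij:
  "bij_betw combination (FI \<times> FI \<times> (I \<rightarrow>\<^sub>E FI)) (cohom_invariants n (parabolic 1 (n - 1)))"
  unfolding bij_betw_def
proof (intro conjI combination_inj subset_antisym subsetI)
  fix f assume "f \<in> combination ` (FI \<times> FI \<times> (I \<rightarrow>\<^sub>E FI))"
  then show "f \<in> cohom_invariants n (parabolic 1 (n - 1))" using combination_invariant by blast
next
  fix f :: "'p mod_ring mpoly ext" assume "f \<in> cohom_invariants n (parabolic 1 (n - 1))"
  then show "f \<in> combination ` (FI \<times> FI \<times> (I \<rightarrow>\<^sub>E FI))" using combination_surj by blast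
qed

end

text \<open>Coefficient families are extensional functions on the index set, so bijectivity says
  that every invariant has exactly one family of coefficients. This expresses the direct sum and the
  freeness at once; likewise \<open>inj_on\<close> expresses algebraic independence of the
  generators.\<close>

theorem proposition23:
  fixes n p :: nat
    and FI :: "'p::prime_card mod_ring mpoly set"
    and gens :: "nat \<Rightarrow> 'p mod_ring mpoly"
  assumes "p = CARD('p)" and "odd p" and "n \<ge> 2"
    and "FI = poly_invariants n (parabolic 1 (n - 1))"
    and "gens = (\<lambda>i. if i = 0 then mui_h 0 ^ (p - 1) else dickson_I n i)"
  shows "FI = msubst gens ` poly_ring n \<and>
    inj_on (msubst gens) (poly_ring n) \<and>
    bij_betw
      (\<lambda>(a, b, c). ext_const a
         + ext_const b * (mui_M 1 {0} * ext_const (mui_h 0 ^ (p - 2)))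
         + (\<Sum>T | T \<subseteq> {..<n} \<and> T \<noteq> {} \<and> 1 \<le> Max T.
              ext_const (c T) * (mui_M n T * ext_const (mui_L n ^ (p - 2)))))
      (FI \<times> FI \<times> ({T. T \<subseteq> {..<n} \<and> T \<noteq> {} \<and> 1 \<le> Max T} \<rightarrow>\<^sub>E FI))
      (cohom_invariants n (parabolic 1 (n - 1)))"
proof -
  interpret parabolic_cohomology n p FI "{T. T \<subseteq> {..<n} \<and> T \<noteq> {} \<and> 1 \<le> Max T}"
    "\<lambda>T. mui_M n T * ext_const (mui_L n ^ (p - 2))" "mui_M 1 {0} * ext_const (mui_h 0 ^ (p - 2))"
    by (unfold_locales; (rule refl | fact assms))
  have "gens = parabolic_gens n"
    by (simp add: assms(1,5) parabolic_gens_def fun_eq_iff)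
  then have "FI = msubst gens ` poly_ring n" "inj_on (msubst gens) (poly_ring n)"
    using parabolic_invariants_generated[OF assms(3)] parabolic_gens_independent[OF assms(3)] assms(4)
    by simp_all
  with combination_bij[unfolded combination_def] show ?thesis by (intro conjI)
qed

end
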